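(* Let $a>0$, let $A$ be the generator of a $C_0$-semigroup $(T(t))_{t\ge 0}$ on a Banach space $X$, and let $u_0\in X$. Let $u:[0,\infty)\to X$ be the (exponentially bounded) solution of the abstract telegraph equation $$u''(t)+2a\,u'(t)=Au(t)\quad (t>0),\qquad u(0)=u_0,\quad u'(0)=0.$$ Then the solution $v$ of the abstract diffusion equation $$v'(t)=Av(t)\quad (t>0),\qquad v(0)=u_0,$$ can be represented as $$v(t)=\int_0^{\infty}p_\mu(s,t)\,u(s)\,ds,\qquad t>0,$$ where $p_\mu(\cdot,t)$ is the probability density of the inverse subordinator $\mathbf{E}_\mu(t)$ with Laplace exponent $\mu(\lambda)=-a+\sqrt{\lambda+a^2}$.
   Context: A subordinator is a one-dimensional Lévy process with values in $[0,\infty)$ that is almost surely nondecreasing and starts at $0$. The function $\mu(\lambda)=-a+\sqrt{\lambda+a^2}$, $\lambda>0$, is a Bernstein function with $\mu(0+)=0$. Hence there is a subordinator $\mathbf{D}_\mu(t)$ with $\mathbb{E}(e^{-\lambda \mathbf{D}_\mu(t)})=e^{-t\mu(\lambda)}$. For $s,t>0$, the variable $\mathbf{D}_\mu(t)$ has density $s\mapsto q_\mu(s,t)=\frac{t s^{-3/2}}{2\sqrt{\pi}}e^{at-a^2s-\frac{t^2}{4s}}$. The inverse subordinator is $\mathbf{E}_\mu(t)=\inf\{z>0:\mathbf{D}_\mu(z)>t\}$, and $s\mapsto p_\mu(s,t)$ denotes its Lebesgue density on $(0,\infty)$, that is, $p_\mu(s,t)=\frac{d}{ds}P(\mathbf{D}_\mu(s)\ge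 t)$. Its Laplace transform in $t$ is $$\int_0^\infty e^{-\lambda t}p_\mu(s,t)\,dt=\frac{\mu(\lambda)}{\lambda}e^{-s\mu(\lambda)},\qquad \lambda>0,\ s>0.$$ Convention on solutions. An exponentially bounded function $u$ is one with $\|u(t)\|\le Me^{\omega t}$ for all $t\ge0$, for some constants $M>0$, $\omega\in\mathbb{R}$. A solution of the telegraph problem is an exponentially bounded continuous function $u:[0,\infty)\to X$ such that, with $k(t)=\frac{1-e^{-2at}}{2a}$, for all $t\ge 0$ one has $\int_0^t k(t-s)u(s)\,ds\in D(A)$ and $u(t)=u_0+A\int_0^t k(t-s)u(s)\,ds$. This is the integrated form of the telegraph problem, and exponentially bounded classical solutions satisfy it. The solution of the diffusion problem is $v(t)=T(t)u_0$. The $X$-valued integrals are Bochner integrals. *)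

theory Defs
  imports "HOL-Probability.Probability"
begin

section \<open>Bochner integral in an arbitrary Banach space\<close>

text \<open>
  The library relation has_bochner_integral is restricted to second countable (that is, separable)
  range spaces, and a Banach space need not be separable.  The following is the library definition
  without that sort constraint.  In the nonseparable case, the L1-approximation by simple functions
  makes the Borel measurable function f strongly measurable, so this is the usual Bochner integral.
\<close>

definition has_Bochner_integral ::
  "'b measure \<Rightarrow> ('b \<Rightarrow> 'a::real_normed_vector) \<Rightarrow> 'a \<Rightarrow> bool" where
  "has_Bochner_integral M f x \<longleftrightarrow>
     f \<in> borel_measurable M \<and>
     (\<exists>s. (\<forall>i. Bochner_Integration.simple_bochner_integrable M (s i)) \<and>
          (\<lambda>i. \<integral>\<^sup>+ w. ennreal (norm (f w - s i w)) \<partial>M) \<longlonglongrightarrow> 0 \<and>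
          (\<lambda>i. Bochner_Integration.simple_bochner_integral M (s i)) \<longlonglongrightarrow> x)"

lemma has_Bochner_integral_second_countable:
  fixes f :: "'b \<Rightarrow> 'a::{real_normed_vector, second_countable_topology}"
  shows "has_Bochner_integral M f x \<longleftrightarrow> has_bochner_integral M f x"
  unfolding has_Bochner_integral_def Bochner_Integration.has_bochner_integral.simps by auto

abbreviation has_Bochner_integral_on ::
  "(real \<Rightarrow> 'a::real_normed_vector) \<Rightarrow> real set \<Rightarrow> 'a \<Rightarrow> bool" where
  "has_Bochner_integral_on f S x \<equiv> has_Bochner_integral lborel (\<lambda>s. indicat_real S s *\<^sub>R f s) x"

section \<open>Semigroups and generators\<close>

text \<open>
  Time is indexed by the reals; only nonnegative times are constrained.  Likewise an unbounded
  operator is a domain together with a total function, of which only the values on the domain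
  are relevant.
\<close>

definition C0_semigroup :: "(real \<Rightarrow> 'a::banach \<Rightarrow>\<^sub>L 'a) \<Rightarrow> bool" where
  "C0_semigroup T \<longleftrightarrow>
     T 0 = id_blinfun \<and>
     (\<forall>s\<ge>0. \<forall>t\<ge>0. T (s + t) = T s o\<^sub>L T t) \<and>
     (\<forall>x. ((\<lambda>t. T t x) \<longlongrightarrow> x) (at_right 0))"

definition is_generator ::
  "(real \<Rightarrow> 'a::banach \<Rightarrow>\<^sub>L 'a) \<Rightarrow> 'a set \<Rightarrow> ('a \<Rightarrow> 'a) \<Rightarrow> bool" where
  "is_generator T DA A \<longleftrightarrow>
     DA = {x. \<exists>y. ((\<lambda>h. (T h x - x) /\<^sub>R h) \<longlongrightarrow> y) (at_right 0)} \<and>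
     (\<forall>x\<in>DA. ((\<lambda>h. (T h x - x) /\<^sub>R h) \<longlongrightarrow> A x) (at_right 0))"

section \<open>The telegraph problem\<close>

definition exponentially_bounded :: "(real \<Rightarrow> 'a::real_normed_vector) \<Rightarrow> bool" where
  "exponentially_bounded u \<longleftrightarrow> (\<exists>K>0. \<exists>\<omega>. \<forall>t\<ge>0. norm (u t) \<le> K * exp (\<omega> * t))"

definition telegraph_kernel :: "real \<Rightarrow> real \<Rightarrow> real" where
  "telegraph_kernel a t = (1 - exp (- 2 * a * t)) / (2 * a)"

text \<open>
  Integrated form of u'' + 2 a u' = A u, u(0) = u0, u'(0) = 0: the kernel k satisfies
  k'' + 2 a k' = 0, k(0) = 0, k'(0) = 1.
\<close>

definition telegraph_solution ::
  "real \<Rightarrow> 'a::banach set \<Rightarrow> ('a \<Rightarrow> 'a) \<Rightarrow> 'a \<Rightarrow> (real \<Rightarrow> 'a) \<Rightarrow> bool" where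
  "telegraph_solution a DA A u0 u \<longleftrightarrow>
     continuous_on {0..} u \<and> exponentially_bounded u \<and>
     (\<forall>t\<ge>0. \<exists>y\<in>DA.
        has_Bochner_integral_on (\<lambda>s. telegraph_kernel a (t - s) *\<^sub>R u s) {0..t} y \<and>
        u t = u0 + A y)"

section \<open>Subordinators and their inverses\<close>

definition levy_process :: "'w measure \<Rightarrow> (real \<Rightarrow> 'w \<Rightarrow> real) \<Rightarrow> bool" where
  "levy_process M X \<longleftrightarrow>
     prob_space M \<and>
     (\<forall>t\<ge>0. X t \<in> borel_measurable M) \<and>
     (AE w in M. X 0 w = 0) \<and>
     (\<forall>n (\<tau> :: nat \<Rightarrow> real). 0 \<le> \<tau> 0 \<longrightarrow> (\<forall>i<n. \<tau> i \<le> \<tau> (Suc i)) \<longrightarrow>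
        prob_space.indep_vars M (\<lambda>_. borel) (\<lambda>i w. X (\<tau> (Suc i)) w - X (\<tau> i) w) {..<n}) \<and>
     (\<forall>s\<ge>0. \<forall>t\<ge>0. distr M borel (\<lambda>w. X (s + t) w - X s w) = distr M borel (X t)) \<and>
     (\<forall>s\<ge>0. \<forall>\<epsilon>>0. ((\<lambda>t. measure M {w\<in>space M. \<epsilon> \<le> \<bar>X t w - X s w\<bar>}) \<longlongrightarrow> 0) (at s within {0..})) \<and>
     (AE w in M. (\<forall>t\<ge>0. ((\<lambda>s. X s w) \<longlongrightarrow> X t w) (at_right t)) \<and>
                 (\<forall>t>0. \<exists>l. ((\<lambda>s. X s w) \<longlongrightarrow> l) (at_left t)))"

definition subordinator :: "'w measure \<Rightarrow> (real \<Rightarrow> 'w \<Rightarrow> real) \<Rightarrow> bool" where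
  "subordinator M D \<longleftrightarrow>
     levy_process M D \<and>
     (\<forall>t\<ge>0. \<forall>w\<in>space M. 0 \<le> D t w) \<and>
     (AE w in M. mono_on {0..} (\<lambda>t. D t w))"

definition has_laplace_exponent ::
  "'w measure \<Rightarrow> (real \<Rightarrow> 'w \<Rightarrow> real) \<Rightarrow> (real \<Rightarrow> real) \<Rightarrow> bool" where
  "has_laplace_exponent M D \<mu> \<longleftrightarrow>
     (\<forall>t\<ge>0. \<forall>l>0. (\<integral>w. exp (- l * D t w) \<partial>M) = exp (- t * \<mu> l))"

text \<open>
  The infimum is real-valued.  If D stays below t forever, the set is empty and the value is an
  unspecified real; for the subordinators considered here this is an event of probability zero,
  since exp (- s * \<mu> l) tends to 0 as s grows.
\<close>

definition inverse_subordinator :: "(real \<Rightarrow> 'w \<Rightarrow> real) \<Rightarrow> real \<Rightarrow> 'w \<Rightarrow> real" where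
  "inverse_subordinator D t w = Inf {z. 0 < z \<and> t < D z w}"

text \<open>The function \<open>p(s, t) = d/ds P(D(s) \<ge> t)\<close>, meant for \<open>s > 0\<close> and \<open>t > 0\<close>.\<close>

definition inverse_density :: "'w measure \<Rightarrow> (real \<Rightarrow> 'w \<Rightarrow> real) \<Rightarrow> real \<Rightarrow> real \<Rightarrow> real" where
  "inverse_density M D s t = deriv (\<lambda>z. measure M {w\<in>space M. t \<le> D z w}) s"

text \<open>
  Since D is nondecreasing and right-continuous only almost surely, the inverse subordinator need
  only be measurable up to a null set; this is why its law is taken under the completion of M.
\<close>

definition is_inverse_density ::
  "'w measure \<Rightarrow> (real \<Rightarrow> 'w \<Rightarrow> real) \<Rightarrow> real \<Rightarrow> (real \<Rightarrow> real) \<Rightarrow> bool" where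
  "is_inverse_density M D t p \<longleftrightarrow>
     (\<forall>s>0. 0 \<le> p s) \<and>
     distributed (completion M) lborel (inverse_subordinator D t)
       (\<lambda>s. ennreal (indicat_real {0<..} s * p s))"

end

theory Submission
  imports Defs "HOL-Real_Asymp.Real_Asymp"
begin

text \<open>
  The theorem says that a pairing is conserved.  The density \<open>p(s, t)\<close> of the inverse subordinator
  is explicit, and it satisfies \<open>p_t = p_ss - 2 a p_s\<close>, the formal adjoint of the telegraph operator
  \<open>g'' + 2 a g'\<close>, together with the no-flux condition \<open>p_s = 2 a p\<close> at \<open>s = 0\<close>.  Since
  \<open>u'' + 2 a u' = A u\<close> and \<open>u'(0) = 0\<close>, two integrations by parts show that, formally,
  \<open>\<integral> p(s, r) T(t - r) u(s) ds\<close> does not depend on \<open>r \<in> (0, t]\<close>.  At \<open>r = t\<close> it is the integral in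
  the theorem.  As \<open>r\<close> tends to 0, the mass of \<open>p(\<cdot>, r)\<close> concentrates at \<open>s = 0\<close> and the
  value tends to \<open>T(t) u0 = v(t)\<close>.

  The computation needs more regularity than an integrated solution has.  It is therefore carried
  out for the scalar functions \<open>G(\<rho>, s) = \<integral>_\<rho>^(\<rho>+h) \<phi>(T(\<sigma>) u(s)) d\<sigma>\<close> with a bounded linear functional
  \<open>\<phi>\<close>.  Integrating the orbit in time removes the unbounded operator, because
  \<open>\<integral>_\<rho>^(\<rho>+h) T(\<sigma>) A y d\<sigma> = T(\<rho>+h) y - T(\<rho>) y\<close>, so that \<open>G\<close> is a classical solution of
  \<open>G_ss + 2 a G_s = G_\<rho>\<close> (\<open>orbit_average_telegraph\<close>).  The conservation law for such families
  is the locale theorem \<open>duality\<close>.  Dividing by \<open>h\<close> and letting \<open>h\<close> tend to 0 gives the formula under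
  \<open>\<phi>\<close> (\<open>functional_duality\<close>), and bounded linear functionals separate points by the Hahn-Banach
  theorem (\<open>functionals_separate\<close>).  In this way only the existence of the Bochner integral is a
  vector-valued question; it is settled by \<open>has_Bochner_integral_continuous\<close>.

  On the probabilistic side, the Laplace exponent identifies \<open>D(s)\<close> as inverse Gaussian.  The
  Laplace transform at the natural numbers gives the moments of \<open>exp (- D(s))\<close>, which takes values in
  the unit interval and is thus determined in law by them (\<open>moments_determine_law\<close>).  The distribution
  function of the inverse Gaussian law is elementary in terms of the error function, and
  differentiating \<open>P(D(s) \<ge> t)\<close> in \<open>s\<close> gives \<open>p\<close> (\<open>inverse_density_eq\<close>).  Finally, for
  \<open>b \<ge> 0\<close> the inverse subordinator is almost surely at most \<open>b\<close> exactly when \<open>D\<close> exceeds \<open>t\<close> at all times after \<open>b\<close>, so its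
  distribution function at \<open>b\<close> is \<open>P(D(b) \<ge> t)\<close> (\<open>inverse_subordinator_cdf\<close>).
\<close>

section \<open>Linear functionals separate points\<close>

definition sublinear :: "('a::real_vector \<Rightarrow> real) \<Rightarrow> bool" where
  "sublinear p \<longleftrightarrow> (\<forall>x y. p (x + y) \<le> p x + p y) \<and> (\<forall>c\<ge>0. \<forall>x. p (c *\<^sub>R x) = c * p x)"

lemma sublinearI:
  assumes add: "\<And>x y. p (x + y) \<le> p x + p y"
    and zero: "p 0 = 0"
    and scale: "\<And>c x. 0 < c \<Longrightarrow> p (c *\<^sub>R x) \<le> c * p x"
  shows "sublinear p"
  unfolding sublinear_def
proof (intro conjI allI impI add)
  fix c :: real and x assume "0 \<le> c"
  show "p (c *\<^sub>R x) = c * p x"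
  proof (cases "c = 0")
    case False
    then have c: "0 < c" using \<open>0 \<le> c\<close> by simp
    have "p ((1 / c) *\<^sub>R (c *\<^sub>R x)) \<le> (1 / c) * p (c *\<^sub>R x)"
      by (rule scale) (use c in simp)
    then have "c * p x \<le> p (c *\<^sub>R x)" using c by (simp add: field_simps)
    with scale[OF c, of x] show ?thesis by simp
  qed (simp add: zero)
qed

lemma sublinear_add: "sublinear p \<Longrightarrow> p (x + y) \<le> p x + p y"
  and sublinear_scaleR: "sublinear p \<Longrightarrow> 0 \<le> c \<Longrightarrow> p (c *\<^sub>R x) = c * p x"
  by (auto simp: sublinear_def)

lemma sublinear_zero: "sublinear p \<Longrightarrow> p 0 = 0"
  using sublinear_scaleR[of p 0 0] by simp

lemma sublinear_minus_le: "sublinear p \<Longrightarrow> - p (- x) \<le> p x"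
  using sublinear_add[of p x "- x"] sublinear_zero[of p] by simp

text \<open>
  Sliding \<open>p\<close> along \<open>y\<close> yields a smaller sublinear functional \<open>p'\<close> with \<open>p' x \<le> p (x + y) - p y\<close>
  (take \<open>t = 1\<close>).  If \<open>p\<close> is minimal then \<open>p = p'\<close>, and this inequality is the missing half of
  additivity.  The infimum is finite because subadditivity bounds the expression below by \<open>- p (- x)\<close>.
\<close>

lemma sublinear_slide:
  fixes p :: "'a::real_vector \<Rightarrow> real" and y :: 'a
  assumes p: "sublinear p"
  defines "p' \<equiv> \<lambda>x. INF t\<in>{0..}. p (x + t *\<^sub>R y) - t * p y"
  shows "sublinear p'" and "\<And>x t. 0 \<le> t \<Longrightarrow> p' x \<le> p (x + t *\<^sub>R y) - t * p y"
proof -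
  have bdd: "bdd_below ((\<lambda>t. p (x + t *\<^sub>R y) - t * p y) ` {0..})" for x
  proof (rule bdd_belowI2)
    fix t :: real assume "t \<in> {0..}"
    then have "t * p y = p (t *\<^sub>R y)" using sublinear_scaleR[OF p] by simp
    also have "\<dots> \<le> p (x + t *\<^sub>R y) + p (- x)"
      using sublinear_add[OF p, of "x + t *\<^sub>R y" "- x"] by simp
    finally show "- p (- x) \<le> p (x + t *\<^sub>R y) - t * p y" by simp
  qed
  show le: "p' x \<le> p (x + t *\<^sub>R y) - t * p y" if "0 \<le> t" for x t
    unfolding p'_def by (rule cINF_lower[OF bdd]) (use that in simp)
  have ge: "z \<le> p' x" if "\<And>t. 0 \<le> t \<Longrightarrow> z \<le> p (x + t *\<^sub>R y) - t * p y" for z x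
    unfolding p'_def by (rule cINF_greatest) (use that in auto)
  show "sublinear p'"
  proof (rule sublinearI)
    fix x x'
    have *: "p' (x + x') \<le> (p (x + s *\<^sub>R y) - s * p y) + (p (x' + t *\<^sub>R y) - t * p y)"
      if "0 \<le> s" "0 \<le> t" for s t
    proof -
      have "p' (x + x') \<le> p ((x + x') + (s + t) *\<^sub>R y) - (s + t) * p y"
        by (rule le) (use that in simp)
      also have "(x + x') + (s + t) *\<^sub>R y = (x + s *\<^sub>R y) + (x' + t *\<^sub>R y)"
        by (simp add: algebra_simps)
      finally show ?thesis
        using sublinear_add[OF p, of "x + s *\<^sub>R y" "x' + t *\<^sub>R y"] by (simp add: algebra_simps)
    qed
    have "p' (x + x') - (p (x + s *\<^sub>R y) - s * p y) \<le> p' x'" if "0 \<le> s" for s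
      by (rule ge) (use *[OF that] in \<open>simp add: algebra_simps\<close>)
    then have "p' (x + x') - p' x' \<le> p' x"
      by (intro ge) (simp add: algebra_simps)
    then show "p' (x + x') \<le> p' x + p' x'" by simp
  next
    have "p (t *\<^sub>R y) - t * p y = 0" if "0 \<le> t" for t
      using sublinear_scaleR[OF p that] by simp
    then show "p' 0 = 0"
      using le[of 0 0] by (intro antisym ge) (auto simp: sublinear_zero[OF p])
  next
    fix c :: real and x assume c: "0 < c"
    have "p' (c *\<^sub>R x) / c \<le> p' x"
    proof (rule ge)
      fix t :: real assume t: "0 \<le> t"
      have "p' (c *\<^sub>R x) \<le> p (c *\<^sub>R x + (c * t) *\<^sub>R y) - (c * t) * p y"
        by (rule le) (use c t in simp)
      also have "c *\<^sub>R x + (c * t) *\<^sub>R y = c *\<^sub>R (x + t *\<^sub>R y)"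
        by (simp add: algebra_simps)
      finally have "p' (c *\<^sub>R x) \<le> c * (p (x + t *\<^sub>R y) - t * p y)"
        using sublinear_scaleR[OF p, of c "x + t *\<^sub>R y"] c by (simp add: algebra_simps)
      then show "p' (c *\<^sub>R x) / c \<le> p (x + t *\<^sub>R y) - t * p y"
        using c by (simp add: divide_le_eq mult.commute)
    qed
    then show "p' (c *\<^sub>R x) \<le> c * p' x" using c by (simp add: divide_le_eq mult.commute)
  qed
qed

text \<open>
  The lower bounds of chains for Zorn's lemma.  The common upper bound \<open>q\<close> also bounds the chain
  from below, since \<open>- q (- x) \<le> - p (- x) \<le> p x\<close>.
\<close>

lemma sublinear_chain_Inf:
  fixes q :: "'a::real_vector \<Rightarrow> real"
  assumes ne: "C \<noteq> {}" and C: "\<And>p. p \<in> C \<Longrightarrow> sublinear p \<and> p \<le> q"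
    and chain: "\<And>p p'. p \<in> C \<Longrightarrow> p' \<in> C \<Longrightarrow> p \<le> p' \<or> p' \<le> p"
  defines "m \<equiv> \<lambda>x. INF p\<in>C. p x"
  shows "sublinear m" and "\<And>p. p \<in> C \<Longrightarrow> m \<le> p"
proof -
  have bdd: "bdd_below ((\<lambda>p. p x) ` C)" for x
  proof (rule bdd_belowI2)
    fix p assume "p \<in> C"
    then have "- p (- x) \<le> p x" "p (- x) \<le> q (- x)"
      using C sublinear_minus_le by (auto simp: le_fun_def)
    then show "- q (- x) \<le> p x" by simp
  qed
  have le: "m x \<le> p x" if "p \<in> C" for p x
    unfolding m_def by (rule cINF_lower[OF bdd that])
  have ge: "z \<le> m x" if "\<And>p. p \<in> C \<Longrightarrow> z \<le> p x" for z x
    unfolding m_def by (rule cINF_greatest[OF ne]) (use that in auto)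
  show "m \<le> p" if "p \<in> C" for p using le[OF that] by (simp add: le_fun_def)
  show "sublinear m"
  proof (rule sublinearI)
    fix x y
    have *: "m (x + y) \<le> p x + p' y" if p: "p \<in> C" "p' \<in> C" for p p'
    proof -
      obtain r where r: "r \<in> C" "r \<le> p" "r \<le> p'" using chain[OF p] p by blast
      have "m (x + y) \<le> r x + r y"
        using le[OF r(1), of "x + y"] sublinear_add[of r x y] C[OF r(1)] by simp
      then show ?thesis using le_funD[OF r(2), of x] le_funD[OF r(3), of y] by linarith
    qed
    have "m (x + y) - p x \<le> m y" if "p \<in> C" for p
      by (rule ge) (use *[OF that] in \<open>simp add: algebra_simps\<close>)
    then have "m (x + y) - m y \<le> m x"
      by (intro ge) (simp add: algebra_simps)
    then show "m (x + y) \<le> m x + m y" by simp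
  next
    obtain p where "p \<in> C" using ne by auto
    then show "m 0 = 0"
      using le[of p 0] C sublinear_zero by (intro antisym ge) (auto simp: sublinear_zero)
  next
    fix c :: real and x assume c: "0 < c"
    have "m (c *\<^sub>R x) / c \<le> m x"
    proof (rule ge)
      fix p assume p: "p \<in> C"
      have "m (c *\<^sub>R x) \<le> c * p x"
        using le[OF p, of "c *\<^sub>R x"] sublinear_scaleR[of p c x] C[OF p] c by simp
      then show "m (c *\<^sub>R x) / c \<le> p x" using c by (simp add: divide_le_eq mult.commute)
    qed
    then show "m (c *\<^sub>R x) \<le> c * m x" using c by (simp add: divide_le_eq mult.commute)
  qed
qed

text \<open>
  The Hahn-Banach theorem: among the sublinear functionals below \<open>q\<close> there is a minimal one, and a
  minimal one equals all its slides and is therefore linear.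
\<close>

lemma linear_below_sublinear:
  fixes q :: "'a::real_vector \<Rightarrow> real"
  assumes q: "sublinear q"
  obtains f where "linear f" "f \<le> q"
proof -
  let ?A = "{p. sublinear p \<and> p \<le> q}"
  let ?P = "\<lambda>p p' :: 'a \<Rightarrow> real. p' \<le> p"
  have "\<exists>m\<in>?A. \<forall>p\<in>?A. ?P m p \<longrightarrow> p = m"
  proof (rule predicate_Zorn)
    show "partial_order_on ?A (relation_of ?P ?A)"
      by (rule partial_order_on_relation_ofI) auto
    fix C assume "C \<in> Chains (relation_of ?P ?A)"
    then have CA: "C \<subseteq> ?A" and chain: "\<And>p p'. p \<in> C \<Longrightarrow> p' \<in> C \<Longrightarrow> p \<le> p' \<or> p' \<le> p"
      by (auto simp: Chains_def relation_of_def)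
    show "\<exists>m\<in>?A. \<forall>p\<in>C. ?P p m"
    proof (cases "C = {}")
      case False
      let ?m = "\<lambda>x. INF p\<in>C. p x"
      have C: "\<And>p. p \<in> C \<Longrightarrow> sublinear p \<and> p \<le> q" using CA by auto
      have m: "sublinear ?m" "\<And>p. p \<in> C \<Longrightarrow> ?m \<le> p"
        by (rule sublinear_chain_Inf[OF False C chain], assumption+)+
      obtain p where "p \<in> C" using False by auto
      then have "?m \<le> q" using m(2)[of p] C[of p] by (meson order_trans)
      with m show ?thesis by blast
    qed (use q in auto)
  qed
  then obtain m where m: "sublinear m" "m \<le> q"
    and min: "\<And>p. sublinear p \<Longrightarrow> p \<le> q \<Longrightarrow> p \<le> m \<Longrightarrow> p = m"
    by auto
  have add: "m (x + y) = m x + m y" for x y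
  proof -
    let ?p = "\<lambda>x. INF t\<in>{0..}. m (x + t *\<^sub>R y) - t * m y"
    have "?p \<le> m"
      unfolding le_fun_def using sublinear_slide(2)[OF m(1), where t = 0 and y = y] by simp
    then have "?p = m"
      using sublinear_slide(1)[OF m(1), where y = y] m(2) by (intro min) (auto intro: order_trans)
    then have "m x \<le> m (x + y) - m y"
      using sublinear_slide(2)[OF m(1), where t = 1 and x = x and y = y] by (simp add: fun_eq_iff)
    then show ?thesis using sublinear_add[OF m(1), of x y] by simp
  qed
  have minus: "m (- x) = - m x" for x
    using add[of x "- x"] sublinear_zero[OF m(1)] by simp
  have "m (c *\<^sub>R x) = c *\<^sub>R m x" for c x
  proof (cases "0 \<le> c")
    case False
    then have "m (- c *\<^sub>R x) = - c * m x" by (intro sublinear_scaleR[OF m(1)]) simp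
    then show ?thesis using minus[of "c *\<^sub>R x"] by simp
  qed (simp add: sublinear_scaleR[OF m(1)])
  with add have "linear m" by (intro linearI) auto
  with m(2) show thesis by (rule that[rotated]) 
qed

text \<open>
  The norm slid along \<open>x\<close> itself takes a value of at most \<open>- norm x\<close> at \<open>- x\<close>, and a linear
  functional below it inherits this bound.
\<close>

lemma norming_functional:
  fixes x :: "'a::real_normed_vector"
  obtains f where "bounded_linear f" "norm x \<le> f x"
proof -
  have norm: "sublinear (norm :: 'a \<Rightarrow> real)"
    by (auto simp: sublinear_def norm_triangle_ineq)
  let ?q = "\<lambda>z. INF t\<in>{0..}. norm (z + t *\<^sub>R x) - t * norm x"
  note q = sublinear_slide[OF norm, where y = x]
  obtain f where f: "linear f" "f \<le> ?q" by (rule linear_below_sublinear[OF q(1)])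
  interpret linear f by fact
  have le: "f z \<le> norm z" for z
    using le_funD[OF f(2), of z] q(2)[where t = 0 and x = z] by simp
  have "bounded_linear f"
  proof (rule bounded_linear_intro[of _ 1])
    show "norm (f z) \<le> norm z * 1" for z
      using le[of z] le[of "- z"] by (simp add: neg abs_le_iff)
  qed (simp_all add: add scale)
  moreover have "f (- x) \<le> - norm x"
    using le_funD[OF f(2), of "- x"] q(2)[where t = 1 and x = "- x"] by simp
  then have "norm x \<le> f x" by (simp add: neg)
  ultimately show thesis by (rule that)
qed

lemma functionals_separate:
  fixes x y :: "'a::real_normed_vector"
  assumes "\<And>f :: 'a \<Rightarrow> real. bounded_linear f \<Longrightarrow> f x = f y"
  shows "x = y"
proof -
  obtain f :: "'a \<Rightarrow> real" where f: "bounded_linear f" "norm (x - y) \<le> f (x - y)"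
    by (rule norming_functional)
  interpret bounded_linear f by fact
  show ?thesis using f(2) assms[OF f(1)] by (simp add: diff)
qed


section \<open>Bochner integrals in nonseparable spaces\<close>


text \<open>
  In a space that is not second countable, differences of Borel measurable functions can fail to be
  measurable.  Subtracting a simple function is harmless: it amounts to finitely many translations.
\<close>

lemma borel_measurable_diff_simple:
  fixes f :: "'b \<Rightarrow> 'a::real_normed_vector"
  assumes f: "f \<in> borel_measurable M" and s: "simple_function M s"
  shows "(\<lambda>x. f x - s x) \<in> borel_measurable M"
proof (rule measurable_compose_countable'[where g = s and I = "s ` space M"])
  show "s \<in> M \<rightarrow>\<^sub>M count_space (s ` space M)"
    using s by (auto simp: simple_function_def measurable_count_space_eq2)
  show "countable (s ` space M)"
    using s by (auto simp: simple_function_def intro: countable_finite)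
  show "(\<lambda>x. f x - y) \<in> borel_measurable M" for y
    by (rule measurable_compose[OF f]) (intro borel_measurable_continuous_onI continuous_intros)
qed

text \<open>
  Through this lemma every statement about vector-valued integrals becomes one about scalar integrals.
\<close>

lemma has_Bochner_integral_bounded_linear:
  fixes f :: "'b \<Rightarrow> 'a::real_normed_vector"
    and L :: "'a \<Rightarrow> 'c::{real_normed_vector, second_countable_topology}"
  assumes L: "bounded_linear L" and f: "has_Bochner_integral M f x"
  shows "has_bochner_integral M (\<lambda>w. L (f w)) (L x)"
proof -
  interpret L: bounded_linear L by fact
  from f obtain s where f_meas: "f \<in> borel_measurable M"
    and s: "\<And>i. Bochner_Integration.simple_bochner_integrable M (s i)"
    and f_s: "(\<lambda>i. \<integral>\<^sup>+ w. ennreal (norm (f w - s i w)) \<partial>M) \<longlonglongrightarrow> 0"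
    and lim: "(\<lambda>i. Bochner_Integration.simple_bochner_integral M (s i)) \<longlonglongrightarrow> x"
    by (auto simp: has_Bochner_integral_def)
  have [measurable]: "(\<lambda>w. f w - s i w) \<in> borel_measurable M" for i
    using s[of i] by (intro borel_measurable_diff_simple f_meas)
      (auto simp: Bochner_Integration.simple_bochner_integrable.simps)
  have "continuous_on UNIV L" by (rule L.continuous_on) (rule continuous_on_id)
  note L_f = measurable_compose[OF f_meas borel_measurable_continuous_onI[OF this]]
  obtain K where K: "K > 0" "\<And>z. norm (L z) \<le> norm z * K"
    using L.pos_bounded by blast
  show ?thesis
  proof (rule has_bochner_integral.intros[where s = "\<lambda>i w. L (s i w)"])
    show "Bochner_Integration.simple_bochner_integrable M (\<lambda>w. L (s i w))" for i
      using s by (intro simple_bochner_integrable_compose2[where p = "\<lambda>a b. L a"] L.zero)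
    show "(\<lambda>i. \<integral>\<^sup>+ w. ennreal (norm (L (f w) - L (s i w))) \<partial>M) \<longlonglongrightarrow> 0" (is "?f \<longlonglongrightarrow> 0")
    proof (rule tendsto_sandwich)
      show "\<forall>\<^sub>F i in sequentially. 0 \<le> ?f i" by simp
      show "\<forall>\<^sub>F i in sequentially. ?f i \<le> ennreal K * (\<integral>\<^sup>+ w. norm (f w - s i w) \<partial>M)"
      proof (intro always_eventually allI)
        fix i
        have "?f i \<le> (\<integral>\<^sup>+ w. ennreal K * norm (f w - s i w) \<partial>M)"
          using K by (intro nn_integral_mono)
            (auto simp: ac_simps L.diff[symmetric] ennreal_mult[symmetric])
        also have "\<dots> = ennreal K * (\<integral>\<^sup>+ w. norm (f w - s i w) \<partial>M)"
          by (intro nn_integral_cmult) measurable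
        finally show "?f i \<le> ennreal K * (\<integral>\<^sup>+ w. norm (f w - s i w) \<partial>M)" .
      qed
      show "(\<lambda>i. ennreal K * (\<integral>\<^sup>+ w. norm (f w - s i w) \<partial>M)) \<longlonglongrightarrow> 0"
        using ennreal_tendsto_cmult[OF _ f_s] by simp
    qed simp
    show "(\<lambda>i. Bochner_Integration.simple_bochner_integral M (\<lambda>w. L (s i w))) \<longlonglongrightarrow> L x"
      using L.tendsto[OF lim] s by (simp add: simple_bochner_integral_linear L.linear_axioms)
  qed (rule L_f)
qed

lemma simple_bochner_integral_dist_le:
  fixes f :: "'b \<Rightarrow> 'a::real_normed_vector"
  assumes f: "f \<in> borel_measurable M"
    and s: "Bochner_Integration.simple_bochner_integrable M s"
    and t: "Bochner_Integration.simple_bochner_integrable M t"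
  shows "ennreal (norm (Bochner_Integration.simple_bochner_integral M s
           - Bochner_Integration.simple_bochner_integral M t))
    \<le> (\<integral>\<^sup>+ w. ennreal (norm (f w - s w)) \<partial>M) + (\<integral>\<^sup>+ w. ennreal (norm (f w - t w)) \<partial>M)"
proof -
  have [measurable]: "(\<lambda>w. f w - s w) \<in> borel_measurable M" "(\<lambda>w. f w - t w) \<in> borel_measurable M"
    using s t by (auto intro!: borel_measurable_diff_simple f
      simp: Bochner_Integration.simple_bochner_integrable.simps)
  have st: "Bochner_Integration.simple_bochner_integrable M (\<lambda>w. s w - t w)"
    using s t by (intro simple_bochner_integrable_compose2[where p = "(-)"]) auto
  have nst: "Bochner_Integration.simple_bochner_integrable M (\<lambda>w. norm (s w - t w))"
    using st by (intro simple_bochner_integrable_compose2[where p = "\<lambda>a b. norm a" and g = "\<lambda>w. s w - t w"]) auto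
  have "ennreal (norm (Bochner_Integration.simple_bochner_integral M s
           - Bochner_Integration.simple_bochner_integral M t))
      \<le> ennreal (Bochner_Integration.simple_bochner_integral M (\<lambda>w. norm (s w - t w)))"
    using simple_bochner_integral_norm_bound[OF st] s t
    by (auto simp: simple_bochner_integral_diff intro!: ennreal_leI)
  also have "\<dots> = (\<integral>\<^sup>+ w. norm (s w - t w) \<partial>M)"
    by (rule simple_bochner_integral_eq_nn_integral[OF nst]) simp
  also have "\<dots> \<le> (\<integral>\<^sup>+ w. ennreal (norm (f w - s w)) + ennreal (norm (f w - t w)) \<partial>M)"
  proof (rule nn_integral_mono)
    fix w
    have "norm (s w - t w) \<le> norm (f w - s w) + norm (f w - t w)"
      using norm_triangle_ineq4[of "f w - t w" "f w - s w"] by simp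
    then show "ennreal (norm (s w - t w)) \<le> ennreal (norm (f w - s w)) + ennreal (norm (f w - t w))"
      by (simp add: ennreal_plus[symmetric] del: ennreal_plus)
  qed
  also have "\<dots> = (\<integral>\<^sup>+ w. ennreal (norm (f w - s w)) \<partial>M) + (\<integral>\<^sup>+ w. ennreal (norm (f w - t w)) \<partial>M)"
    by (rule nn_integral_add) measurable
  finally show ?thesis .
qed

lemma has_Bochner_integral_of_approximation:
  fixes f :: "'b \<Rightarrow> 'a::banach"
  assumes f: "f \<in> borel_measurable M"
    and s: "\<And>i. Bochner_Integration.simple_bochner_integrable M (s i)"
    and lim: "(\<lambda>i. \<integral>\<^sup>+ w. ennreal (norm (f w - s i w)) \<partial>M) \<longlonglongrightarrow> 0" (is "?S \<longlonglongrightarrow> 0")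
  shows "\<exists>x. has_Bochner_integral M f x"
proof -
  let ?s = "\<lambda>n. Bochner_Integration.simple_bochner_integral M (s n)"
  have "\<exists>x. ?s \<longlonglongrightarrow> x"
    unfolding convergent_eq_Cauchy
  proof (rule metric_CauchyI)
    fix e :: real assume "0 < e"
    then have "0 < ennreal (e / 2)" by auto
    from order_tendstoD(2)[OF lim this]
    obtain N where N: "\<And>n. N \<le> n \<Longrightarrow> ?S n < e / 2"
      by (auto simp: eventually_sequentially)
    show "\<exists>N. \<forall>m\<ge>N. \<forall>n\<ge>N. dist (?s m) (?s n) < e"
    proof (intro exI allI impI)
      fix m n assume m: "N \<le> m" and n: "N \<le> n"
      have "norm (?s m - ?s n) \<le> ?S m + ?S n"
        by (intro simple_bochner_integral_dist_le s f)
      also have "\<dots> < ennreal (e / 2) + e / 2"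
        by (intro add_strict_mono N n m)
      also have "\<dots> = e" using \<open>0<e\<close> by (simp flip: ennreal_plus)
      finally show "dist (?s m) (?s n) < e"
        using \<open>0<e\<close> by (simp add: dist_norm ennreal_less_iff)
    qed
  qed
  with f s lim show ?thesis by (auto simp: has_Bochner_integral_def)
qed

text \<open>
  The target space may be nonseparable, but the domain is the real line: there are simple functions
  \<open>g i\<close> converging to the identity, and \<open>f \<circ> g i\<close> is simple and converges to \<open>f\<close> by continuity.
  Setting it to zero wherever its norm exceeds \<open>2 * norm (f s)\<close> makes dominated convergence
  applicable and does not affect the limit.
\<close>

lemma has_Bochner_integral_continuous:
  fixes f :: "real \<Rightarrow> 'a::banach"
  assumes cont: "continuous_on {0..} f"
    and int: "(\<integral>\<^sup>+ s. ennreal (indicator {0<..} s * norm (f s)) \<partial>lborel) < \<infinity>"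
  shows "\<exists>x. has_Bochner_integral_on f {0<..} x"
proof -
  let ?f = "\<lambda>s. indicat_real {0<..} s *\<^sub>R f s"
  have "continuous_on {0<..} f" by (rule continuous_on_subset[OF cont]) auto
  then have f_meas: "?f \<in> borel_measurable borel"
    by (intro borel_measurable_continuous_on_indicator) auto
  have "(\<lambda>s::real. s) \<in> borel_measurable borel" by simp
  from borel_measurable_implies_sequence_metric[OF this, of 0]
  obtain g :: "nat \<Rightarrow> real \<Rightarrow> real" where g: "\<And>i. simple_function borel (g i)"
    and g_lim: "\<And>s. (\<lambda>i. g i s) \<longlonglongrightarrow> s"
    by (auto simp: space_borel)
  define h where "h = (\<lambda>i s. if norm (?f (g i s)) \<le> 2 * norm (?f s) then ?f (g i s) else 0)"
  have fg: "simple_function borel (\<lambda>s. ?f (g i s))" for i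
    by (rule simple_function_compose1[OF g])
  have nf: "(\<lambda>s. norm (?f s)) \<in> borel_measurable borel"
    by (rule measurable_compose[OF f_meas]) simp
  have nfg: "(\<lambda>s. norm (?f (g i s))) \<in> borel_measurable borel" for i
    by (intro borel_measurable_simple_function simple_function_compose1[OF fg])
  have h: "simple_function borel (h i)" for i
  proof -
    have "{s \<in> space borel. norm (?f (g i s)) \<le> 2 * norm (?f s)} \<in> sets borel"
      using nf nfg by measurable
    then show ?thesis
      unfolding h_def by (intro simple_function_If fg simple_function_const)
  qed
  have h_le: "norm (h i s) \<le> 2 * norm (?f s)" for i s
    by (simp add: h_def)
  have isCont_f: "isCont f s" if "0 < s" for s
    using \<open>continuous_on {0<..} f\<close> that by (simp add: continuous_on_eq_continuous_at)
  have h_lim: "(\<lambda>i. h i s) \<longlonglongrightarrow> ?f s" for s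
  proof (cases "?f s = 0")
    case True
    then have "h i s = 0" for i using h_le[of i s] True by (simp only: norm_zero mult_zero_right norm_le_zero_iff)
    then show ?thesis unfolding True by simp
  next
    case False
    then have s: "0 < s" by (auto simp: indicator_def split: if_splits)
    have ev: "\<forall>\<^sub>F i in sequentially. 0 < g i s" using order_tendstoD(1)[OF g_lim s] .
    have "(\<lambda>i. f (g i s)) \<longlonglongrightarrow> f s"
      using isCont_f[OF s] g_lim[of s] by (rule isCont_tendsto_compose)
    then have lim: "(\<lambda>i. ?f (g i s)) \<longlonglongrightarrow> ?f s"
      by (rule Lim_transform_eventually[OF tendsto_eq_rhs])
         (use s ev in \<open>auto elim!: eventually_mono simp: indicator_def\<close>)
    have "norm (?f s) < 2 * norm (?f s)" using False zero_less_norm_iff[of "?f s"] by linarith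
    from order_tendstoD(2)[OF tendsto_norm[OF lim] this]
    have "\<forall>\<^sub>F i in sequentially. ?f (g i s) = h i s"
      by eventually_elim (simp add: h_def)
    then show ?thesis by (rule Lim_transform_eventually[OF lim])
  qed
  have fin: "(\<integral>\<^sup>+ s. ennreal (norm (?f s)) \<partial>lborel) < \<infinity>"
    using int by (simp add: abs_mult)
  have "\<exists>x. has_Bochner_integral lborel ?f x"
  proof (rule has_Bochner_integral_of_approximation)
    show "?f \<in> borel_measurable lborel" using f_meas by simp
    show "Bochner_Integration.simple_bochner_integrable lborel (h i)" for i
    proof (rule simple_bochner_integrableI_bounded)
      show "simple_function lborel (h i)"
        using h[of i] by (simp add: simple_function_def)
      have "(\<integral>\<^sup>+ s. ennreal (norm (h i s)) \<partial>lborel) \<le> (\<integral>\<^sup>+ s. 2 * ennreal (norm (?f s)) \<partial>lborel)"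
      proof (rule nn_integral_mono)
        fix s
        have "ennreal (norm (h i s)) \<le> ennreal (2 * norm (?f s))"
          by (rule ennreal_leI[OF h_le])
        then show "ennreal (norm (h i s)) \<le> 2 * ennreal (norm (?f s))"
          by (simp add: ennreal_mult')
      qed
      also have "\<dots> = 2 * (\<integral>\<^sup>+ s. ennreal (norm (?f s)) \<partial>lborel)"
        using nf by (intro nn_integral_cmult) auto
      also have "\<dots> < \<infinity>" using fin by (simp add: ennreal_mult_less_top)
      finally show "(\<integral>\<^sup>+ s. ennreal (norm (h i s)) \<partial>lborel) < \<infinity>" .
    qed
    have "(\<lambda>i. \<integral>\<^sup>+ s. ennreal (norm (?f s - h i s)) \<partial>lborel) \<longlonglongrightarrow> (\<integral>\<^sup>+ s. 0 \<partial>(lborel::real measure))"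
    proof (rule nn_integral_dominated_convergence[where w = "\<lambda>s. 3 * ennreal (norm (?f s))"])
      show "(\<lambda>s. ennreal (norm (?f s - h i s))) \<in> borel_measurable lborel" for i
        using borel_measurable_diff_simple[OF f_meas h, of i] by measurable
      show "(\<lambda>s. 3 * ennreal (norm (?f s))) \<in> borel_measurable lborel"
        using nf by measurable
      have "(\<integral>\<^sup>+ s. 3 * ennreal (norm (?f s)) \<partial>lborel) = 3 * (\<integral>\<^sup>+ s. ennreal (norm (?f s)) \<partial>lborel)"
        using nf by (intro nn_integral_cmult) auto
      also have "\<dots> < \<infinity>" using fin by (simp add: ennreal_mult_less_top)
      finally show "(\<integral>\<^sup>+ s. 3 * ennreal (norm (?f s)) \<partial>lborel) < \<infinity>" .
      show "AE s in lborel. ennreal (norm (?f s - h i s)) \<le> 3 * ennreal (norm (?f s))" for i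
      proof (rule AE_I2)
        fix s :: real
        have "norm (?f s - h i s) \<le> 3 * norm (?f s)"
          using norm_triangle_ineq4[of "?f s" "h i s"] h_le[of i s] by simp
        then have "ennreal (norm (?f s - h i s)) \<le> ennreal (3 * norm (?f s))"
          by (rule ennreal_leI)
        then show "ennreal (norm (?f s - h i s)) \<le> 3 * ennreal (norm (?f s))"
          by (simp add: ennreal_mult')
      qed
      show "AE s in lborel. (\<lambda>i. ennreal (norm (?f s - h i s))) \<longlonglongrightarrow> 0"
      proof (rule AE_I2)
        fix s :: real
        have "(\<lambda>i. norm (?f s - h i s)) \<longlonglongrightarrow> 0"
          using tendsto_norm[OF tendsto_diff[OF tendsto_const h_lim[of s], of "?f s"]] by simp
        then show "(\<lambda>i. ennreal (norm (?f s - h i s))) \<longlonglongrightarrow> 0"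
          using tendsto_ennrealI by fastforce
      qed
    qed simp
    then show "(\<lambda>i. \<integral>\<^sup>+ s. ennreal (norm (?f s - h i s)) \<partial>lborel) \<longlonglongrightarrow> 0" by simp
  qed
  then show ?thesis .
qed

section \<open>Strongly continuous semigroups\<close>

text \<open>
  By Baire's theorem one of the closed sets of points at which the whole family is bounded by \<open>n\<close>
  contains a ball; differences of points of this ball reach all directions.
\<close>

lemma uniform_boundedness:
  fixes S :: "('a::banach \<Rightarrow>\<^sub>L 'b::real_normed_vector) set"
  assumes pw: "\<And>x. \<exists>C. \<forall>B\<in>S. norm (B x) \<le> C"
  obtains K where "\<And>B. B \<in> S \<Longrightarrow> norm B \<le> K"
proof -
  define F where "F = (\<lambda>n::nat. {x. \<forall>B\<in>S. norm (blinfun_apply B x) \<le> real n})"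
  have F_closed: "closed (F n)" for n
  proof -
    have "F n = (\<Inter>B\<in>S. {x. norm (blinfun_apply B x) \<le> real n})" by (auto simp: F_def)
    moreover have "closed {x. norm (blinfun_apply B x) \<le> real n}" for B :: "'a \<Rightarrow>\<^sub>L 'b"
      by (intro closed_Collect_le continuous_intros)
    ultimately show ?thesis by auto
  qed
  have cover: "\<Union>(range F) = UNIV"
  proof (intro set_eqI iffI UNIV_I)
    fix x
    obtain C where C: "\<And>B. B \<in> S \<Longrightarrow> norm (blinfun_apply B x) \<le> C" using pw by blast
    obtain n where "C \<le> real n" using real_arch_simple by blast
    with C have "x \<in> F n" by (force simp: F_def)
    then show "x \<in> \<Union>(range F)" by blast
  qed
  have "\<exists>n. interior (F n) \<noteq> {}"
  proof (rule ccontr)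
    assume "\<not> ?thesis"
    then have "(euclidean :: 'a topology) interior_of \<Union>(range F) = {}"
      using F_closed by (intro Baire_category_alt disjI1 completely_metrizable_space_euclidean) auto
    then show False unfolding cover by simp
  qed
  then obtain n x0 where "x0 \<in> interior (F n)" by blast
  then obtain e where e: "0 < e" "cball x0 e \<subseteq> F n"
    by (meson interior_subset mem_interior_cball subset_trans)
  have "norm B \<le> 2 * real n / e" if B: "B \<in> S" for B
  proof (rule norm_blinfun_bound)
    show "0 \<le> 2 * real n / e" using e by simp
    fix z :: 'a
    show "norm (B z) \<le> 2 * real n / e * norm z"
    proof (cases "z = 0")
      case False
      define w where "w = (e / norm z) *\<^sub>R z"
      have w: "norm w = e" using False e by (simp add: w_def)
      have "x0 + w \<in> F n" "x0 \<in> F n" using e w by (auto simp: dist_norm subset_iff)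
      then have "norm (B (x0 + w)) \<le> n" "norm (B x0) \<le> n" using B by (auto simp: F_def)
      moreover have "B w = B (x0 + w) - B x0" by (simp add: blinfun.bilinear_simps)
      ultimately have "norm (B w) \<le> 2 * n" using norm_triangle_ineq4[of "B (x0 + w)" "B x0"] by simp
      moreover have "norm (B w) = e / norm z * norm (B z)"
        using False e by (simp add: w_def blinfun.bilinear_simps)
      ultimately show ?thesis using False e by (simp add: field_simps)
    qed (simp add: blinfun.bilinear_simps)
  qed
  then show thesis by (rule that)
qed

lemma C0_semigroup_zero: "C0_semigroup T \<Longrightarrow> T 0 x = x"
  and C0_semigroup_add: "C0_semigroup T \<Longrightarrow> 0 \<le> s \<Longrightarrow> 0 \<le> t \<Longrightarrow> T (s + t) x = T s (T t x)"
  by (auto simp: C0_semigroup_def)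

lemma C0_semigroup_tendsto_zero:
  assumes T: "C0_semigroup T"
  shows "((\<lambda>t. T t x) \<longlongrightarrow> x) (at 0 within {0..})"
proof -
  have "((\<lambda>t. T t x) \<longlongrightarrow> x) (at_right 0)" using T by (simp add: C0_semigroup_def)
  moreover have "at (0::real) within {0..} = at_right 0"
    by (rule at_within_Ici_at_right)
  ultimately show ?thesis by simp
qed

text \<open>
  If \<open>T\<close> were unbounded on every interval \<open>[0, 1 / (n + 1)]\<close>, there would be times \<open>\<tau> n\<close> tending to
  zero with unbounded \<open>T (\<tau> n)\<close>, although \<open>T (\<tau> n) x\<close> converges to \<open>x\<close> for each \<open>x\<close>.  The
  semigroup law spreads a bound near zero to every bounded interval.
\<close>

lemma C0_semigroup_bounded:
  fixes T :: "real \<Rightarrow> 'a::banach \<Rightarrow>\<^sub>L 'a"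
  assumes T: "C0_semigroup T"
  obtains K where "\<And>t. 0 \<le> t \<Longrightarrow> t \<le> \<tau> \<Longrightarrow> norm (T t) \<le> K"
proof -
  have "\<exists>d>0. \<exists>K. \<forall>t\<in>{0..d}. norm (T t) \<le> K"
  proof (rule ccontr)
    assume "\<not> ?thesis"
    then have "\<exists>t\<in>{0..1 / real (Suc n)}. real n < norm (T t)" for n
      by (meson not_le of_nat_0_less_iff zero_less_Suc zero_less_divide_1_iff)
    then obtain \<tau> where \<tau>: "\<And>n. \<tau> n \<in> {0..1 / real (Suc n)}" "\<And>n. real n < norm (T (\<tau> n))"
      by metis
    have "\<tau> \<longlonglongrightarrow> 0"
      by (rule tendsto_sandwich[OF _ _ tendsto_const LIMSEQ_inverse_real_of_nat])
         (use \<tau>(1) in \<open>auto simp: inverse_eq_divide\<close>)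
    have bdd: "\<exists>C. \<forall>B\<in>range (\<lambda>n. T (\<tau> n)). norm (blinfun_apply B x) \<le> C" for x
    proof -
      have "((\<lambda>t. T t x) \<longlongrightarrow> T 0 x) (at 0 within {0..})"
        using C0_semigroup_tendsto_zero[OF T, of x] C0_semigroup_zero[OF T] by simp
      then have "continuous (at 0 within {0..}) (\<lambda>t. T t x)"
        by (simp add: continuous_within)
      then have "(\<lambda>n. T (\<tau> n) x) \<longlonglongrightarrow> T 0 x"
        using \<open>\<tau> \<longlonglongrightarrow> 0\<close> \<tau>(1) by (auto simp: continuous_within_sequentially comp_def)
      then have "bounded (range (\<lambda>n. T (\<tau> n) x))" by (rule convergent_imp_bounded)
      then show ?thesis by (auto simp: bounded_iff)
    qed
    obtain K where "\<And>B. B \<in> range (\<lambda>n. T (\<tau> n)) \<Longrightarrow> norm B \<le> K"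
      by (rule uniform_boundedness[OF bdd]) blast
    then have "norm (T (\<tau> n)) \<le> K" for n by blast
    moreover obtain n where "K \<le> real n" using real_arch_simple by blast
    ultimately show False using \<tau>(2)[of n] by (meson not_le order_trans)
  qed
  then obtain d K where d: "0 < d" and K: "\<And>t. t \<in> {0..d} \<Longrightarrow> norm (T t) \<le> K" by blast
  have bound: "norm (T t) \<le> (max K 1) ^ Suc n" if "0 \<le> t" "t \<le> real (Suc n) * d" for n t
    using that
  proof (induction n arbitrary: t)
    case 0
    then show ?case using K[of t] by simp
  next
    case (Suc n)
    show ?case
    proof (cases "t \<le> d")
      case True
      then have "norm (T t) \<le> max K 1" using K[of t] Suc.prems by simp
      also have "\<dots> \<le> max K 1 ^ Suc (Suc n)" using power_increasing[of 1 "Suc (Suc n)" "max K 1"] by simp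
      finally show ?thesis .
    next
      case False
      have "T (r + s) = T r o\<^sub>L T s" if "0 \<le> r" "0 \<le> s" for r s
        using T that by (simp add: C0_semigroup_def)
      from this[of d "t - d"] have "T t = T d o\<^sub>L T (t - d)" using False d by simp
      then have "norm (T t) \<le> norm (T d) * norm (T (t - d))"
        by (simp add: norm_blinfun_compose)
      also have "\<dots> \<le> max K 1 * max K 1 ^ Suc n"
        using K[of d] d False Suc.prems
        by (intro mult_mono Suc.IH) (auto simp: algebra_simps)
      finally show ?thesis by simp
    qed
  qed
  obtain n where "\<tau> / d \<le> real n" using real_arch_simple by blast
  then have "\<tau> \<le> real (Suc n) * d" using d by (simp add: field_simps)
  then show thesis by (intro that[of "max K 1 ^ Suc n"] bound) linarith+
qed

lemma C0_semigroup_continuous: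
  fixes T :: "real \<Rightarrow> 'a::banach \<Rightarrow>\<^sub>L 'a"
  assumes T: "C0_semigroup T"
  shows "continuous_on {0..} (\<lambda>t. T t x)"
  unfolding continuous_on_iff
proof (intro ballI allI impI)
  fix t e :: real assume t: "t \<in> {0..}" and e: "0 < e"
  obtain K where K: "\<And>s. 0 \<le> s \<Longrightarrow> s \<le> t + 1 \<Longrightarrow> norm (T s) \<le> K"
    using C0_semigroup_bounded[OF T] by blast
  have "0 \<le> K" using K[of 0] t norm_ge_zero[of "T 0"] by (simp del: norm_ge_zero)
  have "\<forall>\<^sub>F h in at 0 within {0..}. dist (T h x) x < e / (K + 1)"
    using tendstoD[OF C0_semigroup_tendsto_zero[OF T]] e \<open>0 \<le> K\<close> by auto
  then obtain d where d: "0 < d" "\<And>h. 0 < h \<Longrightarrow> h < d \<Longrightarrow> dist (T h x) x < e / (K + 1)"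
    by (auto simp: eventually_at dist_real_def)
  have *: "dist (T r x) (T s x) < e" if "0 \<le> s" "s < r" "s \<le> t + 1" "r - s < d" for r s
  proof -
    have "T r x = T s (T (r - s) x)" using C0_semigroup_add[OF T, of s "r - s" x] that by simp
    then have "dist (T r x) (T s x) = norm (T s (T (r - s) x - x))"
      by (simp add: dist_norm blinfun.bilinear_simps)
    also have "\<dots> \<le> norm (T s) * norm (T (r - s) x - x)" by (rule norm_blinfun)
    also have "\<dots> \<le> K * norm (T (r - s) x - x)" using K that by (intro mult_right_mono) auto
    also have "\<dots> \<le> K * (e / (K + 1))"
      using d(2)[of "r - s"] that \<open>0 \<le> K\<close> by (intro mult_left_mono) (auto simp: dist_norm)
    also have "\<dots> < e" using e \<open>0 \<le> K\<close> by (simp add: field_simps)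
    finally show ?thesis .
  qed
  show "\<exists>d>0. \<forall>s\<in>{0..}. dist s t < d \<longrightarrow> dist (T s x) (T t x) < e"
  proof (intro exI[of _ d] conjI d(1) ballI impI)
    fix s assume s: "s \<in> {0..}" "dist s t < d"
    consider "s = t" | "s < t" | "t < s" by linarith
    then show "dist (T s x) (T t x) < e"
      using s t e *[of s t] *[of t s] by cases (auto simp: dist_real_def dist_commute)
  qed
qed

lemma C0_semigroup_jointly_continuous:
  fixes T :: "real \<Rightarrow> 'a::banach \<Rightarrow>\<^sub>L 'a" and u :: "'b::topological_space \<Rightarrow> 'a"
  assumes T: "C0_semigroup T" and u: "continuous_on S u"
  shows "continuous_on ({0..} \<times> S) (\<lambda>(\<sigma>, s). T \<sigma> (u s))"
  unfolding continuous_on_def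
proof (intro ballI)
  fix z :: "real \<times> 'b" assume z: "z \<in> {0..} \<times> S"
  obtain \<sigma>0 :: real and s0 where z_eq: "z = (\<sigma>0, s0)" by (cases z)
  with z have \<sigma>0: "0 \<le> \<sigma>0" and s0: "s0 \<in> S" by auto
  let ?F = "at (\<sigma>0, s0) within ({0..} \<times> S)"
  obtain K where K: "\<And>s. 0 \<le> s \<Longrightarrow> s \<le> \<sigma>0 + 1 \<Longrightarrow> norm (T s) \<le> K"
    using C0_semigroup_bounded[OF T] by blast
  have cu: "continuous_on ({0..} \<times> S) (\<lambda>z. u (snd z))"
    by (rule continuous_on_compose2[OF u]) (auto intro!: continuous_intros)
  have cT: "continuous_on ({0..} \<times> S) (\<lambda>z. T (fst z) (u s0))"
    by (rule continuous_on_compose2[OF C0_semigroup_continuous[OF T]]) (auto intro!: continuous_intros)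
  have lim_u: "((\<lambda>z. u (snd z)) \<longlongrightarrow> u s0) ?F"
    using cu z unfolding continuous_on_def z_eq by (metis snd_conv)
  have lim_T: "((\<lambda>z. T (fst z) (u s0)) \<longlongrightarrow> T \<sigma>0 (u s0)) ?F"
    using cT z unfolding continuous_on_def z_eq by (metis fst_conv)
  have "(fst \<longlongrightarrow> \<sigma>0) ?F" using tendsto_fst[OF tendsto_ident_at] by (metis fst_conv)
  then have ev1: "\<forall>\<^sub>F z in ?F. fst z < \<sigma>0 + 1" by (rule order_tendstoD) simp
  have ev2: "\<forall>\<^sub>F z in ?F. z \<in> {0..} \<times> S" by (simp add: eventually_at_filter)
  have "((\<lambda>z. T (fst z) (u (snd z) - u s0)) \<longlongrightarrow> 0) ?F"
  proof (rule Lim_null_comparison)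
    show "\<forall>\<^sub>F z in ?F. norm (T (fst z) (u (snd z) - u s0)) \<le> K * norm (u (snd z) - u s0)"
      using ev1 ev2
    proof eventually_elim
      case (elim z)
      have "norm (T (fst z) (u (snd z) - u s0)) \<le> norm (T (fst z)) * norm (u (snd z) - u s0)"
        by (rule norm_blinfun)
      also have "\<dots> \<le> K * norm (u (snd z) - u s0)"
        using elim by (intro mult_right_mono K) auto
      finally show ?case .
    qed
    have "((\<lambda>z. K * norm (u (snd z) - u s0)) \<longlongrightarrow> K * norm (u s0 - u s0)) ?F"
      by (intro tendsto_intros lim_u)
    then show "((\<lambda>z. K * norm (u (snd z) - u s0)) \<longlongrightarrow> 0) ?F" by simp
  qed
  from tendsto_add[OF this lim_T]
  have "((\<lambda>z. T (fst z) (u (snd z))) \<longlongrightarrow> T \<sigma>0 (u s0)) ?F"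
    by (simp add: blinfun.bilinear_simps)
  then show "((\<lambda>(\<sigma>, s). T \<sigma> (u s)) \<longlongrightarrow> (case z of (\<sigma>, s) \<Rightarrow> T \<sigma> (u s))) (at z within {0..} \<times> S)"
    by (simp add: z_eq case_prod_beta')
qed

text \<open>
  The difference quotients from the left and from the right are both of the form
  \<open>T (min s t) ((T h y - y) /\<^sub>R h)\<close> with \<open>h = \<bar>s - t\<bar>\<close>.  Hence the right-sided derivative at zero, which
  defines the generator, suffices, and the local bound on \<open>T\<close> allows passing to the limit.
\<close>

lemma C0_semigroup_orbit_derivative:
  fixes T :: "real \<Rightarrow> 'a::banach \<Rightarrow>\<^sub>L 'a"
  assumes T: "C0_semigroup T" and A: "is_generator T DA A" and y: "y \<in> DA" and t: "0 \<le> t"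
  shows "((\<lambda>t. T t y) has_vector_derivative T t (A y)) (at t within {0..})"
proof -
  let ?F = "at t within {0..}"
  let ?D = "\<lambda>h. (T h y - y) /\<^sub>R h"
  obtain K where K: "\<And>s. 0 \<le> s \<Longrightarrow> s \<le> t \<Longrightarrow> norm (T s) \<le> K"
    using C0_semigroup_bounded[OF T] by blast
  have "filterlim (\<lambda>s. \<bar>s - t\<bar>) (at_right 0) ?F"
    unfolding filterlim_at
  proof
    have "((\<lambda>s. \<bar>s - t\<bar>) \<longlongrightarrow> \<bar>t - t\<bar>) ?F" by (intro tendsto_intros)
    then show "((\<lambda>s. \<bar>s - t\<bar>) \<longlongrightarrow> 0) ?F" by simp
    show "\<forall>\<^sub>F s in ?F. \<bar>s - t\<bar> \<in> {0<..} \<and> \<bar>s - t\<bar> \<noteq> 0"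
      by (simp add: eventually_at_filter)
  qed
  moreover have "(?D \<longlongrightarrow> A y) (at_right 0)" using A y by (auto simp: is_generator_def)
  ultimately have D: "((\<lambda>s. ?D \<bar>s - t\<bar>) \<longlongrightarrow> A y) ?F" by (rule filterlim_compose[rotated])
  have "continuous_on {0..} (\<lambda>s. T (min s t) (A y))"
    by (rule continuous_on_compose2[OF C0_semigroup_continuous[OF T]])
       (use t in \<open>auto intro!: continuous_intros\<close>)
  then have C: "((\<lambda>s. T (min s t) (A y)) \<longlongrightarrow> T t (A y)) ?F"
    using t unfolding continuous_on_def by force
  have quot: "(T s y - T t y) /\<^sub>R (s - t) = T (min s t) (?D \<bar>s - t\<bar>)" if s: "0 \<le> s" "s \<noteq> t" for s
  proof (cases "s < t")
    case True
    then have "T t y = T s (T (t - s) y)" using C0_semigroup_add[OF T, of s "t - s" y] s by simp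
    moreover have "inverse (s - t) = - inverse (t - s)" using True
      by (metis inverse_minus_eq minus_diff_eq)
    ultimately show ?thesis using True
      by (simp add: blinfun.bilinear_simps algebra_simps)
  next
    case False
    then have "T s y = T t (T (s - t) y)" using C0_semigroup_add[OF T, of t "s - t" y] s t by simp
    then show ?thesis using False s by (simp add: blinfun.bilinear_simps)
  qed
  have "((\<lambda>s. T (min s t) (?D \<bar>s - t\<bar> - A y)) \<longlongrightarrow> 0) ?F"
  proof (rule Lim_null_comparison)
    have "\<forall>\<^sub>F s in ?F. 0 \<le> s" by (simp add: eventually_at_filter)
    then show "\<forall>\<^sub>F s in ?F. norm (T (min s t) (?D \<bar>s - t\<bar> - A y)) \<le> K * norm (?D \<bar>s - t\<bar> - A y)"
    proof eventually_elim
      case (elim s)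
      have "norm (T (min s t) (?D \<bar>s - t\<bar> - A y)) \<le> norm (T (min s t)) * norm (?D \<bar>s - t\<bar> - A y)"
        by (rule norm_blinfun)
      also have "\<dots> \<le> K * norm (?D \<bar>s - t\<bar> - A y)"
        using elim t by (intro mult_right_mono K) auto
      finally show ?case .
    qed
    have "((\<lambda>s. K * norm (?D \<bar>s - t\<bar> - A y)) \<longlongrightarrow> K * norm (A y - A y)) ?F"
      by (intro tendsto_intros D)
    then show "((\<lambda>s. K * norm (?D \<bar>s - t\<bar> - A y)) \<longlongrightarrow> 0) ?F" by simp
  qed
  from tendsto_add[OF this C]
  have "((\<lambda>s. T (min s t) (?D \<bar>s - t\<bar>)) \<longlongrightarrow> T t (A y)) ?F"
    by (simp add: blinfun.bilinear_simps)
  then have "((\<lambda>s. (T s y - T t y) /\<^sub>R (s - t)) \<longlongrightarrow> T t (A y)) ?F"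
    by (rule Lim_transform_eventually) (use quot in \<open>simp add: eventually_at_filter\<close>)
  from tendsto_norm[OF tendsto_diff[OF this tendsto_const[of "T t (A y)"]]]
  have "((\<lambda>s. norm ((T s y - T t y) /\<^sub>R (s - t) - T t (A y))) \<longlongrightarrow> 0) ?F" by simp
  then have "((\<lambda>s. norm ((T s y - T t y) - (s - t) *\<^sub>R T t (A y)) / norm (s - t)) \<longlongrightarrow> 0) ?F"
  proof (rule Lim_transform_eventually)
    have "norm ((T s y - T t y) /\<^sub>R (s - t) - T t (A y))
        = norm ((T s y - T t y) - (s - t) *\<^sub>R T t (A y)) / norm (s - t)" if "s \<noteq> t" for s
    proof -
      have "(T s y - T t y) /\<^sub>R (s - t) - T t (A y)
          = ((T s y - T t y) - (s - t) *\<^sub>R T t (A y)) /\<^sub>R (s - t)"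
        using that by (simp add: scaleR_diff_right)
      then show ?thesis by (simp add: divide_inverse mult.commute)
    qed
    then show "\<forall>\<^sub>F s in ?F. norm ((T s y - T t y) /\<^sub>R (s - t) - T t (A y))
        = norm ((T s y - T t y) - (s - t) *\<^sub>R T t (A y)) / norm (s - t)"
      by (simp add: eventually_at_filter)
  qed
  then show ?thesis
    unfolding has_vector_derivative_def has_derivative_iff_norm
    by (auto intro: bounded_linear_scaleR_left)
qed

lemma C0_semigroup_integral_generator:
  fixes T :: "real \<Rightarrow> 'a::banach \<Rightarrow>\<^sub>L 'a"
  assumes T: "C0_semigroup T" and A: "is_generator T DA A" and y: "y \<in> DA"
    and r: "0 \<le> r" "r \<le> t"
  shows "((\<lambda>\<sigma>. T \<sigma> (A y)) has_integral T t y - T r y) {r..t}"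
  by (rule fundamental_theorem_of_calculus[OF r(2)])
     (use r in \<open>auto intro!: has_vector_derivative_within_subset[OF C0_semigroup_orbit_derivative[OF T A y]]\<close>)

section \<open>The complementary error function\<close>

text \<open>
  Twice the upper tail of the centred normal law of variance 1/2.  Taking it from a probability law
  provides the limits at both infinities.
\<close>

definition erfc :: "real \<Rightarrow> real" where
  "erfc y = 2 * measure (density lborel (normal_density 0 (1 / sqrt 2))) {y<..}"

lemma normal_density_half: "normal_density 0 (1 / sqrt 2) x = exp (- x\<^sup>2) / sqrt pi"
  by (simp add: normal_density_def power_divide)

lemma erfc_eq_cdf: "erfc y = 2 * (1 - cdf (density lborel (normal_density 0 (1 / sqrt 2))) y)"
proof -
  interpret prob_space "density lborel (normal_density 0 (1 / sqrt 2))"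
    by (rule prob_space_normal_density) simp
  have "prob (space (density lborel (normal_density 0 (1 / sqrt 2))) - {..y}) = 1 - prob {..y}"
    by (rule prob_compl) simp
  moreover have "space (density lborel (normal_density 0 (1 / sqrt 2))) - {..y} = {y<..}" by auto
  ultimately have "prob {y<..} = 1 - prob {..y}" by simp
  then show ?thesis by (simp add: erfc_def cdf_def)
qed

lemma erfc_nonneg: "0 \<le> erfc y"
  by (simp add: erfc_def)

lemma erfc_at_top: "(erfc \<longlongrightarrow> 0) at_top" and erfc_at_bot: "(erfc \<longlongrightarrow> 2) at_bot"
proof -
  let ?N = "density lborel (normal_density 0 (1 / sqrt 2))"
  interpret prob_space ?N by (rule prob_space_normal_density) simp
  interpret real_distribution ?N by unfold_locales simp_all
  have "((\<lambda>y. 2 * (1 - cdf ?N y)) \<longlongrightarrow> 2 * (1 - 1)) at_top"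
    by (intro tendsto_intros cdf_lim_at_top_prob)
  then show "(erfc \<longlongrightarrow> 0) at_top" by (simp add: erfc_eq_cdf[abs_def])
  have "((\<lambda>y. 2 * (1 - cdf ?N y)) \<longlongrightarrow> 2 * (1 - 0)) at_bot"
    by (intro tendsto_intros cdf_lim_at_bot)
  then show "(erfc \<longlongrightarrow> 2) at_bot" by (simp add: erfc_eq_cdf[abs_def])
qed

lemma erfc_has_derivative: "(erfc has_real_derivative - (2 / sqrt pi) * exp (- y\<^sup>2)) (at y)"
proof -
  let ?N = "density lborel (normal_density 0 (1 / sqrt 2))"
  let ?f = "\<lambda>x::real. exp (- x\<^sup>2) / sqrt pi"
  interpret prob_space ?N by (rule prob_space_normal_density) simp
  interpret real_distribution ?N by unfold_locales simp_all
  have cont: "continuous_on S ?f" for S by (intro continuous_intros) auto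
  have eq: "erfc x = erfc (y - 1) - 2 * integral {y - 1..x} ?f" if "y - 1 < x" for x
  proof -
    have "measure ?N {y - 1<..x} = (\<integral>w. indicator {y - 1<..x} w \<partial>?N)" by simp
    also have "\<dots> = (\<integral>w. normal_density 0 (1 / sqrt 2) w *\<^sub>R indicator {y - 1<..x} w \<partial>lborel)"
      by (rule integral_density) auto
    also have "\<dots> = (LINT w : {y - 1<..x} | lborel. ?f w)"
      by (simp add: set_lebesgue_integral_def normal_density_half mult.commute)
    also have "\<dots> = integral {y - 1<..x} ?f"
    proof (rule set_borel_integral_eq_integral)
      have "set_integrable lborel {y - 1..x} ?f" by (rule borel_integrable_atLeastAtMost') (rule cont)
      then show "set_integrable lborel {y - 1<..x} ?f" by (rule set_integrable_subset) auto
    qed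
    also have "\<dots> = integral {y - 1..x} ?f"
      by (rule integral_spike_set) (auto intro: negligible_subset[of "{y - 1}"])
    finally have "cdf ?N x - cdf ?N (y - 1) = integral {y - 1..x} ?f"
      using cdf_diff_eq[OF that] by simp
    then show ?thesis by (simp add: erfc_eq_cdf algebra_simps)
  qed
  have "((\<lambda>x. integral {y - 1..x} ?f) has_real_derivative ?f y) (at y within {y - 1..y + 1})"
    by (rule integral_has_real_derivative) (auto intro: cont)
  then have "((\<lambda>x. integral {y - 1..x} ?f) has_real_derivative ?f y) (at y)"
    by (subst (asm) at_within_interior) auto
  then have "((\<lambda>x. erfc (y - 1) - 2 * integral {y - 1..x} ?f) has_real_derivative
      - (2 / sqrt pi) * exp (- y\<^sup>2)) (at y)"
    by (rule DERIV_cong[OF DERIV_diff[OF DERIV_const DERIV_cmult]]) simp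
  then show ?thesis
  proof (rule has_field_derivative_transform_within_open[where S = "{y - 1<..}"])
  qed (auto simp: eq)
qed

lemma erfc_chain:
  assumes "(g has_real_derivative g') (at x within S)"
  shows "((\<lambda>x. erfc (g x)) has_real_derivative - (2 / sqrt pi) * exp (- (g x)\<^sup>2) * g') (at x within S)"
  by (rule DERIV_chain2[OF erfc_has_derivative assms])

lemma continuous_on_erfc [continuous_intros]:
  "continuous_on S g \<Longrightarrow> continuous_on S (\<lambda>x. erfc (g x))"
  by (rule continuous_on_compose2[of UNIV erfc])
     (auto intro!: DERIV_continuous_on[where D = "\<lambda>y. - (2 / sqrt pi) * exp (- y\<^sup>2)"] erfc_has_derivative)

lemma erfc_uminus: "erfc (- y) = 2 - erfc y"
proof -
  let ?g = "\<lambda>y. erfc (- y) + erfc y"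
  have "(?g has_real_derivative 0) (at x)" for x
    by (rule derivative_eq_intros erfc_chain erfc_has_derivative refl | simp)+
  then have const: "?g x = ?g y" for x by (intro DERIV_isconst_all) auto
  have "(?g \<longlongrightarrow> 2 + 0) at_top"
    by (intro tendsto_add erfc_at_top filterlim_compose[OF erfc_at_bot] filterlim_uminus_at_bot_at_top)
  moreover have "(?g \<longlongrightarrow> ?g y) at_top" by (subst const) simp
  ultimately have "?g y = 2 + 0" by (intro tendsto_unique[of at_top ?g]) auto
  then show ?thesis by simp
qed

text \<open>
  The difference of the two sides is decreasing and tends to zero at infinity.
\<close>

lemma erfc_upper_bound:
  assumes "0 < y"
  shows "erfc y \<le> exp (- y\<^sup>2) / (y * sqrt pi)"
proof -
  let ?g = "\<lambda>y. exp (- y\<^sup>2) / (y * sqrt pi) - erfc y"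
  have "0 < ?g y"
  proof (rule DERIV_neg_imp_decreasing_at_top[where f = ?g and b = y])
    fix x assume "y \<le> x"
    with assms have x: "0 < x" by simp
    have "(?g has_real_derivative
        (exp (- x\<^sup>2) * (- 2 * x) * (x * sqrt pi) - exp (- x\<^sup>2) * sqrt pi) / (x * sqrt pi)\<^sup>2
          - (- (2 / sqrt pi) * exp (- x\<^sup>2))) (at x)"
      using x by (auto intro!: derivative_eq_intros erfc_has_derivative simp: power2_eq_square)
    moreover have "(e * (- 2 * x) * (x * r) - e * r) / (x * r)\<^sup>2 - (- (2 / r) * e) = - e / (x\<^sup>2 * r)"
      if "0 < r" for e r :: real
      using x that by (simp add: field_simps power2_eq_square)
    from this[of "sqrt pi" "exp (- x\<^sup>2)"]
    have "(exp (- x\<^sup>2) * (- 2 * x) * (x * sqrt pi) - exp (- x\<^sup>2) * sqrt pi) / (x * sqrt pi)\<^sup>2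
          - (- (2 / sqrt pi) * exp (- x\<^sup>2)) = - exp (- x\<^sup>2) / (x\<^sup>2 * sqrt pi)" by simp
    moreover have "- exp (- x\<^sup>2) / (x\<^sup>2 * sqrt pi) < 0" using x by simp
    ultimately show "\<exists>D. (?g has_real_derivative D) (at x) \<and> D < 0" by metis
  next
    have "((\<lambda>y::real. exp (- y\<^sup>2) / (y * sqrt pi)) \<longlongrightarrow> 0) at_top" by real_asymp
    from tendsto_diff[OF this erfc_at_top] show "(?g \<longlongrightarrow> 0) at_top" by simp
  qed
  then show ?thesis by simp
qed


section \<open>The inverse Gaussian kernel\<close>


text \<open>
  Completing the square, the exponent is \<open>- (s - 2 c t)\<^sup>2 / (4 t)\<close>, so for positive \<open>t\<close> this is twice the density at
  \<open>s\<close> of the normal law with mean \<open>2 c t\<close> and variance \<open>2 t\<close>.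
\<close>

definition heat :: "real \<Rightarrow> real \<Rightarrow> real \<Rightarrow> real" where
  "heat c s t = exp (c * s - c\<^sup>2 * t - s\<^sup>2 / (4 * t)) / sqrt (pi * t)"

text \<open>
  The contribution of the reflected Gaussian that a drift \<open>c\<close> adds to first-passage formulas.
\<close>

definition drift_tail :: "real \<Rightarrow> real \<Rightarrow> real \<Rightarrow> real" where
  "drift_tail c s t = exp (2 * c * s) * erfc (s / (2 * sqrt t) + c * sqrt t)"

text \<open>
  For positive \<open>c\<close> and \<open>s\<close> this is, as a function of \<open>t\<close>, the distribution function of the inverse
  Gaussian law with Laplace transform \<open>exp (- s * (sqrt (l + c\<^sup>2) - c))\<close>.
\<close>

definition ig_cdf :: "real \<Rightarrow> real \<Rightarrow> real \<Rightarrow> real" where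
  "ig_cdf c s t = (erfc (s / (2 * sqrt t) - c * sqrt t) + drift_tail c s t) / 2"

text \<open>
  For positive \<open>c\<close>, \<open>s\<close> and \<open>t\<close> this is the inverse Gaussian density
  \<open>s t^(-3/2) / (2 sqrt \<pi>) exp (c s - c\<^sup>2 t - s\<^sup>2 / (4 t))\<close> at \<open>t\<close>.
\<close>

definition ig_density :: "real \<Rightarrow> real \<Rightarrow> real \<Rightarrow> real" where
  "ig_density c s t = s / (2 * t) * heat c s t"

text \<open>
  Minus the derivative of \<open>ig_cdf\<close> in its level argument \<open>s\<close>.
\<close>

definition inverse_ig_density :: "real \<Rightarrow> real \<Rightarrow> real \<Rightarrow> real" where
  "inverse_ig_density c s t = heat c s t - c * drift_tail c s t"

lemma square_minus: "0 < t \<Longrightarrow> (s / (2 * sqrt t) - c * sqrt t)\<^sup>2 = s\<^sup>2 / (4 * t) - c * s + c\<^sup>2 * t"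
  and square_plus: "0 < t \<Longrightarrow> (s / (2 * sqrt t) + c * sqrt t)\<^sup>2 = s\<^sup>2 / (4 * t) + c * s + c\<^sup>2 * t"
  by (subst power2_diff, simp add: power_divide power_mult_distrib)
    (subst power2_sum, simp add: power_divide power_mult_distrib)

text \<open>
  Both arguments of \<open>erfc\<close> in \<open>ig_cdf\<close> produce the same kernel when differentiated: the prefactor
  \<open>exp (2 * c * s)\<close> compensates exactly the difference \<open>2 c s\<close> of their squares.
\<close>

lemma exp_minus_eq_heat:
  "0 < t \<Longrightarrow> exp (- (s / (2 * sqrt t) - c * sqrt t)\<^sup>2) = heat c s t * (sqrt pi * sqrt t)"
  by (subst square_minus) (simp_all add: heat_def real_sqrt_mult)

lemma exp_plus_eq_heat:
  assumes "0 < t"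
  shows "exp (2 * c * s) * exp (- (s / (2 * sqrt t) + c * sqrt t)\<^sup>2) = heat c s t * (sqrt pi * sqrt t)"
proof -
  have "exp (2 * c * s) * exp (- (s / (2 * sqrt t) + c * sqrt t)\<^sup>2) = exp (c * s - c\<^sup>2 * t - s\<^sup>2 / (4 * t))"
    using assms by (subst square_plus) (simp_all add: exp_add[symmetric])
  then show ?thesis using assms by (simp add: heat_def real_sqrt_mult)
qed

lemma heat_pos: "0 < t \<Longrightarrow> 0 < heat c s t"
  by (simp add: heat_def)

lemma heat_deriv_s:
  assumes "0 < t"
  shows "((\<lambda>s. heat c s t) has_real_derivative (c - s / (2 * t)) * heat c s t) (at s within S)"
proof -
  have "((\<lambda>s. c * s - c\<^sup>2 * t - s\<^sup>2 / (4 * t)) has_real_derivative c - s / (2 * t)) (at s within S)"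
    using assms by (auto intro!: derivative_eq_intros simp: field_simps)
  from DERIV_cdivide[OF DERIV_chain2[OF DERIV_exp this], of "sqrt (pi * t)"] show ?thesis
    unfolding heat_def by (rule DERIV_cong) simp
qed

lemma drift_tail_deriv_s:
  assumes "0 < t"
  shows "((\<lambda>s. drift_tail c s t) has_real_derivative 2 * c * drift_tail c s t - heat c s t) (at s within S)"
proof -
  let ?b = "s / (2 * sqrt t) + c * sqrt t"
  have b: "((\<lambda>s. s / (2 * sqrt t) + c * sqrt t) has_real_derivative 1 / (2 * sqrt t)) (at s within S)"
    by (rule DERIV_cong[OF DERIV_add[OF DERIV_cdivide[OF DERIV_ident] DERIV_const]]) simp
  have e: "((\<lambda>s. exp (2 * c * s)) has_real_derivative 2 * c * exp (2 * c * s)) (at s within S)"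
    by (auto intro!: derivative_eq_intros)
  have "2 * c * exp (2 * c * s) * erfc ?b
      + - (2 / sqrt pi) * exp (- ?b\<^sup>2) * (1 / (2 * sqrt t)) * exp (2 * c * s)
    = 2 * c * drift_tail c s t - (exp (2 * c * s) * exp (- ?b\<^sup>2)) / (sqrt pi * sqrt t)"
    by (simp add: drift_tail_def)
  also have "\<dots> = 2 * c * drift_tail c s t - heat c s t"
    using assms by (subst exp_plus_eq_heat) auto
  finally show ?thesis
    using DERIV_mult[OF e erfc_chain[OF b]] by (simp only: drift_tail_def)
qed

lemma ig_cdf_deriv_s:
  assumes "0 < t"
  shows "((\<lambda>s. ig_cdf c s t) has_real_derivative - inverse_ig_density c s t) (at s within S)"
proof -
  let ?b = "s / (2 * sqrt t) - c * sqrt t"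
  have b: "((\<lambda>s. s / (2 * sqrt t) - c * sqrt t) has_real_derivative 1 / (2 * sqrt t)) (at s within S)"
    by (rule DERIV_cong[OF DERIV_diff[OF DERIV_cdivide[OF DERIV_ident] DERIV_const]]) simp
  have "- (2 / sqrt pi) * exp (- ?b\<^sup>2) * (1 / (2 * sqrt t)) = - heat c s t"
    using assms by (subst exp_minus_eq_heat) auto
  then have "((\<lambda>s. erfc (s / (2 * sqrt t) - c * sqrt t)) has_real_derivative - heat c s t) (at s within S)"
    using erfc_chain[OF b] by simp
  from DERIV_cdivide[OF DERIV_add[OF this drift_tail_deriv_s[OF assms]], of c 2]
  show ?thesis unfolding ig_cdf_def inverse_ig_density_def
    by (rule DERIV_cong) (simp add: field_simps)
qed

text \<open>
  Read as \<open>p_s - 2 c p = - ig_density\<close>: the flux of \<open>p\<close> is an inverse Gaussian density and vanishes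
  at \<open>s = 0\<close>, which is the no-flux boundary condition.
\<close>

lemma inverse_ig_density_deriv_s:
  assumes "0 < t"
  shows "((\<lambda>s. inverse_ig_density c s t) has_real_derivative 2 * c * inverse_ig_density c s t - ig_density c s t) (at s within S)"
proof -
  have "((\<lambda>s. inverse_ig_density c s t) has_real_derivative
      (c - s / (2 * t)) * heat c s t - c * (2 * c * drift_tail c s t - heat c s t)) (at s within S)"
    unfolding inverse_ig_density_def
    by (intro DERIV_diff DERIV_cmult heat_deriv_s drift_tail_deriv_s assms)
  then show ?thesis
    by (rule DERIV_cong) (simp add: inverse_ig_density_def ig_density_def algebra_simps)
qed

lemma ig_density_deriv_s:
  assumes "0 < t"
  shows "((\<lambda>s. ig_density c s t) has_real_derivative
    (1 / (2 * t) + c * s / (2 * t) - s\<^sup>2 / (4 * t\<^sup>2)) * heat c s t) (at s within S)"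
proof -
  have "((\<lambda>s. s / (2 * t)) has_real_derivative 1 / (2 * t)) (at s within S)"
    by (rule DERIV_cdivide[OF DERIV_ident])
  from DERIV_mult[OF this heat_deriv_s[OF assms]] show ?thesis
    unfolding ig_density_def
    by (rule DERIV_cong) (use assms in \<open>simp add: field_simps power2_eq_square\<close>)
qed

lemma heat_deriv_t:
  assumes "0 < t"
  shows "((\<lambda>t. heat c s t) has_real_derivative
    (s\<^sup>2 / (4 * t\<^sup>2) - c\<^sup>2 - 1 / (2 * t)) * heat c s t) (at t within S)"
proof -
  have "((\<lambda>t. s\<^sup>2 / (4 * t)) has_real_derivative - s\<^sup>2 / (4 * t\<^sup>2)) (at t within S)"
    using assms by (auto intro!: derivative_eq_intros simp: field_simps power2_eq_square)
  then have "((\<lambda>t. c * s - c\<^sup>2 * t - s\<^sup>2 / (4 * t)) has_real_derivative s\<^sup>2 / (4 * t\<^sup>2) - c\<^sup>2) (at t within S)"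
    by (rule DERIV_cong[OF DERIV_diff[OF DERIV_diff[OF DERIV_const DERIV_cmult[OF DERIV_ident]]]]) simp
  note DERIV_chain2[OF DERIV_exp this]
  moreover have "((\<lambda>t. sqrt (pi * t)) has_real_derivative sqrt (pi * t) / (2 * t)) (at t within S)"
    using assms by (auto intro!: derivative_eq_intros simp: field_simps real_sqrt_mult)
  ultimately have "((\<lambda>t. heat c s t) has_real_derivative
      (exp (c * s - c\<^sup>2 * t - s\<^sup>2 / (4 * t)) * (s\<^sup>2 / (4 * t\<^sup>2) - c\<^sup>2) * sqrt (pi * t)
       - exp (c * s - c\<^sup>2 * t - s\<^sup>2 / (4 * t)) * (sqrt (pi * t) / (2 * t)))
       / (sqrt (pi * t) * sqrt (pi * t))) (at t within S)"
    unfolding heat_def using assms by (intro DERIV_divide) auto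
  then show ?thesis
    by (rule DERIV_cong) (use assms in \<open>simp add: heat_def field_simps del: real_sqrt_mult_self\<close>)
qed

text \<open>
  The right-hand side is the derivative of \<open>- ig_density\<close> in \<open>s\<close> from the lemma
  \<open>ig_density_deriv_s\<close>.  Together with the formula for the flux this is the equation
  \<open>p_t = p_ss - 2 c p_s\<close>.
\<close>

lemma inverse_ig_density_deriv_t:
  assumes "0 < t"
  shows "((\<lambda>t. inverse_ig_density c s t) has_real_derivative
    - (1 / (2 * t) + c * s / (2 * t) - s\<^sup>2 / (4 * t\<^sup>2)) * heat c s t) (at t within S)"
proof -
  let ?b = "s / (2 * sqrt t) + c * sqrt t"
  let ?b' = "c / (2 * sqrt t) - s / (4 * t * sqrt t)"
  have "((\<lambda>t. s / (2 * sqrt t)) has_real_derivative - s / (4 * t * sqrt t)) (at t within S)"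
    using assms by (auto intro!: derivative_eq_intros simp: field_simps)
  moreover have "((\<lambda>t. c * sqrt t) has_real_derivative c / (2 * sqrt t)) (at t within S)"
    using assms by (auto intro!: derivative_eq_intros simp: field_simps)
  ultimately have b: "((\<lambda>t. s / (2 * sqrt t) + c * sqrt t) has_real_derivative ?b') (at t within S)"
    by (rule DERIV_cong[OF DERIV_add]) simp
  have "exp (2 * c * s) * (- (2 / sqrt pi) * exp (- ?b\<^sup>2) * ?b')
      = - (2 / sqrt pi) * (exp (2 * c * s) * exp (- ?b\<^sup>2)) * ?b'" by simp
  also have "\<dots> = (s / (2 * t) - c) * heat c s t"
    using assms by (subst exp_plus_eq_heat) (auto simp: field_simps)
  finally have tail: "((\<lambda>t. drift_tail c s t) has_real_derivative (s / (2 * t) - c) * heat c s t) (at t within S)"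
    unfolding drift_tail_def using DERIV_cmult[OF erfc_chain[OF b], of "exp (2 * c * s)"] by simp
  have "((\<lambda>t. inverse_ig_density c s t) has_real_derivative
      (s\<^sup>2 / (4 * t\<^sup>2) - c\<^sup>2 - 1 / (2 * t)) * heat c s t - c * ((s / (2 * t) - c) * heat c s t))
      (at t within S)"
    unfolding inverse_ig_density_def by (intro DERIV_diff DERIV_cmult heat_deriv_t tail assms)
  then show ?thesis
    by (rule DERIV_cong) (simp add: algebra_simps power2_eq_square)
qed

lemma ig_cdf_deriv_t:
  assumes "0 < t"
  shows "((\<lambda>t. ig_cdf c s t) has_real_derivative ig_density c s t) (at t)"
proof -
  let ?a = "s / (2 * sqrt t) - c * sqrt t"
  let ?a' = "- c / (2 * sqrt t) - s / (4 * t * sqrt t)"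
  let ?b = "s / (2 * sqrt t) + c * sqrt t"
  let ?b' = "c / (2 * sqrt t) - s / (4 * t * sqrt t)"
  have 1: "((\<lambda>t. s / (2 * sqrt t)) has_real_derivative - s / (4 * t * sqrt t)) (at t)"
    using assms by (auto intro!: derivative_eq_intros simp: field_simps)
  have 2: "((\<lambda>t. c * sqrt t) has_real_derivative c / (2 * sqrt t)) (at t)"
    using assms by (auto intro!: derivative_eq_intros simp: field_simps)
  have a: "((\<lambda>t. s / (2 * sqrt t) - c * sqrt t) has_real_derivative ?a') (at t)"
    by (rule DERIV_cong[OF DERIV_diff[OF 1 2]]) simp
  have b: "((\<lambda>t. s / (2 * sqrt t) + c * sqrt t) has_real_derivative ?b') (at t)"
    by (rule DERIV_cong[OF DERIV_add[OF 1 2]]) simp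
  have alg: "(- (2 / r) * ea * a' + k * (- (2 / r) * eb * b')) / 2
      = - (1 / r) * (ea * a' + (k * eb) * b')" if "r \<noteq> 0" for r ea eb a' b' k :: real
    using that by (simp add: field_simps)
  have "(- (2 / sqrt pi) * exp (- ?a\<^sup>2) * ?a'
       + exp (2 * c * s) * (- (2 / sqrt pi) * exp (- ?b\<^sup>2) * ?b')) / 2
      = - (1 / sqrt pi) * (exp (- ?a\<^sup>2) * ?a' + (exp (2 * c * s) * exp (- ?b\<^sup>2)) * ?b')"
    by (rule alg) simp
  also have "\<dots> = ig_density c s t"
    using assms by (subst exp_plus_eq_heat, simp, subst exp_minus_eq_heat)
      (auto simp: field_simps ig_density_def)
  finally show ?thesis
    unfolding ig_cdf_def drift_tail_def
    by (intro DERIV_cong[OF DERIV_cdivide[OF DERIV_add[OF erfc_chain[OF a]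
          DERIV_cmult[OF erfc_chain[OF b], of "exp (2 * c * s)"]]]])
qed

lemma inverse_ig_density_le_heat: "0 \<le> c \<Longrightarrow> inverse_ig_density c s t \<le> heat c s t"
  by (simp add: inverse_ig_density_def drift_tail_def erfc_nonneg)

text \<open>
  The tail bound on \<open>erfc\<close> gives \<open>c * drift_tail c s t \<le> heat c s t * (c * sqrt t / b)\<close>, where
  \<open>b = s / (2 * sqrt t) + c * sqrt t\<close> is at least \<open>c * sqrt t\<close>.
\<close>

lemma inverse_ig_density_nonneg:
  assumes c: "0 < c" and s: "0 \<le> s" and t: "0 < t"
  shows "0 \<le> inverse_ig_density c s t"
proof -
  let ?b = "s / (2 * sqrt t) + c * sqrt t"
  have b: "c * sqrt t \<le> ?b" "0 < c * sqrt t" using assms by auto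
  then have "0 < ?b" by linarith
  have "drift_tail c s t \<le> exp (2 * c * s) * (exp (- ?b\<^sup>2) / (?b * sqrt pi))"
    unfolding drift_tail_def by (intro mult_left_mono erfc_upper_bound \<open>0 < ?b\<close>) simp
  also have "\<dots> = (exp (2 * c * s) * exp (- ?b\<^sup>2)) / (?b * sqrt pi)" by simp
  also have "\<dots> = heat c s t * (sqrt t / ?b)"
    using t by (subst exp_plus_eq_heat) auto
  finally have "c * drift_tail c s t \<le> heat c s t * (c * sqrt t / ?b)"
    using c by (simp add: mult_left_mono mult.left_commute[of c] flip: mult.assoc times_divide_eq_right)
  also have "\<dots> \<le> heat c s t * 1"
    using b heat_pos[OF t, of c s] by (intro mult_left_mono) auto
  finally show ?thesis by (simp add: inverse_ig_density_def)
qed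

lemma ig_cdf_zero: "ig_cdf c 0 t = 1"
  by (simp add: ig_cdf_def drift_tail_def erfc_uminus)

lemma ig_cdf_at_zero:
  assumes "0 < s"
  shows "((\<lambda>t. ig_cdf c s t) \<longlongrightarrow> 0) (at_right 0)"
proof -
  have "filterlim (\<lambda>t. s / (2 * sqrt t) - c * sqrt t) at_top (at_right 0)"
    using assms by real_asymp
  moreover have "filterlim (\<lambda>t. s / (2 * sqrt t) + c * sqrt t) at_top (at_right 0)"
    using assms by real_asymp
  ultimately have "((\<lambda>t. ig_cdf c s t) \<longlongrightarrow> (0 + exp (2 * c * s) * 0) / 2) (at_right 0)"
    unfolding ig_cdf_def drift_tail_def
    by (intro tendsto_intros filterlim_compose[OF erfc_at_top]) auto
  then show ?thesis by simp
qed

lemma ig_cdf_at_top: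
  assumes "0 < c"
  shows "((\<lambda>t. ig_cdf c s t) \<longlongrightarrow> 1) at_top"
proof -
  have "filterlim (\<lambda>t. s / (2 * sqrt t) - c * sqrt t) at_bot at_top"
    using assms by real_asymp
  moreover have "filterlim (\<lambda>t. s / (2 * sqrt t) + c * sqrt t) at_top at_top"
    using assms by real_asymp
  ultimately have "((\<lambda>t. ig_cdf c s t) \<longlongrightarrow> (2 + exp (2 * c * s) * 0) / 2) at_top"
    unfolding ig_cdf_def drift_tail_def
    by (intro tendsto_intros filterlim_compose[OF erfc_at_top] filterlim_compose[OF erfc_at_bot]) auto
  then show ?thesis by simp
qed

lemma continuous_on_heat [continuous_intros]:
  assumes "continuous_on S f" "continuous_on S g" "\<And>x. x \<in> S \<Longrightarrow> 0 < g x"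
  shows "continuous_on S (\<lambda>x. heat c (f x) (g x))"
  unfolding heat_def using assms(3)
  by (intro continuous_intros assms(1,2)) (auto dest!: assms(3) simp: less_le)

lemma continuous_on_inverse_ig_density [continuous_intros]:
  assumes "continuous_on S f" "continuous_on S g" "\<And>x. x \<in> S \<Longrightarrow> 0 < g x"
  shows "continuous_on S (\<lambda>x. inverse_ig_density c (f x) (g x))"
  unfolding inverse_ig_density_def drift_tail_def
  by (intro continuous_intros assms) (auto dest!: assms(3))

lemma continuous_on_ig_density [continuous_intros]:
  assumes "continuous_on S f" "continuous_on S g" "\<And>x. x \<in> S \<Longrightarrow> 0 < g x"
  shows "continuous_on S (\<lambda>x. ig_density c (f x) (g x))"
  unfolding ig_density_def
  by (intro continuous_intros assms) (auto dest!: assms(3))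

section \<open>The law of the subordinator\<close>

lemma ig_density_nonneg: "0 \<le> s \<Longrightarrow> 0 < t \<Longrightarrow> 0 \<le> ig_density c s t"
  using heat_pos[of t c s] by (simp add: ig_density_def)

lemma ig_density_integral:
  assumes c: "0 < c" and s: "0 < s"
  shows "has_bochner_integral lborel (\<lambda>t. indicator {0<..} t * ig_density c s t) 1"
proof -
  have A: "(((\<lambda>t. ig_cdf c s t) \<circ> real_of_ereal) \<longlongrightarrow> 0) (at_right (ereal 0))"
    using ig_cdf_at_zero[OF s, of c] by (simp add: ereal_tendsto_simps1)
  have B: "(((\<lambda>t. ig_cdf c s t) \<circ> real_of_ereal) \<longlongrightarrow> 1) (at_left \<infinity>)"
    using ig_cdf_at_top[OF c, of s] by (simp add: ereal_tendsto_simps1)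
  have cont: "isCont (ig_density c s) x" if "0 < x" for x
  proof -
    have "continuous_on {0<..} (\<lambda>t. ig_density c s t)" by (intro continuous_intros) auto
    then show ?thesis using that by (simp add: continuous_on_eq_continuous_at)
  qed
  have *: "set_integrable lborel (einterval 0 \<infinity>) (ig_density c s)"
    "(LBINT t=0..\<infinity>. ig_density c s t) = 1 - 0"
    by (rule interval_integral_FTC_nonneg[where F = "ig_cdf c s" and A = 0 and B = 1];
        use A B cont s in \<open>auto simp: ig_cdf_deriv_t ig_density_nonneg zero_ereal_def[symmetric]\<close>)+
  have "einterval 0 \<infinity> = {0<..}" by (auto simp: einterval_def)
  with * show ?thesis
    by (simp add: has_bochner_integral_iff set_integrable_def interval_lebesgue_integral_def
        set_lebesgue_integral_def)
qed

definition ig_law :: "real \<Rightarrow> real \<Rightarrow> real measure" where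
  "ig_law c s = density lborel (\<lambda>t. ennreal (indicator {0<..} t * ig_density c s t))"

lemma ig_density_borel [measurable]:
  "(\<lambda>t. indicator {0<..} t * ig_density c s t) \<in> borel_measurable borel"
proof -
  have "continuous_on {0<..} (\<lambda>t. ig_density c s t)" by (intro continuous_intros) auto
  from borel_measurable_continuous_on_indicator[OF _ this] show ?thesis by simp
qed

lemma ig_weight_nonneg: "0 < s \<Longrightarrow> 0 \<le> indicator {0<..} t * ig_density c s t"
  by (auto simp: indicator_def intro: ig_density_nonneg)

lemma ig_law_integral:
  fixes f :: "real \<Rightarrow> real"
  assumes "0 < s" and [measurable]: "f \<in> borel_measurable borel"
  shows "(\<integral>t. f t \<partial>ig_law c s) = (\<integral>t. (indicator {0<..} t * ig_density c s t) * f t \<partial>lborel)"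
  unfolding ig_law_def using assms by (subst integral_density) (auto simp: ig_weight_nonneg)

lemma prob_space_ig_law:
  assumes "0 < c" "0 < s"
  shows "prob_space (ig_law c s)"
proof
  have "emeasure (ig_law c s) (space (ig_law c s))
      = (\<integral>\<^sup>+ t. ennreal (indicator {0<..} t * ig_density c s t) \<partial>lborel)"
    by (simp add: ig_law_def emeasure_density)
  also have "\<dots> = ennreal 1"
    using ig_density_integral[OF assms] assms(2)
    by (subst nn_integral_eq_integral) (auto simp: has_bochner_integral_iff ig_weight_nonneg)
  finally show "emeasure (ig_law c s) (space (ig_law c s)) = 1" by simp
qed

text \<open>
  Tilting an inverse Gaussian density by \<open>exp (- l * t)\<close> gives a constant multiple of the inverse
  Gaussian density with parameter \<open>sqrt (l + a\<^sup>2)\<close>, which has integral 1.  The constant is the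
  Laplace transform.
\<close>

lemma ig_law_laplace:
  assumes a: "0 < a" and s: "0 < s" and l: "0 \<le> l"
  shows "(\<integral>t. exp (- l * t) \<partial>ig_law a s) = exp (- s * (- a + sqrt (l + a\<^sup>2)))"
proof -
  let ?c = "sqrt (l + a\<^sup>2)"
  have c: "0 < ?c" using a l by (simp add: add_nonneg_pos)
  have c2: "?c\<^sup>2 = l + a\<^sup>2" using l by simp
  have eq: "ig_density a s t * exp (- l * t) = exp ((a - ?c) * s) * ig_density ?c s t" for t
  proof -
    have "a * s - a\<^sup>2 * t - s\<^sup>2 / (4 * t) + (- l * t)
        = (a - ?c) * s + (?c * s - ?c\<^sup>2 * t - s\<^sup>2 / (4 * t))"
      unfolding c2 by (simp add: algebra_simps)
    then have "exp (a * s - a\<^sup>2 * t - s\<^sup>2 / (4 * t)) * exp (- l * t)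
        = exp ((a - ?c) * s) * exp (?c * s - ?c\<^sup>2 * t - s\<^sup>2 / (4 * t))"
      by (simp only: exp_add[symmetric])
    then show ?thesis by (simp add: ig_density_def heat_def)
  qed
  have "(\<integral>t. exp (- l * t) \<partial>ig_law a s)
      = (\<integral>t. exp ((a - ?c) * s) * (indicator {0<..} t * ig_density ?c s t) \<partial>lborel)"
  proof (subst ig_law_integral[OF s])
    show "(\<integral>t. indicator {0<..} t * ig_density a s t * exp (- l * t) \<partial>lborel)
        = (\<integral>t. exp ((a - ?c) * s) * (indicator {0<..} t * ig_density ?c s t) \<partial>lborel)"
    proof (rule Bochner_Integration.integral_cong[OF refl])
      fix t :: real
      show "indicator {0<..} t * ig_density a s t * exp (- l * t)
          = exp ((a - ?c) * s) * (indicator {0<..} t * ig_density ?c s t)"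
        using eq[of t] by (cases "0 < t") (simp_all del: mult_minus_left)
    qed
  qed simp
  also have "\<dots> = exp ((a - ?c) * s)"
    using ig_density_integral[OF c s] by (simp add: has_bochner_integral_iff)
  also have "(a - c) * s = - s * (- a + c)" for c by (simp add: algebra_simps)
  finally show ?thesis .
qed

lemma ig_law_atLeast:
  assumes c: "0 < c" and s: "0 < s" and t: "0 < t"
  shows "measure (ig_law c s) {t..} = 1 - ig_cdf c s t"
proof -
  interpret prob_space "ig_law c s" by (rule prob_space_ig_law[OF c s])
  have le: "ig_cdf c s t \<le> 1"
  proof (rule tendsto_lowerbound[OF ig_cdf_at_top[OF c, of s]])
    have "ig_cdf c s t \<le> ig_cdf c s x" if "t \<le> x" for x
    proof (rule DERIV_nonneg_imp_nondecreasing[OF that])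
      fix y assume "t \<le> y" "y \<le> x"
      then have "0 < y" using t by simp
      with ig_cdf_deriv_t[OF this, of c s] ig_density_nonneg[of s y c] s
      show "\<exists>d. (ig_cdf c s has_real_derivative d) (at y) \<and> 0 \<le> d" by fastforce
    qed
    then show "\<forall>\<^sub>F x in at_top. ig_cdf c s t \<le> ig_cdf c s x"
      by (rule eventually_mono[OF eventually_ge_at_top[of t]])
  qed simp
  have meas: "(\<lambda>x. ig_density c s x * indicator {0<..} x) \<in> borel_measurable borel"
    using ig_density_borel by (simp add: mult.commute)
  have "emeasure (ig_law c s) {t..}
      = (\<integral>\<^sup>+ x. ennreal (indicator {0<..} x * ig_density c s x) * indicator {t..} x \<partial>lborel)"
    unfolding ig_law_def by (subst emeasure_density) auto
  also have "\<dots> = (\<integral>\<^sup>+ x. ennreal (ig_density c s x * indicator {0<..} x) * indicator {t..} x \<partial>lborel)"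
    by (simp add: mult.commute)
  also have "\<dots> = ennreal (1 - ig_cdf c s t)"
  proof (rule nn_integral_FTC_atLeast[OF meas])
    show "DERIV (ig_cdf c s) x :> ig_density c s x * indicator {0<..} x" if "t \<le> x" for x
      using that t ig_cdf_deriv_t[of x c s] by simp
    show "0 \<le> ig_density c s x * indicator {0<..} x" if "t \<le> x" for x
      using that t s by (simp add: ig_density_nonneg)
  qed (rule ig_cdf_at_top[OF c])
  finally show ?thesis using le by (simp add: emeasure_eq_measure)
qed

lemma (in prob_space) moments_of_unit_interval:
  fixes X :: "'a \<Rightarrow> real"
  assumes [measurable]: "X \<in> borel_measurable M" and X: "AE x in M. 0 \<le> X x \<and> X x \<le> 1"
  shows "integrable M (\<lambda>x. X x ^ n)" and "(\<integral>x. \<bar>X x\<bar> ^ n \<partial>M) \<le> 1"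
proof -
  have bound: "AE x in M. \<bar>X x\<bar> ^ n \<le> 1"
    using X by eventually_elim (auto intro: power_le_one)
  show "integrable M (\<lambda>x. X x ^ n)"
    by (rule integrable_const_bound[where B = 1]) (use bound in \<open>simp_all add: power_abs\<close>)
  have "(\<integral>x. \<bar>X x\<bar> ^ n \<partial>M) \<le> (\<integral>x. 1 \<partial>M)"
  proof (rule integral_mono_AE)
    show "integrable M (\<lambda>x. \<bar>X x\<bar> ^ n)"
      by (rule integrable_const_bound[where B = 1]) (use bound in \<open>simp_all\<close>)
  qed (use bound in simp_all)
  then show "(\<integral>x. \<bar>X x\<bar> ^ n \<partial>M) \<le> 1" by (simp add: prob_space)
qed

text \<open>
  The Taylor polynomials of the two characteristic functions at zero agree, and their remainders are
  at most \<open>2 * \<bar>t\<bar> ^ n / fact n\<close> because the variables are bounded by 1.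
\<close>

lemma moments_determine_law:
  fixes X :: "'m \<Rightarrow> real" and Y :: "'n \<Rightarrow> real"
  assumes "prob_space M" "prob_space N"
    and [measurable]: "X \<in> borel_measurable M" "Y \<in> borel_measurable N"
    and X: "AE x in M. 0 \<le> X x \<and> X x \<le> 1" and Y: "AE y in N. 0 \<le> Y y \<and> Y y \<le> 1"
    and moments: "\<And>n. (\<integral>x. X x ^ n \<partial>M) = (\<integral>y. Y y ^ n \<partial>N)"
  shows "distr M borel X = distr N borel Y"
proof (rule Levy_uniqueness)
  interpret M: prob_space M by fact
  interpret N: prob_space N by fact
  show "real_distribution (distr M borel X)" "real_distribution (distr N borel Y)"
    by (auto intro!: M.real_distribution_distr N.real_distribution_distr)
  note iX = M.moments_of_unit_interval(1)[OF assms(3) X] and eX = M.moments_of_unit_interval(2)[OF assms(3) X]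
  note iY = N.moments_of_unit_interval(1)[OF assms(4) Y] and eY = N.moments_of_unit_interval(2)[OF assms(4) Y]
  show "char (distr M borel X) = char (distr N borel Y)"
  proof
    fix t
    let ?d = "cmod (char (distr M borel X) t - char (distr N borel Y) t)"
    let ?b = "\<lambda>n. 2 * \<bar>t\<bar> ^ n / fact n"
    have "?d \<le> 2 * ?b n" for n
    proof -
      let ?S = "\<Sum>k\<le>n. ((\<i> * t) ^ k / fact k) * (\<integral>x. X x ^ k \<partial>M)"
      have "cmod (char (distr M borel X) t - ?S) \<le> ?b n * (\<integral>x. \<bar>X x\<bar> ^ n \<partial>M)"
        by (rule M.char_approx1') (auto intro: iX)
      also have "\<dots> \<le> ?b n * 1" by (rule mult_left_mono[OF eX]) simp
      finally have 1: "cmod (char (distr M borel X) t - ?S) \<le> ?b n" by simp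
      have "cmod (char (distr N borel Y) t - ?S) \<le> ?b n * (\<integral>x. \<bar>Y x\<bar> ^ n \<partial>N)"
        unfolding moments by (rule N.char_approx1') (auto intro: iY)
      also have "\<dots> \<le> ?b n * 1" by (rule mult_left_mono[OF eY]) simp
      finally have 2: "cmod (char (distr N borel Y) t - ?S) \<le> ?b n" by simp
      show ?thesis
        using norm_triangle_ineq4[of "char (distr M borel X) t - ?S" "char (distr N borel Y) t - ?S"] 1 2
        by simp
    qed
    moreover have "(\<lambda>n. 4 * (inverse (fact n) * \<bar>t\<bar> ^ n)) \<longlonglongrightarrow> 4 * 0"
      by (intro tendsto_mult_left summable_LIMSEQ_zero summable_exp)
    then have "(\<lambda>n. 2 * ?b n) \<longlonglongrightarrow> 0"
      by (simp add: divide_inverse mult_ac)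
    ultimately have "?d \<le> 0"
      by (intro tendsto_lowerbound[of "\<lambda>n. 2 * ?b n" 0 sequentially] always_eventually allI) simp_all
    then show "char (distr M borel X) t = char (distr N borel Y) t" by simp
  qed
qed

text \<open>
  The Laplace transform of \<open>D s\<close> at \<open>n\<close> is the \<open>n\<close>-th moment of \<open>exp (- D s)\<close>, a variable with
  values in the unit interval.  So \<open>exp (- D s)\<close>, and with it \<open>D s\<close>, has the same law as for the
  inverse Gaussian distribution.
\<close>

lemma subordinator_law:
  assumes a: "0 < a" and D: "subordinator M D"
    and lap: "has_laplace_exponent M D (\<lambda>l. - a + sqrt (l + a\<^sup>2))"
    and s: "0 < s" and t: "0 < t"
  shows "measure M {w \<in> space M. t \<le> D s w} = 1 - ig_cdf a s t"
proof -
  have M: "prob_space M" and [measurable]: "D s \<in> borel_measurable M"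
    and D_nonneg: "\<And>w. w \<in> space M \<Longrightarrow> 0 \<le> D s w"
    using D s by (auto simp: subordinator_def levy_process_def)
  interpret M: prob_space M by fact
  interpret N: prob_space "ig_law a s" by (rule prob_space_ig_law[OF a s])
  have sets_N [measurable_cong]: "sets (ig_law a s) = sets borel" by (simp add: ig_law_def)
  have "distr M borel (\<lambda>w. exp (- D s w)) = distr (ig_law a s) borel (\<lambda>x. exp (- x))"
  proof (rule moments_determine_law)
    show "AE w in M. 0 \<le> exp (- D s w) \<and> exp (- D s w) \<le> 1" using D_nonneg by auto
    have "AE x in ig_law a s. 0 < x"
      unfolding ig_law_def by (subst AE_density, measurable) (auto simp: indicator_def)
    then show "AE x in ig_law a s. 0 \<le> exp (- x) \<and> exp (- x) \<le> 1"
      by eventually_elim auto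
    show "(\<integral>w. exp (- D s w) ^ n \<partial>M) = (\<integral>x. exp (- x) ^ n \<partial>ig_law a s)" for n
    proof (cases "n = 0")
      case False
      have "(\<integral>w. exp (- D s w) ^ n \<partial>M) = (\<integral>w. exp (- real n * D s w) \<partial>M)"
        by (simp add: exp_of_nat_mult[symmetric])
      also have "\<dots> = exp (- s * (- a + sqrt (real n + a\<^sup>2)))"
        using lap False s unfolding has_laplace_exponent_def by force
      also have "\<dots> = (\<integral>x. exp (- real n * x) \<partial>ig_law a s)"
        by (rule ig_law_laplace[OF a s, symmetric]) simp
      finally show ?thesis by (simp add: exp_of_nat_mult[symmetric])
    qed (simp add: M.prob_space N.prob_space)
  qed (auto simp: M N.prob_space_axioms)
  then have "measure (distr M borel (\<lambda>w. exp (- D s w))) {..exp (- t)}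
      = measure (distr (ig_law a s) borel (\<lambda>x. exp (- x))) {..exp (- t)}" by simp
  then have "measure M {w \<in> space M. t \<le> D s w} = measure (ig_law a s) {x. t \<le> x}"
    by (simp add: measure_distr vimage_def Int_def conj_commute ig_law_def)
  also have "{x. t \<le> x} = {t..}" by auto
  finally show ?thesis using ig_law_atLeast[OF a s t] by simp
qed

lemma inverse_density_eq:
  assumes a: "0 < a" and D: "subordinator M D"
    and lap: "has_laplace_exponent M D (\<lambda>l. - a + sqrt (l + a\<^sup>2))"
    and s: "0 < s" and t: "0 < t"
  shows "inverse_density M D s t = inverse_ig_density a s t"
proof -
  have "((\<lambda>z. 1 - ig_cdf a z t) has_real_derivative inverse_ig_density a s t) (at s)"
    using DERIV_diff[OF DERIV_const ig_cdf_deriv_s[OF t, of a s UNIV]] by simp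
  then have "((\<lambda>z. measure M {w \<in> space M. t \<le> D z w}) has_real_derivative inverse_ig_density a s t) (at s)"
    by (rule has_field_derivative_transform_within_open[where S = "{0<..}"])
       (use s subordinator_law[OF a D lap _ t] in auto)
  then show ?thesis unfolding inverse_density_def by (rule DERIV_imp_deriv)
qed

section \<open>The law of the inverse subordinator\<close>

text \<open>
  The inverse subordinator is compared below with measurable events from which it differs on the
  null set of irregular paths.
\<close>

lemma completion_measure_cong_AE:
  assumes B: "B \<in> sets M" and A: "A \<subseteq> space M"
    and eq: "AE w in M. w \<in> A \<longleftrightarrow> w \<in> B"
  shows "A \<in> sets (completion M)" and "emeasure (completion M) A = emeasure M B"
proof -
  obtain S where S: "S \<in> null_sets M" "{w \<in> space M. \<not> (w \<in> A \<longleftrightarrow> w \<in> B)} \<subseteq> S"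
    using AE_E[OF eq] by (metis null_setsI)
  have "A = (B - S) \<union> (A \<inter> S)" using A S(2) sets.sets_into_space[OF B] by blast
  then show meas: "A \<in> sets (completion M)"
    by (rule sets_completionI[where N' = S]) (use S B in auto)
  have "emeasure (completion M) A = emeasure (completion M) B"
    by (rule emeasure_eq_AE) (use eq meas B in \<open>auto simp: AE_completion_iff\<close>)
  also have "\<dots> = emeasure M B" using B by simp
  finally show "emeasure (completion M) A = emeasure M B" .
qed

text \<open>
  By monotonicity the path exceeds \<open>t\<close> at all times after its infimum and at none before.  Testing
  only the times \<open>a + 1 / Suc n\<close> makes the criterion countable, which gives measurability.
\<close>

lemma inverse_subordinator_le_iff:
  assumes mono: "mono_on {0..} (\<lambda>z. D z w)" and ex: "0 < b" "t < D b w"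
  shows "inverse_subordinator D t w \<le> a \<longleftrightarrow> 0 \<le> a \<and> (\<forall>n. t < D (a + 1 / real (Suc n)) w)"
proof -
  let ?Z = "{z. 0 < z \<and> t < D z w}"
  have ne: "?Z \<noteq> {}" using ex by blast
  have bdd: "bdd_below ?Z" by (rule bdd_belowI[of _ 0]) auto
  show ?thesis
  proof
    assume le: "inverse_subordinator D t w \<le> a"
    have "0 \<le> inverse_subordinator D t w"
      unfolding inverse_subordinator_def by (rule cInf_greatest[OF ne]) auto
    with le have a: "0 \<le> a" by simp
    have "t < D (a + 1 / real (Suc n)) w" for n
    proof -
      have "Inf ?Z < a + 1 / real (Suc n)"
        using le by (simp add: inverse_subordinator_def add_strict_increasing2 le_less_trans)
      from cInf_lessD[OF ne this] obtain z where z: "0 < z" "t < D z w" "z < a + 1 / real (Suc n)"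
        by auto
      with a have "D z w \<le> D (a + 1 / real (Suc n)) w" by (intro mono_onD[OF mono]) auto
      with z show ?thesis by simp
    qed
    with a show "0 \<le> a \<and> (\<forall>n. t < D (a + 1 / real (Suc n)) w)" by blast
  next
    assume *: "0 \<le> a \<and> (\<forall>n. t < D (a + 1 / real (Suc n)) w)"
    have "inverse_subordinator D t w \<le> a + 1 / real (Suc n)" for n
      unfolding inverse_subordinator_def by (rule cInf_lower[OF _ bdd]) (use * in \<open>auto simp: add_nonneg_pos\<close>)
    moreover have "(\<lambda>n. a + 1 / real (Suc n)) \<longlonglongrightarrow> a + 0"
      by (intro tendsto_intros LIMSEQ_Suc lim_1_over_n)
    ultimately show "inverse_subordinator D t w \<le> a"
      by (intro tendsto_lowerbound[where F = sequentially and f = "\<lambda>n. a + 1 / real (Suc n)"])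
        (auto intro: always_eventually)
  qed
qed

context
  fixes a t :: real and M :: "'w measure" and D :: "real \<Rightarrow> 'w \<Rightarrow> real"
  assumes a: "0 < a" and D: "subordinator M D"
    and lap: "has_laplace_exponent M D (\<lambda>l. - a + sqrt (l + a\<^sup>2))"
    and t: "0 < t"
begin

interpretation M: prob_space M
  using D by (simp add: subordinator_def levy_process_def)

lemma D_measurable: "0 \<le> z \<Longrightarrow> D z \<in> borel_measurable M"
  using D by (simp add: subordinator_def levy_process_def)

text \<open>
  Markov's inequality for \<open>exp (- D (Suc n))\<close>, whose expectation tends to zero.
\<close>

lemma subordinator_unbounded: "AE w in M. \<exists>n. t < D (real (Suc n)) w"
proof -
  note [measurable (raw)] = D_measurable
  let ?B = "\<lambda>n. {w \<in> space M. D (real (Suc n)) w \<le> t}"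
  have bound: "measure M (\<Inter>n. ?B n) \<le> exp t * exp (- real (Suc n) * (- a + sqrt (1 + a\<^sup>2)))" for n
  proof -
    have nn: "0 \<le> D (real (Suc n)) w" if "w \<in> space M" for w
      using D that by (simp add: subordinator_def)
    have int: "integrable M (\<lambda>w. exp (- 1 * D (real (Suc n)) w))"
      by (rule M.integrable_const_bound[where B = 1]) (use nn in auto)
    have "measure M (\<Inter>n. ?B n) \<le> measure M (?B n)"
      by (intro M.finite_measure_mono) auto
    also have "measure M (?B n) = (\<integral>w. indicator (?B n) w \<partial>M)" by simp
    also have "\<dots> \<le> (\<integral>w. exp t * exp (- 1 * D (real (Suc n)) w) \<partial>M)"
    proof (rule integral_mono)
      show "integrable M (indicat_real (?B n))" by (simp add: M.emeasure_eq_measure)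
      show "integrable M (\<lambda>w. exp t * exp (- 1 * D (real (Suc n)) w))"
        by (rule integrable_mult_right[OF int])
      show "indicat_real (?B n) w \<le> exp t * exp (- 1 * D (real (Suc n)) w)" for w
        by (auto simp: indicator_def exp_add[symmetric])
    qed
    also have "\<dots> = exp t * exp (- real (Suc n) * (- a + sqrt (1 + a\<^sup>2)))"
      using lap unfolding has_laplace_exponent_def
      by (metis integral_mult_right_zero of_nat_0_le_iff zero_less_one)
    finally show ?thesis .
  qed
  have pos: "0 < - a + sqrt (1 + a\<^sup>2)" using a by (simp add: real_less_rsqrt)
  have "(\<lambda>n. exp t * exp (- real (Suc n) * c)) \<longlonglongrightarrow> 0" if "0 < c" for c
    using that by real_asymp
  note this[OF pos]
  then have "measure M (\<Inter>n. ?B n) \<le> 0"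
    using bound by (intro tendsto_lowerbound[where F = sequentially
        and f = "\<lambda>n. exp t * exp (- real (Suc n) * (- a + sqrt (1 + a\<^sup>2)))"])
      (auto intro: always_eventually)
  then have "measure M (\<Inter>n. ?B n) = 0" using measure_nonneg[of M "\<Inter>n. ?B n"] by linarith
  then have "(\<Inter>n. ?B n) \<in> null_sets M" by (simp add: null_sets_def M.emeasure_eq_measure)
  from AE_not_in[OF this] show ?thesis
    by (rule AE_mp) (auto simp: not_le)
qed

text \<open>
  For nonnegative \<open>b\<close> the event is almost surely the intersection over \<open>n\<close> of the events \<open>t < D (b + 1 / Suc n)\<close>.  It is
  almost surely contained in each \<open>t \<le> D (b + 1 / Suc n)\<close> and, for positive \<open>b\<close>, it almost surely
  contains each \<open>t + 1 / Suc n \<le> D b\<close>.  The probabilities of these bounds converge to the same value because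
  \<open>ig_cdf\<close> is continuous in both arguments.  For \<open>b = 0\<close> that value is zero.
\<close>

lemma inverse_subordinator_cdf:
  fixes b :: real
  shows "{w \<in> space M. inverse_subordinator D t w \<le> b} \<in> sets (completion M)"
    and "emeasure (completion M) {w \<in> space M. inverse_subordinator D t w \<le> b}
      = ennreal (if b < 0 then 0 else 1 - ig_cdf a b t)"
proof -
  note [measurable (raw)] = D_measurable
  \<comment> \<open>The absolute value keeps the time index nonnegative, so that \<open>?B\<close> is measurable for negative \<open>b\<close> too.\<close>
  let ?B = "{w \<in> space M. 0 \<le> b \<and> (\<forall>n. t < D (\<bar>b\<bar> + 1 / real (Suc n)) w)}"
  have B: "?B \<in> sets M" by measurable
  \<comment> \<open>The regular paths are those which are nondecreasing and exceed \<open>t\<close> eventually.\<close>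
  have "AE w in M. mono_on {0..} (\<lambda>z. D z w)" using D by (simp add: subordinator_def)
  then have AE: "AE w in M. w \<in> {w \<in> space M. inverse_subordinator D t w \<le> b} \<longleftrightarrow> w \<in> ?B"
    using subordinator_unbounded
  proof eventually_elim
    case (elim w)
    then obtain n where "t < D (real (Suc n)) w" by blast
    from inverse_subordinator_le_iff[of D w "real (Suc n)" t b, OF elim(1) _ this]
    show ?case by (cases "0 \<le> b") auto
  qed
  note cong = completion_measure_cong_AE[OF B _ AE]
  show "{w \<in> space M. inverse_subordinator D t w \<le> b} \<in> sets (completion M)"
    by (rule cong) auto
  have "measure M ?B = (if b < 0 then 0 else 1 - ig_cdf a b t)"
  proof (cases "b < 0")
    case False
    then have b: "0 \<le> b" by simp
    have cont: "isCont (\<lambda>z. ig_cdf a z t) b"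
      by (rule DERIV_isCont[OF ig_cdf_deriv_s[OF t]])
    have lim1: "(\<lambda>n. 1 - ig_cdf a (b + 1 / real (Suc n)) t) \<longlonglongrightarrow> 1 - ig_cdf a b t"
    proof (intro tendsto_intros isCont_tendsto_compose[OF cont])
      have "(\<lambda>n. b + 1 / real (Suc n)) \<longlonglongrightarrow> b + 0"
        by (intro tendsto_intros LIMSEQ_Suc lim_1_over_n)
      then show "(\<lambda>n. b + 1 / real (Suc n)) \<longlonglongrightarrow> b" by simp
    qed
    have "measure M ?B \<le> 1 - ig_cdf a (b + 1 / real (Suc n)) t" for n
    proof -
      have "measure M ?B \<le> measure M {w \<in> space M. t \<le> D (b + 1 / real (Suc n)) w}"
        using b by (intro M.finite_measure_mono) (auto intro: less_imp_le)
      also have "\<dots> = 1 - ig_cdf a (b + 1 / real (Suc n)) t"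
        using b by (intro subordinator_law[OF a D lap _ t]) (simp add: add_nonneg_pos)
      finally show ?thesis .
    qed
    then have le: "measure M ?B \<le> 1 - ig_cdf a b t"
      by (intro tendsto_lowerbound[OF lim1] always_eventually allI) auto
    have ge: "1 - ig_cdf a b t \<le> measure M ?B"
    proof (cases "b = 0")
      case False
      with b have b: "0 < b" by simp
      have cont: "isCont (\<lambda>z. ig_cdf a b z) t"
        by (rule DERIV_isCont[OF ig_cdf_deriv_t[OF t]])
      have lim2: "(\<lambda>n. 1 - ig_cdf a b (t + 1 / real (Suc n))) \<longlonglongrightarrow> 1 - ig_cdf a b t"
      proof (intro tendsto_intros isCont_tendsto_compose[OF cont])
        have "(\<lambda>n. t + 1 / real (Suc n)) \<longlonglongrightarrow> t + 0"
          by (intro tendsto_intros LIMSEQ_Suc lim_1_over_n)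
        then show "(\<lambda>n. t + 1 / real (Suc n)) \<longlonglongrightarrow> t" by simp
      qed
      have "1 - ig_cdf a b (t + 1 / real (Suc n)) \<le> measure M ?B" for n
      proof -
        have "1 - ig_cdf a b (t + 1 / real (Suc n))
            = measure M {w \<in> space M. t + 1 / real (Suc n) \<le> D b w}"
          using t by (intro subordinator_law[OF a D lap b, symmetric]) (simp add: add_pos_pos)
        also have "\<dots> \<le> measure M ?B"
        proof (rule M.finite_measure_mono_AE[OF _ B])
          have "AE w in M. mono_on {0..} (\<lambda>z. D z w)" using D by (simp add: subordinator_def)
          then show "AE w in M. w \<in> {w \<in> space M. t + 1 / real (Suc n) \<le> D b w} \<longrightarrow> w \<in> ?B"
          proof eventually_elim
            case (elim w)
            have "t < D (b + 1 / real (Suc m)) w" if "t + 1 / real (Suc n) \<le> D b w" for m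
            proof -
              have "0 < 1 / real (Suc n)" by simp
              then have "t < D b w" using that by linarith
              also have "D b w \<le> D (b + 1 / real (Suc m)) w"
                using b by (intro mono_onD[OF elim]) (auto simp: add_nonneg_pos less_imp_le)
              finally show ?thesis .
            qed
            then show ?case using b by auto
          qed
        qed
        finally show ?thesis .
      qed
      then show ?thesis
        by (intro tendsto_upperbound[OF lim2] always_eventually allI) auto
    qed (simp add: ig_cdf_zero)
    show ?thesis using le ge False by simp
  qed simp
  then show "emeasure (completion M) {w \<in> space M. inverse_subordinator D t w \<le> b}
      = ennreal (if b < 0 then 0 else 1 - ig_cdf a b t)"
    by (subst cong(2)) (auto simp: M.emeasure_eq_measure)
qed

lemma is_inverse_density_subordinator:
  "is_inverse_density M D t (\<lambda>s. inverse_density M D s t)"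
  unfolding is_inverse_density_def
proof
  note eq = inverse_density_eq[OF a D lap _ t]
  show "\<forall>s>0. 0 \<le> inverse_density M D s t"
    by (simp add: eq inverse_ig_density_nonneg[OF a _ t])
  have "continuous_on UNIV (\<lambda>s. inverse_ig_density a s t)" using t by (intro continuous_intros) auto
  then have p_meas [measurable]: "(\<lambda>s. inverse_ig_density a s t) \<in> borel_measurable borel"
    by (rule borel_measurable_continuous_onI)
  interpret C: prob_space "completion M" by (rule M.prob_space_completion)
  have "distributed (completion M) lborel (inverse_subordinator D t)
      (\<lambda>s. ennreal (indicat_real {0<..} s * inverse_ig_density a s t))"
  proof (rule distributedI_borel_atMost)
    show "inverse_subordinator D t \<in> borel_measurable (completion M)"
      unfolding borel_measurable_iff_le using inverse_subordinator_cdf(1) by simp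
    show "AE x in lborel. 0 \<le> indicat_real {0<..} x * inverse_ig_density a x t"
      by (rule AE_I2) (auto simp: indicator_def inverse_ig_density_nonneg[OF a _ t])
    show "emeasure (completion M) {w \<in> space (completion M). inverse_subordinator D t w \<le> b}
        = ennreal (if b < 0 then 0 else 1 - ig_cdf a b t)" for b
      unfolding space_completion by (rule inverse_subordinator_cdf(2))
    show "(\<integral>\<^sup>+ x. ennreal (indicat_real {0<..} x * inverse_ig_density a x t * indicat_real {..b} x) \<partial>lborel)
        = ennreal (if b < 0 then 0 else 1 - ig_cdf a b t)" for b
    proof (cases "b < 0")
      case True
      then have "ennreal (indicat_real {0<..} x * inverse_ig_density a x t * indicat_real {..b} x) = 0" for x
        by (auto simp: indicator_def)
      then have "(\<integral>\<^sup>+ x. ennreal (indicat_real {0<..} x * inverse_ig_density a x t * indicat_real {..b} x) \<partial>lborel)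
          = (\<integral>\<^sup>+ x. 0 \<partial>(lborel :: real measure))"
        by (intro nn_integral_cong)
      then show ?thesis using True by simp
    next
      case False
      then have b: "0 \<le> b" by simp
      have "AE x in lborel. x \<noteq> (0::real)" by (rule AE_lborel_singleton)
      then have "(\<integral>\<^sup>+ x. ennreal (indicat_real {0<..} x * inverse_ig_density a x t * indicat_real {..b} x) \<partial>lborel)
          = (\<integral>\<^sup>+ x. ennreal (inverse_ig_density a x t) * indicator {0..b} x \<partial>lborel)"
        by (intro nn_integral_cong_AE) (auto elim!: eventually_mono simp: indicator_def)
      also have "\<dots> = ennreal ((- ig_cdf a b t) - (- ig_cdf a 0 t))"
      proof (rule nn_integral_FTC_Icc[OF p_meas _ _ b])
        show "((\<lambda>x. - ig_cdf a x t) has_real_derivative inverse_ig_density a x t) (at x)" for x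
          using DERIV_minus[OF ig_cdf_deriv_s[OF t, of a x UNIV]] by simp
        show "0 \<le> inverse_ig_density a x t" if "x \<in> {0..b}" for x
          using that by (simp add: inverse_ig_density_nonneg[OF a _ t])
      qed
      finally show ?thesis using False by (simp add: ig_cdf_zero)
    qed
    show "(\<lambda>s. indicat_real {0<..} s * inverse_ig_density a s t) \<in> borel_measurable borel" by measurable
  qed
  moreover have "indicat_real {0<..} s * inverse_ig_density a s t = indicat_real {0<..} s * inverse_density M D s t" for s
    by (simp add: indicator_def eq)
  ultimately show "distributed (completion M) lborel (inverse_subordinator D t)
      (\<lambda>s. ennreal (indicat_real {0<..} s * inverse_density M D s t))"
    by simp
qed

end

section \<open>Duality of the telegraph equation and the kernel\<close>

lemma integrable_exp_linear_minus_square: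
  assumes r: "0 < r"
  shows "integrable lborel (\<lambda>s::real. exp (b * s - s\<^sup>2 / (4 * r)))"
proof -
  have "exp (b * s - s\<^sup>2 / (4 * r)) = exp (r * b\<^sup>2) * sqrt (2 * pi * (2 * r)) * normal_density (2 * r * b) (sqrt (2 * r)) s" for s
  proof -
    have "- (s - 2 * r * b)\<^sup>2 / (2 * (sqrt (2 * r))\<^sup>2) = - (r * b\<^sup>2) + (b * s - s\<^sup>2 / (4 * r))"
      using r by (simp add: field_simps power2_eq_square)
    then show ?thesis
      using r by (simp add: normal_density_def exp_add[symmetric] exp_minus field_simps)
  qed
  moreover have "integrable lborel (normal_density (2 * r * b) (sqrt (2 * r)))"
    using r by (intro integrable_normal_density) simp
  ultimately show ?thesis by simp
qed

lemma integrable_heat: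
  assumes r: "0 < r"
  shows "integrable lborel (\<lambda>s. heat a s r * exp (w * s))"
proof -
  have "heat a s r * exp (w * s) = exp (- (a\<^sup>2 * r)) / sqrt (pi * r) * exp ((a + w) * s - s\<^sup>2 / (4 * r))" for s
    unfolding heat_def by (simp add: exp_add[symmetric] algebra_simps)
  then show ?thesis using integrable_exp_linear_minus_square[OF r] by simp
qed

lemma integrable_inverse_ig_density_times:
  assumes a: "0 < a" and r: "0 < r"
    and f: "continuous_on {0..} f" and bnd: "\<And>s. 0 \<le> s \<Longrightarrow> \<bar>f s\<bar> \<le> C * exp (w * s)"
  shows "integrable lborel (\<lambda>s. indicator {0..} s * (inverse_ig_density a s r * f s))"
proof (rule Bochner_Integration.integrable_bound)
  show "integrable lborel (\<lambda>s. C * (heat a s r * exp (w * s)))"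
    by (rule integrable_mult_right) (rule integrable_heat[OF r])
  have "continuous_on {0..} (\<lambda>s. inverse_ig_density a s r * f s)" using r by (intro continuous_intros f) auto
  from borel_measurable_continuous_on_indicator[OF _ this]
  show "(\<lambda>s. indicator {0..} s * (inverse_ig_density a s r * f s)) \<in> borel_measurable lborel" by simp
  show "AE s in lborel. norm (indicator {0..} s * (inverse_ig_density a s r * f s)) \<le> norm (C * (heat a s r * exp (w * s)))"
  proof (rule AE_I2)
    fix s :: real
    show "norm (indicator {0..} s * (inverse_ig_density a s r * f s)) \<le> norm (C * (heat a s r * exp (w * s)))"
    proof (cases "0 \<le> s")
      case True
      have "inverse_ig_density a s r * \<bar>f s\<bar> \<le> heat a s r * (C * exp (w * s))"
        using a r inverse_ig_density_nonneg[OF a True r] bnd[OF True] heat_pos[OF r, of a s]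
        by (intro mult_mono inverse_ig_density_le_heat) auto
      also have "\<dots> \<le> norm (C * (heat a s r * exp (w * s)))"
        using abs_ge_self[of "C * (heat a s r * exp (w * s))"] by (simp add: mult_ac)
      finally show ?thesis using True inverse_ig_density_nonneg[OF a True r] by (simp add: abs_mult)
    qed simp
  qed
qed

text \<open>
  Convolution with the telegraph kernel solves \<open>g'' + 2 a g' = h\<close> with \<open>g' = 0\<close> at zero: the kernel is a
  difference of two exponentials, so \<open>g\<close> is a combination of \<open>\<integral> h\<close> and its velocity \<open>g'\<close>.
\<close>

lemma telegraph_convolution_derivatives:
  fixes h :: "real \<Rightarrow> real"
  assumes a: "0 < a" and h: "continuous_on {0..} h"
    and g: "\<And>s. 0 \<le> s \<Longrightarrow> g s = g0 + integral {0..s} (\<lambda>r. telegraph_kernel a (s - r) * h r)"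
    and s: "0 \<le> s" "s \<le> N"
  defines "g' \<equiv> \<lambda>s. exp (- 2 * a * s) * integral {0..s} (\<lambda>r. exp (2 * a * r) * h r)"
  shows "(g has_real_derivative g' s) (at s within {0..N})"
    and "(g' has_real_derivative h s - 2 * a * g' s) (at s within {0..N})"
proof -
  have hN: "continuous_on {0..x} h" for x by (rule continuous_on_subset[OF h]) auto
  have I: "((\<lambda>s. integral {0..s} h) has_real_derivative h s) (at s within {0..N})"
    by (rule integral_has_real_derivative[OF hN]) (use s in auto)
  have J: "((\<lambda>s. integral {0..s} (\<lambda>r. exp (2 * a * r) * h r)) has_real_derivative exp (2 * a * s) * h s)
      (at s within {0..N})"
    by (rule integral_has_real_derivative[OF continuous_on_mult[OF _ hN]])
       (use s in \<open>auto intro!: continuous_intros\<close>)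
  have E: "((\<lambda>s. exp (- 2 * a * s)) has_real_derivative - 2 * a * exp (- 2 * a * s)) (at s within {0..N})"
    by (auto intro!: derivative_eq_intros)
  show g': "(g' has_real_derivative h s - 2 * a * g' s) (at s within {0..N})"
    unfolding g'_def
    by (rule DERIV_cong[OF DERIV_mult[OF E J]]) (simp add: exp_minus field_simps)
  have eq: "g x = g0 + (integral {0..x} h - g' x) / (2 * a)" if x: "0 \<le> x" for x
  proof -
    have i1: "h integrable_on {0..x}" by (rule integrable_continuous_real[OF hN])
    have i2: "(\<lambda>r. exp (2 * a * r) * h r) integrable_on {0..x}"
      by (intro integrable_continuous_real continuous_intros hN)
    have "telegraph_kernel a (x - r) * h r = (h r - exp (- 2 * a * x) * (exp (2 * a * r) * h r)) / (2 * a)" for r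
    proof -
      have "exp (- 2 * a * (x - r)) = exp (- 2 * a * x) * exp (2 * a * r)"
        by (simp add: exp_add[symmetric] algebra_simps)
      then show ?thesis using a by (simp add: telegraph_kernel_def field_simps)
    qed
    then have "integral {0..x} (\<lambda>r. telegraph_kernel a (x - r) * h r)
        = integral {0..x} (\<lambda>r. (h r - exp (- 2 * a * x) * (exp (2 * a * r) * h r)) / (2 * a))"
      by presburger
    also have "\<dots> = (integral {0..x} h - g' x) / (2 * a)"
      using i1 i2 by (simp add: g'_def Henstock_Kurzweil_Integration.integral_diff integrable_on_mult_right)
    finally show ?thesis using g[OF x] by simp
  qed
  have "((\<lambda>x. g0 + (integral {0..x} h - g' x) / (2 * a)) has_real_derivative g' s) (at s within {0..N})"
    by (rule DERIV_cong[OF DERIV_add[OF DERIV_const DERIV_cdivide[OF DERIV_diff[OF I g']]]])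
       (use a in \<open>simp add: field_simps\<close>)
  then show "(g has_real_derivative g' s) (at s within {0..N})"
    by (rule has_field_derivative_transform_within[where d = 1]) (use s eq in auto)
qed

lemma telegraph_convolution_velocity_bound:
  fixes h :: "real \<Rightarrow> real"
  assumes a: "0 < a" and h: "continuous_on {0..} h" and w: "0 \<le> w"
    and bnd: "\<And>s. 0 \<le> s \<Longrightarrow> \<bar>h s\<bar> \<le> C * exp (w * s)" and s: "0 \<le> s"
  shows "\<bar>exp (- 2 * a * s) * integral {0..s} (\<lambda>r. exp (2 * a * r) * h r)\<bar> \<le> s * (C * exp (w * s))"
proof -
  have hN: "continuous_on {0..s} h" by (rule continuous_on_subset[OF h]) auto
  have "norm (integral {0..s} (\<lambda>r. exp (2 * a * r) * h r)) \<le> exp (2 * a * s) * (C * exp (w * s)) * (s - 0)"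
  proof (rule integral_bound[OF s])
    show "continuous_on {0..s} (\<lambda>r. exp (2 * a * r) * h r)" by (intro continuous_intros hN)
    fix r assume r: "r \<in> {0..s}"
    have "0 \<le> C * exp (w * 0)" using bnd[of 0] abs_ge_zero order_trans by blast
    then have C: "0 \<le> C" by simp
    have "\<bar>h r\<bar> \<le> C * exp (w * r)" using bnd r by simp
    also have "\<dots> \<le> C * exp (w * s)" using r w C by (intro mult_left_mono) (auto intro: mult_left_mono)
    finally show "norm (exp (2 * a * r) * h r) \<le> exp (2 * a * s) * (C * exp (w * s))"
      using r a by (simp add: abs_mult) (intro mult_mono, auto)
  qed
  then have "exp (- 2 * a * s) * norm (integral {0..s} (\<lambda>r. exp (2 * a * r) * h r))
      \<le> exp (- 2 * a * s) * (exp (2 * a * s) * (C * exp (w * s)) * (s - 0))"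
    by (rule mult_left_mono) simp
  also have "\<dots> = s * (C * exp (w * s))" by (simp add: exp_minus field_simps)
  finally show ?thesis by (simp add: abs_mult)
qed

text \<open>
  Green's formula: with the flux \<open>\<kappa> = p_s - 2 a p = - ig_density\<close>, the equations \<open>p_t = \<kappa>_s\<close> and
  \<open>g'' + 2 a g' = h\<close> make \<open>p_t g - p h\<close> the derivative of \<open>\<kappa> g - p g'\<close>.  The boundary term at zero vanishes
  because neither \<open>p\<close> has flux nor \<open>g\<close> has velocity there.
\<close>

lemma inverse_ig_density_telegraph_integral:
  fixes h :: "real \<Rightarrow> real"
  assumes a: "0 < a" and h: "continuous_on {0..} h"
    and g: "\<And>s. 0 \<le> s \<Longrightarrow> g s = g0 + integral {0..s} (\<lambda>r. telegraph_kernel a (s - r) * h r)"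
    and r: "0 < r" and N: "0 \<le> N"
  defines "g' \<equiv> \<lambda>s. exp (- 2 * a * s) * integral {0..s} (\<lambda>r. exp (2 * a * r) * h r)"
    and "pt \<equiv> \<lambda>s. - (1 / (2 * r) + a * s / (2 * r) - s\<^sup>2 / (4 * r\<^sup>2)) * heat a s r"
  shows "integral {0..N} (\<lambda>s. pt s * g s - inverse_ig_density a s r * h s)
    = - (ig_density a N r * g N + inverse_ig_density a N r * g' N)"
proof -
  let ?F = "\<lambda>s. - (ig_density a s r * g s + inverse_ig_density a s r * g' s)"
  have "((\<lambda>s. pt s * g s - inverse_ig_density a s r * h s) has_integral ?F N - ?F 0) {0..N}"
  proof (rule fundamental_theorem_of_calculus[OF N])
    fix s assume s: "s \<in> {0..N}"
    note dg = telegraph_convolution_derivatives[OF a h g, of s N, folded g'_def]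
    have "(?F has_real_derivative pt s * g s - inverse_ig_density a s r * h s) (at s within {0..N})"
      by (rule DERIV_cong[OF DERIV_minus[OF DERIV_add[OF
            DERIV_mult[OF ig_density_deriv_s[OF r] dg(1)] DERIV_mult[OF inverse_ig_density_deriv_s[OF r] dg(2)]]]])
         (use s in \<open>auto simp: pt_def g'_def algebra_simps\<close>)
    then show "(?F has_vector_derivative pt s * g s - inverse_ig_density a s r * h s) (at s within {0..N})"
      by (simp add: has_real_derivative_iff_has_vector_derivative)
  qed
  \<comment> \<open>The flux vanishes at zero through its factor \<open>s\<close>, the velocity through its degenerate range of integration.\<close>
  moreover have "?F 0 = 0" by (simp add: ig_density_def g'_def)
  ultimately show ?thesis by (simp add: integral_unique)
qed

text \<open>
  Scalar functions \<open>G\<close> with \<open>G_\<rho> = H\<close> which in \<open>s\<close> solve the telegraph equation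
  \<open>G_ss + 2 a G_s = H\<close> with zero initial velocity, written in integrated form.  The time variable
  \<open>\<rho>\<close> is confined to \<open>[0, t]\<close>, where the growth bounds are uniform.
\<close>

locale telegraph_family =
  fixes a t C w :: real and G H :: "real \<Rightarrow> real \<Rightarrow> real"
  assumes a: "0 < a" and t: "0 < t" and w: "0 \<le> w"
    and G_cont: "continuous_on ({0..t} \<times> {0..}) (\<lambda>(\<rho>, s). G \<rho> s)"
    and H_cont: "continuous_on ({0..t} \<times> {0..}) (\<lambda>(\<rho>, s). H \<rho> s)"
    and G_deriv: "\<And>\<rho> s. \<rho> \<in> {0..t} \<Longrightarrow> 0 \<le> s \<Longrightarrow> ((\<lambda>\<rho>. G \<rho> s) has_real_derivative H \<rho> s) (at \<rho> within {0..t})"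
    and G_telegraph: "\<And>\<rho> s. \<rho> \<in> {0..t} \<Longrightarrow> 0 \<le> s \<Longrightarrow>
      G \<rho> s = G \<rho> 0 + integral {0..s} (\<lambda>r. telegraph_kernel a (s - r) * H \<rho> r)"
    and G_bound: "\<And>\<rho> s. \<rho> \<in> {0..t} \<Longrightarrow> 0 \<le> s \<Longrightarrow> \<bar>G \<rho> s\<bar> \<le> C * exp (w * s)"
    and H_bound: "\<And>\<rho> s. \<rho> \<in> {0..t} \<Longrightarrow> 0 \<le> s \<Longrightarrow> \<bar>H \<rho> s\<bar> \<le> C * exp (w * s)"
begin

text \<open>
  The quantity that does not depend on \<open>r \<in> (0, t]\<close>.
\<close>

definition pairing :: "real \<Rightarrow> real" where
  "pairing r = (\<integral>s. indicator {0..} s * (inverse_ig_density a s r * G (t - r) s) \<partial>lborel)"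

definition truncated_pairing :: "real \<Rightarrow> real \<Rightarrow> real" where
  "truncated_pairing N r = integral {0..N} (\<lambda>s. inverse_ig_density a s r * G (t - r) s)"

lemma C_nonneg: "0 \<le> C"
proof -
  have "0 \<le> C * exp (w * 0)" using G_bound[of 0 0] t abs_ge_zero order_trans by fastforce
  then show ?thesis by simp
qed

lemma slice_cont:
  assumes "\<rho> \<in> {0..t}"
  shows "continuous_on {0..} (\<lambda>s. G \<rho> s)" "continuous_on {0..} (\<lambda>s. H \<rho> s)"
proof -
  have pair: "continuous_on {0..} (\<lambda>s::real. (\<rho>, s))"
    by (intro continuous_on_Pair continuous_on_const continuous_on_id)
  have sub: "(\<lambda>s. (\<rho>, s)) ` {0..} \<subseteq> {0..t} \<times> {0..}" using assms by auto
  show "continuous_on {0..} (\<lambda>s. G \<rho> s)" "continuous_on {0..} (\<lambda>s. H \<rho> s)"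
    using continuous_on_compose2[OF G_cont pair sub] continuous_on_compose2[OF H_cont pair sub] by simp_all
qed

lemma pairing_integrable:
  assumes "0 < r" "r \<le> t"
  shows "integrable lborel (\<lambda>s. indicator {0..} s * (inverse_ig_density a s r * G (t - r) s))"
  by (rule integrable_inverse_ig_density_times[OF a assms(1), where C = C and w = w])
    (use assms in \<open>auto intro: G_bound slice_cont\<close>)

lemma truncated_pairing_tendsto:
  assumes r: "0 < r" "r \<le> t"
  shows "((\<lambda>N. truncated_pairing N r) \<longlongrightarrow> pairing r) at_top"
proof -
  let ?f = "\<lambda>s. inverse_ig_density a s r * G (t - r) s"
  have eq: "(\<integral>s. indicator {..N} s *\<^sub>R (indicator {0..} s * ?f s) \<partial>lborel) = truncated_pairing N r" for N
  proof -
    have "set_integrable lborel {0..N} ?f"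
    proof (rule borel_integrable_atLeastAtMost')
      have "continuous_on {0..} ?f" using r by (intro continuous_intros slice_cont) auto
      then show "continuous_on {0..N} ?f" by (rule continuous_on_subset) auto
    qed
    from set_borel_integral_eq_integral(2)[OF this]
    have "truncated_pairing N r = (\<integral>s. indicator {0..N} s *\<^sub>R ?f s \<partial>lborel)"
      by (simp add: truncated_pairing_def set_lebesgue_integral_def)
    also have "\<dots> = (\<integral>s. indicator {..N} s *\<^sub>R (indicator {0..} s * ?f s) \<partial>lborel)"
      by (intro Bochner_Integration.integral_cong) (auto simp: indicator_def)
    finally show ?thesis ..
  qed
  show ?thesis
    using tendsto_integral_at_top[OF _ pairing_integrable[OF r]] by (simp only: eq pairing_def sets_lborel)
qed

text \<open>
  Differentiation under the integral, followed by Green's formula: only the boundary term at \<open>N\<close>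
  survives.
\<close>

lemma truncated_pairing_deriv:
  assumes e: "0 < e" "e \<le> t" and N: "0 \<le> N" and r: "r \<in> {e..t}"
  shows "(truncated_pairing N has_real_derivative
     - (ig_density a N r * G (t - r) N + inverse_ig_density a N r *
        (exp (- 2 * a * N) * integral {0..N} (\<lambda>s. exp (2 * a * s) * H (t - r) s))))
    (at r within {e..t})"
proof -
  let ?pt = "\<lambda>r s. - (1 / (2 * r) + a * s / (2 * r) - s\<^sup>2 / (4 * r\<^sup>2)) * heat a s r"
  let ?fx = "\<lambda>r s. ?pt r s * G (t - r) s - inverse_ig_density a s r * H (t - r) s"
  have pos: "0 < x" if "x \<in> {e..t}" for x using that e by simp
  have *: "((\<lambda>r. integral (cbox 0 N) (\<lambda>s. inverse_ig_density a s r * G (t - r) s)) has_real_derivative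
      integral (cbox 0 N) (?fx r)) (at r within {e..t})"
  proof (rule leibniz_rule_field_derivative)
    fix x s assume x: "x \<in> {e..t}" and "s \<in> cbox 0 N"
    then have s: "0 \<le> s" by simp
    have m: "((\<lambda>r. t - r) has_real_derivative -1) (at x within {e..t})"
      by (auto intro!: derivative_eq_intros)
    have "((\<lambda>r. G r s) has_real_derivative H (t - x) s) (at (t - x) within (\<lambda>r. t - r) ` {e..t})"
      by (rule has_field_derivative_subset[OF G_deriv]) (use x s e in auto)
    from DERIV_image_chain[OF this m]
    have "((\<lambda>r. G (t - r) s) has_real_derivative - H (t - x) s) (at x within {e..t})"
      by (simp add: comp_def)
    from DERIV_mult[OF inverse_ig_density_deriv_t[OF pos[OF x], of a s "{e..t}"] this]
    show "((\<lambda>r. inverse_ig_density a s r * G (t - r) s) has_real_derivative ?fx x s) (at x within {e..t})"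
      by (rule DERIV_cong) simp
  next
    fix x assume x: "x \<in> {e..t}"
    have "continuous_on {0..} (\<lambda>s. inverse_ig_density a s x * G (t - x) s)"
      using pos[OF x] x e by (intro continuous_intros slice_cont) auto
    then show "(\<lambda>s. inverse_ig_density a s x * G (t - x) s) integrable_on cbox 0 N"
      by (intro integrable_continuous) (auto intro: continuous_on_subset)
  next
    have G: "continuous_on ({e..t} \<times> cbox 0 N) (\<lambda>z. G (t - fst z) (snd z))"
      by (rule continuous_on_compose2[OF G_cont, where f = "\<lambda>z. (t - fst z, snd z)", simplified])
         (use e in \<open>auto intro!: continuous_intros\<close>)
    have H: "continuous_on ({e..t} \<times> cbox 0 N) (\<lambda>z. H (t - fst z) (snd z))"
      by (rule continuous_on_compose2[OF H_cont, where f = "\<lambda>z. (t - fst z, snd z)", simplified])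
         (use e in \<open>auto intro!: continuous_intros\<close>)
    show "continuous_on ({e..t} \<times> cbox 0 N) (\<lambda>(r, s). ?fx r s)"
      unfolding case_prod_beta
      by (intro continuous_intros G H) (use e in auto)
  qed (use r in auto)
  have r0: "0 < r" and rt: "t - r \<in> {0..t}" using r e by auto
  have "integral {0..N} (?fx r) = - (ig_density a N r * G (t - r) N + inverse_ig_density a N r *
        (exp (- 2 * a * N) * integral {0..N} (\<lambda>s. exp (2 * a * s) * H (t - r) s)))"
    by (rule inverse_ig_density_telegraph_integral[OF a slice_cont(2)[OF rt] G_telegraph[OF rt] r0 N])
  with * show ?thesis unfolding truncated_pairing_def[abs_def] by simp
qed

text \<open>
  On \<open>[e, t]\<close> the derivative of the truncated pairing is bounded by \<open>B N\<close>, in which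
  the factor \<open>exp (- N\<^sup>2 / (4 * t))\<close> of the kernel beats the exponential growth of \<open>G\<close> and \<open>H\<close>.
\<close>

lemma pairing_const:
  assumes e: "0 < e" "e \<le> t"
  shows "pairing t = pairing e"
proof -
  define B where "B = (\<lambda>N. exp (a * N - N\<^sup>2 / (4 * t)) / sqrt (pi * e) * (N / (2 * e) + N) * (C * exp (w * N)))"
  \<comment> \<open>On \<open>[e, t]\<close> the prefactor of the kernel is largest at \<open>e\<close> and its Gaussian factor at \<open>t\<close>.\<close>
  have "norm (truncated_pairing N t - truncated_pairing N e) \<le> B N * norm (t - e)" if N: "0 \<le> N" for N
  proof (rule field_differentiable_bound[OF _ truncated_pairing_deriv[OF e N]])
    fix r assume r: "r \<in> {e..t}"
    let ?g' = "exp (- 2 * a * N) * integral {0..N} (\<lambda>s. exp (2 * a * s) * H (t - r) s)"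
    have r0: "0 < r" and rt: "t - r \<in> {0..t}" using r e by auto
    let ?h = "exp (a * N - N\<^sup>2 / (4 * t)) / sqrt (pi * e)"
    have heat: "heat a N r \<le> ?h"
      unfolding heat_def
    proof (rule frac_le)
      have "N\<^sup>2 / (4 * t) \<le> N\<^sup>2 / (4 * r)" using r r0 by (intro divide_left_mono) auto
      moreover have "0 \<le> a\<^sup>2 * r" using r0 by simp
      ultimately have "a * N - a\<^sup>2 * r - N\<^sup>2 / (4 * r) \<le> a * N - N\<^sup>2 / (4 * t)" by linarith
      then show "exp (a * N - a\<^sup>2 * r - N\<^sup>2 / (4 * r)) \<le> exp (a * N - N\<^sup>2 / (4 * t))" by simp
      show "sqrt (pi * e) \<le> sqrt (pi * r)" using r by simp
    qed (use e in auto)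
    have ig: "\<bar>ig_density a N r\<bar> \<le> ?h * (N / (2 * e))"
    proof -
      have "N / (2 * r) * heat a N r \<le> N / (2 * e) * ?h"
        using r e N r0 heat by (intro mult_mono frac_le) (auto intro: less_imp_le[OF heat_pos])
      then show ?thesis using N r0 less_imp_le[OF heat_pos[OF r0, of a N]]
        by (simp add: ig_density_def mult.commute)
    qed
    have p: "\<bar>inverse_ig_density a N r\<bar> \<le> ?h"
      using inverse_ig_density_nonneg[OF a N r0] inverse_ig_density_le_heat[of a N r] a heat by simp
    have g': "\<bar>?g'\<bar> \<le> N * (C * exp (w * N))"
      by (rule telegraph_convolution_velocity_bound[OF a slice_cont(2)[OF rt] w H_bound[OF rt] N])
    have "\<bar>ig_density a N r * G (t - r) N + inverse_ig_density a N r * ?g'\<bar>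
        \<le> \<bar>ig_density a N r\<bar> * \<bar>G (t - r) N\<bar> + \<bar>inverse_ig_density a N r\<bar> * \<bar>?g'\<bar>"
      unfolding abs_mult[symmetric] by (rule abs_triangle_ineq)
    also have "\<dots> \<le> ?h * (N / (2 * e)) * (C * exp (w * N)) + ?h * (N * (C * exp (w * N)))"
      using ig p g' G_bound[OF rt N] e N by (intro add_mono mult_mono) auto
    also have "\<dots> = B N"
    proof -
      have "x * y * z + x * (y' * z) = x * (y + y') * z" for x y y' z :: real
        by (simp add: algebra_simps)
      then show ?thesis unfolding B_def .
    qed
    finally show "norm (- (ig_density a N r * G (t - r) N + inverse_ig_density a N r * ?g')) \<le> B N" by simp
  qed (use e in auto)
  then have le: "\<forall>\<^sub>F N in at_top. norm (truncated_pairing N t - truncated_pairing N e) \<le> B N * norm (t - e)"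
    by (rule eventually_mono[OF eventually_ge_at_top])
  have "((\<lambda>N::real. N * exp (b * N - k * N\<^sup>2)) \<longlongrightarrow> 0) at_top" if "0 < b" "0 < k" for b k
    using that by real_asymp
  from this[of "a + w" "1 / (4 * t)"]
  have "((\<lambda>N. N * exp ((a + w) * N - 1 / (4 * t) * N\<^sup>2)) \<longlongrightarrow> 0) at_top" using a w t by simp
  then have "((\<lambda>N. (C / sqrt (pi * e) * (1 / (2 * e) + 1)) * (N * exp ((a + w) * N - 1 / (4 * t) * N\<^sup>2)))
      \<longlongrightarrow> 0) at_top"
    by (rule tendsto_mult_right_zero)
  moreover have "B = (\<lambda>N. (C / sqrt (pi * e) * (1 / (2 * e) + 1)) * (N * exp ((a + w) * N - 1 / (4 * t) * N\<^sup>2)))"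
  proof
    fix N
    have "exp ((a + w) * N - 1 / (4 * t) * N\<^sup>2) = exp (a * N - N\<^sup>2 / (4 * t)) * exp (w * N)"
      by (simp add: exp_add[symmetric] algebra_simps)
    moreover have "N / (2 * e) + N = (1 / (2 * e) + 1) * N" by (simp add: algebra_simps)
    ultimately show "B N = (C / sqrt (pi * e) * (1 / (2 * e) + 1)) * (N * exp ((a + w) * N - 1 / (4 * t) * N\<^sup>2))"
      unfolding B_def by (simp only: times_divide_eq_left times_divide_eq_right mult_ac)
  qed
  ultimately have "(B \<longlongrightarrow> 0) at_top" by simp
  then have "((\<lambda>N. B N * norm (t - e)) \<longlongrightarrow> 0) at_top" by (rule tendsto_mult_left_zero)
  with le have "((\<lambda>N. truncated_pairing N t - truncated_pairing N e) \<longlongrightarrow> 0) at_top" by (rule Lim_null_comparison)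
  moreover have "((\<lambda>N. truncated_pairing N t - truncated_pairing N e) \<longlongrightarrow> pairing t - pairing e) at_top"
    using e t by (intro tendsto_diff truncated_pairing_tendsto) auto
  ultimately have "pairing t - pairing e = 0" by (rule tendsto_unique[OF trivial_limit_at_top_linorder, rotated])
  then show ?thesis by simp
qed

text \<open>
  In the diffusive scaling \<open>s = 2 * sqrt r * x\<close> the kernel has a limit as \<open>r\<close> tends to zero.
\<close>

lemma pairing_substitution:
  assumes r: "0 < r"
  shows "pairing r = (\<integral>x. indicator {0..} x *
    (2 * sqrt r * inverse_ig_density a (2 * sqrt r * x) r * G (t - r) (2 * sqrt r * x)) \<partial>lborel)"
proof -
  have "pairing r = \<bar>2 * sqrt r\<bar> *\<^sub>R (\<integral>x. indicator {0..} (0 + 2 * sqrt r * x) *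
      (inverse_ig_density a (0 + 2 * sqrt r * x) r * G (t - r) (0 + 2 * sqrt r * x)) \<partial>lborel)"
    unfolding pairing_def by (rule lborel_integral_real_affine) (use r in simp)
  also have "\<dots> = (\<integral>x. 2 * sqrt r * (indicator {0..} (2 * sqrt r * x) *
      (inverse_ig_density a (2 * sqrt r * x) r * G (t - r) (2 * sqrt r * x))) \<partial>lborel)"
    using r by simp
  also have "\<dots> = (\<integral>x. indicator {0..} x *
    (2 * sqrt r * inverse_ig_density a (2 * sqrt r * x) r * G (t - r) (2 * sqrt r * x)) \<partial>lborel)"
    using r by (intro Bochner_Integration.integral_cong) (auto simp: indicator_def zero_le_mult_iff)
  finally show ?thesis .
qed

lemma scaled_heat: "0 < r \<Longrightarrow> 2 * sqrt r * heat a (2 * sqrt r * x) r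
   = 2 / sqrt pi * exp (2 * a * sqrt r * x - a\<^sup>2 * r - x\<^sup>2)"
  by (simp add: heat_def real_sqrt_mult power_mult_distrib field_simps)

text \<open>
  In the variable \<open>x\<close> the rescaled kernel tends to \<open>2 / sqrt pi * exp (- x\<^sup>2)\<close>, of integral 1 on the half
  line, and \<open>G (t - r) (2 * sqrt r * x)\<close> tends to \<open>G t 0\<close>.
\<close>

lemma pairing_tendsto:
  assumes "\<And>n. 0 < R n" "\<And>n. R n \<le> t" "R \<longlonglongrightarrow> 0"
  shows "(\<lambda>n. pairing (R n)) \<longlonglongrightarrow> G t 0"
proof -
  have gauss: "has_bochner_integral lborel (\<lambda>x. indicator {0..} x * (2 / sqrt pi * exp (- x\<^sup>2) * G t 0)) (G t 0)"
    using has_bochner_integral_mult_left[OF gaussian_moment_0, of "2 / sqrt pi * G t 0"]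
    by (simp add: mult_ac)
  let ?s = "\<lambda>n x. indicator {0..} x * (2 * sqrt (R n) * inverse_ig_density a (2 * sqrt (R n) * x) (R n)
      * G (t - R n) (2 * sqrt (R n) * x))"
  let ?b = "2 * a * sqrt t + w * (2 * sqrt t)"
  have "(\<lambda>n. \<integral>x. ?s n x \<partial>lborel) \<longlonglongrightarrow> (\<integral>x. indicator {0..} x * (2 / sqrt pi * exp (- x\<^sup>2) * G t 0) \<partial>lborel)"
  proof (rule integral_dominated_convergence[where w = "\<lambda>x. 2 / sqrt pi * C * exp (?b * x - x\<^sup>2 / (4 * (1 / 4)))"])
    show "(\<lambda>x. indicator {0..} x * (2 / sqrt pi * exp (- x\<^sup>2) * G t 0)) \<in> borel_measurable lborel"
      by measurable
    show "integrable lborel (\<lambda>x. 2 / sqrt pi * C * exp (?b * x - x\<^sup>2 / (4 * (1 / 4))))"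
      by (intro integrable_mult_right integrable_exp_linear_minus_square) simp
    show "?s n \<in> borel_measurable lborel" for n
    proof -
      have "continuous_on {0..} (\<lambda>x. G (t - R n) (2 * sqrt (R n) * x))"
        by (rule continuous_on_compose2[OF slice_cont(1)[of "t - R n"]])
           (use assms less_imp_le[OF assms(1)] in \<open>auto intro!: continuous_intros\<close>)
      then have "continuous_on {0..} (\<lambda>x. 2 * sqrt (R n) * inverse_ig_density a (2 * sqrt (R n) * x) (R n)
          * G (t - R n) (2 * sqrt (R n) * x))"
        using assms by (intro continuous_intros) auto
      from borel_measurable_continuous_on_indicator[OF _ this] show ?thesis by simp
    qed
    show "AE x in lborel. norm (?s n x) \<le> 2 / sqrt pi * C * exp (?b * x - x\<^sup>2 / (4 * (1 / 4)))" for n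
    proof (rule AE_I2)
      fix x :: real
      note r = assms(1,2)[of n]
      show "norm (?s n x) \<le> 2 / sqrt pi * C * exp (?b * x - x\<^sup>2 / (4 * (1 / 4)))"
      proof (cases "0 \<le> x")
        case True
        let ?y = "2 * sqrt (R n) * x"
        have y: "0 \<le> ?y" "?y \<le> 2 * sqrt t * x" using True r by (auto intro!: mult_right_mono)
        have "2 * sqrt (R n) * inverse_ig_density a ?y (R n) \<le> 2 * sqrt (R n) * heat a ?y (R n)"
          using a r by (intro mult_left_mono inverse_ig_density_le_heat) auto
        also have "\<dots> = 2 / sqrt pi * exp (2 * a * sqrt (R n) * x - a\<^sup>2 * R n - x\<^sup>2)"
          by (rule scaled_heat[OF r(1)])
        also have "\<dots> \<le> 2 / sqrt pi * exp (2 * a * sqrt t * x - x\<^sup>2)"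
        proof -
          have "a * ?y \<le> a * (2 * sqrt t * x)" using y(2) a by (intro mult_left_mono) auto
          moreover have "0 \<le> a\<^sup>2 * R n" using r by simp
          ultimately have "2 * a * sqrt (R n) * x - a\<^sup>2 * R n - x\<^sup>2 \<le> 2 * a * sqrt t * x - x\<^sup>2"
            by (simp add: mult_ac)
          then show ?thesis by (intro mult_left_mono) auto
        qed
        finally have 1: "2 * sqrt (R n) * inverse_ig_density a ?y (R n) \<le> 2 / sqrt pi * exp (2 * a * sqrt t * x - x\<^sup>2)" .
        have "\<bar>G (t - R n) ?y\<bar> \<le> C * exp (w * ?y)" using r y by (intro G_bound) auto
        also have "\<dots> \<le> C * exp (w * (2 * sqrt t) * x)"
          using mult_left_mono[OF y(2) w] C_nonneg by (intro mult_left_mono) (auto simp: mult_ac)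
        finally have 2: "\<bar>G (t - R n) ?y\<bar> \<le> C * exp (w * (2 * sqrt t) * x)" .
        have nn: "0 \<le> 2 * sqrt (R n) * inverse_ig_density a ?y (R n)"
          using r inverse_ig_density_nonneg[OF a y(1), of "R n"] by simp
        have "norm (?s n x) = \<bar>2 * sqrt (R n) * inverse_ig_density a ?y (R n)\<bar> * \<bar>G (t - R n) ?y\<bar>"
          using True by (simp add: abs_mult)
        also have "\<dots> = 2 * sqrt (R n) * inverse_ig_density a ?y (R n) * \<bar>G (t - R n) ?y\<bar>"
          by (simp only: abs_of_nonneg[OF nn])
        also have "\<dots> \<le> (2 / sqrt pi * exp (2 * a * sqrt t * x - x\<^sup>2)) * (C * exp (w * (2 * sqrt t) * x))"
          by (rule mult_mono[OF 1 2]) (use C_nonneg in auto)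
        also have "\<dots> = 2 / sqrt pi * C * (exp (2 * a * sqrt t * x - x\<^sup>2) * exp (w * (2 * sqrt t) * x))"
          by simp
        also have "exp (2 * a * sqrt t * x - x\<^sup>2) * exp (w * (2 * sqrt t) * x) = exp (?b * x - x\<^sup>2 / (4 * (1 / 4)))"
          by (simp add: exp_add[symmetric] algebra_simps)
        finally show ?thesis .
      qed (use C_nonneg in simp)
    qed
    show "AE x in lborel. (\<lambda>n. ?s n x) \<longlonglongrightarrow> indicator {0..} x * (2 / sqrt pi * exp (- x\<^sup>2) * G t 0)"
    proof (rule AE_I2)
      fix x :: real
      show "(\<lambda>n. ?s n x) \<longlonglongrightarrow> indicator {0..} x * (2 / sqrt pi * exp (- x\<^sup>2) * G t 0)"
      proof (cases "0 \<le> x")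
        case True
        have sq: "(\<lambda>n. sqrt (R n)) \<longlonglongrightarrow> 0" using tendsto_real_sqrt[OF assms(3)] by simp
        have tl: "drift_tail a (2 * sqrt r * x) r = exp (2 * a * (2 * sqrt r * x)) * erfc (x + a * sqrt r)" if "0 < r" for r
          using that by (simp add: drift_tail_def)
        have p_eq: "2 * sqrt r * inverse_ig_density a (2 * sqrt r * x) r
            = 2 / sqrt pi * exp (2 * a * sqrt r * x - a\<^sup>2 * r - x\<^sup>2)
              - 2 * sqrt r * a * (exp (2 * a * (2 * sqrt r * x)) * erfc (x + a * sqrt r))" if "0 < r" for r
          unfolding inverse_ig_density_def right_diff_distrib scaled_heat[OF that] tl[OF that] by simp
        have erfc_cont: "isCont erfc x" by (rule DERIV_isCont[OF erfc_has_derivative])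
        have "(\<lambda>n. x + a * sqrt (R n)) \<longlonglongrightarrow> x + a * 0" by (intro tendsto_intros sq)
        then have e: "(\<lambda>n. erfc (x + a * sqrt (R n))) \<longlonglongrightarrow> erfc x"
          by (intro isCont_tendsto_compose[OF erfc_cont]) simp
        have "(\<lambda>n. 2 / sqrt pi * exp (2 * a * sqrt (R n) * x - a\<^sup>2 * R n - x\<^sup>2)
              - 2 * sqrt (R n) * a * (exp (2 * a * (2 * sqrt (R n) * x)) * erfc (x + a * sqrt (R n))))
            \<longlonglongrightarrow> 2 / sqrt pi * exp (2 * a * 0 * x - a\<^sup>2 * 0 - x\<^sup>2)
              - 2 * 0 * a * (exp (2 * a * (2 * 0 * x)) * erfc x)"
          by (intro tendsto_intros sq e assms(3))
        then have lim_p: "(\<lambda>n. 2 * sqrt (R n) * inverse_ig_density a (2 * sqrt (R n) * x) (R n)) \<longlonglongrightarrow> 2 / sqrt pi * exp (- x\<^sup>2)"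
          using assms(1) by (simp add: p_eq)
        have "(\<lambda>n. (t - R n, 2 * sqrt (R n) * x)) \<longlonglongrightarrow> (t - 0, 2 * 0 * x)"
          by (intro tendsto_intros sq assms(3))
        then have "(\<lambda>n. (\<lambda>(\<rho>, s). G \<rho> s) (t - R n, 2 * sqrt (R n) * x)) \<longlonglongrightarrow> (\<lambda>(\<rho>, s). G \<rho> s) (t, 0)"
          using t True assms(1,2) less_imp_le[OF assms(1)]
          by (intro continuous_on_tendsto_compose[OF G_cont] always_eventually) auto
        then have "(\<lambda>n. G (t - R n) (2 * sqrt (R n) * x)) \<longlonglongrightarrow> G t 0" by simp
        from tendsto_mult[OF lim_p this] show ?thesis using True by simp
      qed simp
    qed
  qed
  then show ?thesis
    using gauss assms(1) by (simp add: pairing_substitution has_bochner_integral_iff)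
qed

theorem duality: "(\<integral>s. indicator {0..} s * (inverse_ig_density a s t * G 0 s) \<partial>lborel) = G t 0"
proof -
  define R where "R = (\<lambda>n. t / real (Suc n))"
  have R: "0 < R n" "R n \<le> t" for n using t by (simp_all add: R_def field_simps)
  have "R \<longlonglongrightarrow> 0"
    unfolding R_def by (intro LIMSEQ_Suc lim_const_over_n)
  from pairing_tendsto[OF R this] have "(\<lambda>n. pairing t) \<longlonglongrightarrow> G t 0"
    using pairing_const[OF R] by simp
  then have "pairing t = G t 0" by (simp add: LIMSEQ_const_iff)
  then show ?thesis by (simp add: pairing_def)
qed

end

section \<open>The representation formula\<close>

lemma average_tendsto:
  fixes f :: "real \<Rightarrow> real"
  assumes f: "continuous_on {0..} f" and \<rho>: "0 \<le> \<rho>"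
  shows "(\<lambda>n. integral {\<rho>..\<rho> + 1 / real (Suc n)} f * real (Suc n)) \<longlonglongrightarrow> f \<rho>"
proof -
  let ?I = "\<lambda>x. integral {\<rho>..x} f"
  let ?y = "\<lambda>n. \<rho> + 1 / real (Suc n)"
  have "continuous_on {\<rho>..\<rho> + 1} f" by (rule continuous_on_subset[OF f]) (use \<rho> in auto)
  then have "(?I has_real_derivative f \<rho>) (at \<rho> within {\<rho>..\<rho> + 1})"
    by (rule integral_has_real_derivative) auto
  then have "((\<lambda>y. (?I y - ?I \<rho>) / (y - \<rho>)) \<longlongrightarrow> f \<rho>) (at \<rho> within {\<rho>..\<rho> + 1})"
    by (simp add: has_field_derivative_iff)
  moreover have "filterlim ?y (at \<rho> within {\<rho>..\<rho> + 1}) sequentially"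
    unfolding filterlim_at
  proof
    have "?y \<longlonglongrightarrow> \<rho> + 0" by (intro tendsto_intros LIMSEQ_Suc lim_1_over_n)
    then show "?y \<longlonglongrightarrow> \<rho>" by simp
  qed (auto intro!: always_eventually)
  ultimately have "(\<lambda>n. (?I (?y n) - ?I \<rho>) / (?y n - \<rho>)) \<longlonglongrightarrow> f \<rho>"
    by (rule filterlim_compose)
  then show ?thesis by simp
qed

lemma telegraph_solution_continuous: "telegraph_solution a DA A u0 u \<Longrightarrow> continuous_on {0..} u"
  by (simp add: telegraph_solution_def)

lemma telegraph_solution_bound:
  assumes u: "telegraph_solution a DA A u0 u"
  shows "\<exists>C w. 0 \<le> w \<and> (\<forall>s\<ge>0. norm (u s) \<le> C * exp (w * s))"
proof -
  obtain C w where C: "0 < C" "\<And>s. 0 \<le> s \<Longrightarrow> norm (u s) \<le> C * exp (w * s)"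
    using u by (auto simp: telegraph_solution_def exponentially_bounded_def)
  have "norm (u s) \<le> C * exp (max w 0 * s)" if "0 \<le> s" for s
    by (rule order_trans[OF C(2)[OF that]]) (use C(1) that in \<open>auto intro!: mult_left_mono mult_right_mono\<close>)
  then have "0 \<le> max w 0 \<and> (\<forall>s\<ge>0. norm (u s) \<le> C * exp (max w 0 * s))" by simp
  then show ?thesis by blast
qed

context
  fixes a :: real
    and T :: "real \<Rightarrow> 'a::banach \<Rightarrow>\<^sub>L 'a"
    and DA :: "'a set" and A :: "'a \<Rightarrow> 'a"
    and u0 :: 'a and u :: "real \<Rightarrow> 'a" and \<phi> :: "'a \<Rightarrow> real"
  assumes a: "0 < a" and T: "C0_semigroup T" and A: "is_generator T DA A"
    and u: "telegraph_solution a DA A u0 u" and \<phi>: "bounded_linear \<phi>"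
begin

interpretation \<phi>: bounded_linear \<phi> by (rule \<phi>)

lemmas u_cont = telegraph_solution_continuous[OF u]

lemma orbit_cont: "continuous_on ({0..} \<times> {0..}) (\<lambda>(\<sigma>, s). \<phi> (T \<sigma> (u s)))"
  using \<phi>.continuous_on[OF C0_semigroup_jointly_continuous[OF T u_cont]]
  by (simp add: case_prod_beta)

lemma orbit_cont_compose:
  assumes "continuous_on S f" "continuous_on S g"
    and "\<And>z. z \<in> S \<Longrightarrow> 0 \<le> f z" "\<And>z. z \<in> S \<Longrightarrow> 0 \<le> g z"
  shows "continuous_on S (\<lambda>z. \<phi> (T (f z) (u (g z))))"
proof -
  have "(\<lambda>z. (f z, g z)) ` S \<subseteq> {0..} \<times> {0..}" using assms(3,4) by auto
  from continuous_on_compose2[OF orbit_cont continuous_on_Pair[OF assms(1,2)] this]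
  show ?thesis by (simp only: prod.case)
qed

lemma orbit_cont_time:
  shows "continuous_on {0..} (\<lambda>\<sigma>. \<phi> (T \<sigma> x))"
  by (rule \<phi>.continuous_on[OF C0_semigroup_continuous[OF T]])

lemma orbit_bound:
  "\<exists>C w. 0 \<le> w \<and> (\<forall>\<sigma> s. 0 \<le> \<sigma> \<longrightarrow> \<sigma> \<le> \<tau> \<longrightarrow> 0 \<le> s \<longrightarrow> \<bar>\<phi> (T \<sigma> (u s))\<bar> \<le> C * exp (w * s))"
proof -
  obtain C w where C: "0 \<le> w" "\<And>s. 0 \<le> s \<Longrightarrow> norm (u s) \<le> C * exp (w * s)"
    using telegraph_solution_bound[OF u] by blast
  obtain K where K: "\<And>\<sigma>. 0 \<le> \<sigma> \<Longrightarrow> \<sigma> \<le> \<tau> \<Longrightarrow> norm (T \<sigma>) \<le> K"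
    using C0_semigroup_bounded[OF T] by blast
  obtain L where L: "0 < L" "\<And>x. norm (\<phi> x) \<le> norm x * L" using \<phi>.pos_bounded by blast
  have "\<bar>\<phi> (T \<sigma> (u s))\<bar> \<le> (K * C * L) * exp (w * s)" if "0 \<le> \<sigma>" "\<sigma> \<le> \<tau>" "0 \<le> s" for \<sigma> s
  proof -
    have "0 \<le> K" using K[OF that(1,2)] norm_ge_zero order_trans by blast
    have "\<bar>\<phi> (T \<sigma> (u s))\<bar> \<le> norm (T \<sigma> (u s)) * L" using L(2)[of "T \<sigma> (u s)"] by simp
    also have "\<dots> \<le> (norm (T \<sigma>) * norm (u s)) * L" using L(1) by (intro mult_right_mono norm_blinfun) simp
    also have "\<dots> \<le> (K * (C * exp (w * s))) * L"
      using L(1) K that C \<open>0 \<le> K\<close> by (intro mult_right_mono mult_mono) auto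
    finally show ?thesis by (simp add: mult_ac)
  qed
  with C(1) show ?thesis by blast
qed

text \<open>
  This is where the generator disappears.  In \<open>u s = u0 + A y\<close> with \<open>y\<close> the convolution of the kernel
  with \<open>u\<close>, averaging the orbit turns \<open>A y\<close> into \<open>T (\<rho> + h) y - T \<rho> y\<close>, and bounded operators
  pass through the convolution integral.
\<close>

lemma orbit_average_telegraph:
  assumes \<rho>: "0 \<le> \<rho>" and h: "0 \<le> h" and s: "0 \<le> s"
  shows "integral {\<rho>..\<rho> + h} (\<lambda>\<sigma>. \<phi> (T \<sigma> (u s))) = integral {\<rho>..\<rho> + h} (\<lambda>\<sigma>. \<phi> (T \<sigma> u0))
    + integral {0..s} (\<lambda>r. telegraph_kernel a (s - r) * (\<phi> (T (\<rho> + h) (u r)) - \<phi> (T \<rho> (u r))))"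
proof -
  obtain y where y: "y \<in> DA" "u s = u0 + A y"
    and int: "has_Bochner_integral_on (\<lambda>r. telegraph_kernel a (s - r) *\<^sub>R u r) {0..s} y"
    using u s by (auto simp: telegraph_solution_def)
  have conv: "((\<lambda>r. telegraph_kernel a (s - r) * \<phi> (T \<sigma> (u r))) has_integral \<phi> (T \<sigma> y)) {0..s}" for \<sigma>
  proof -
    have "bounded_linear (\<lambda>x. \<phi> (T \<sigma> x))"
      by (rule bounded_linear_compose[OF \<phi> blinfun.bounded_linear_right])
    from has_Bochner_integral_bounded_linear[OF this int]
    have bi: "has_bochner_integral lborel (\<lambda>r. indicator {0..s} r *\<^sub>R (telegraph_kernel a (s - r) * \<phi> (T \<sigma> (u r)))) (\<phi> (T \<sigma> y))"
      by (simp add: blinfun.scaleR_right \<phi>.scaleR mult.assoc)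
    then have "set_integrable lborel {0..s} (\<lambda>r. telegraph_kernel a (s - r) * \<phi> (T \<sigma> (u r)))"
      and "(LINT r:{0..s}|lborel. telegraph_kernel a (s - r) * \<phi> (T \<sigma> (u r))) = \<phi> (T \<sigma> y)"
      by (auto simp: set_integrable_def set_lebesgue_integral_def has_bochner_integral_iff)
    then show ?thesis
      using set_borel_integral_eq_integral[of "{0..s}"] by (metis has_integral_integral)
  qed
  have gen: "((\<lambda>\<sigma>. \<phi> (T \<sigma> (A y))) has_integral \<phi> (T (\<rho> + h) y) - \<phi> (T \<rho> y)) {\<rho>..\<rho> + h}"
    using has_integral_linear[OF C0_semigroup_integral_generator[OF T A y(1) \<rho>, of "\<rho> + h"] \<phi>] h
    by (simp add: comp_def \<phi>.diff)
  have base: "((\<lambda>\<sigma>. \<phi> (T \<sigma> u0)) has_integral integral {\<rho>..\<rho> + h} (\<lambda>\<sigma>. \<phi> (T \<sigma> u0))) {\<rho>..\<rho> + h}"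
    by (intro integrable_integral integrable_continuous_real continuous_on_subset[OF orbit_cont_time])
       (use \<rho> in auto)
  have "((\<lambda>\<sigma>. \<phi> (T \<sigma> (u s))) has_integral integral {\<rho>..\<rho> + h} (\<lambda>\<sigma>. \<phi> (T \<sigma> u0))
      + (\<phi> (T (\<rho> + h) y) - \<phi> (T \<rho> y))) {\<rho>..\<rho> + h}"
    using has_integral_add[OF base gen] by (simp add: y(2) blinfun.add_right \<phi>.add)
  moreover have "integral {0..s} (\<lambda>r. telegraph_kernel a (s - r) * (\<phi> (T (\<rho> + h) (u r)) - \<phi> (T \<rho> (u r))))
      = \<phi> (T (\<rho> + h) y) - \<phi> (T \<rho> y)"
    using has_integral_diff[OF conv conv, of "\<rho> + h" \<rho>]
    by (intro integral_unique) (simp add: right_diff_distrib)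
  ultimately show ?thesis by (simp add: integral_unique)
qed

text \<open>
  The averages \<open>G \<rho> s = \<integral>_\<rho>^(\<rho>+h) \<phi>(T \<sigma> (u s)) d\<sigma>\<close> form a telegraph family with
  \<open>H \<rho> s = \<phi>(T (\<rho> + h) (u s)) - \<phi>(T \<rho> (u s))\<close>, to which the conservation law applies.
\<close>

lemma orbit_average_duality:
  assumes t: "0 < t" and h: "0 < h"
  shows "(\<integral>s. indicator {0..} s * (inverse_ig_density a s t * integral {0..h} (\<lambda>\<sigma>. \<phi> (T \<sigma> (u s)))) \<partial>lborel)
    = integral {t..t + h} (\<lambda>\<sigma>. \<phi> (T \<sigma> u0))"
proof -
  define F where "F = (\<lambda>\<sigma> s. \<phi> (T \<sigma> (u s)))"
  obtain C w where w: "0 \<le> w"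
    and C: "\<And>\<sigma> s. 0 \<le> \<sigma> \<Longrightarrow> \<sigma> \<le> t + h \<Longrightarrow> 0 \<le> s \<Longrightarrow> \<bar>F \<sigma> s\<bar> \<le> C * exp (w * s)"
    unfolding F_def using orbit_bound[of "t + h"] by metis
  have "0 \<le> C * exp (w * 0)" using order_trans[OF abs_ge_zero C[of 0 0]] t h by simp
  then have C0: "0 \<le> C" by simp
  define G where "G = (\<lambda>\<rho> s. integral {\<rho>..\<rho> + h} (\<lambda>\<sigma>. F \<sigma> s))"
  define H where "H = (\<lambda>\<rho> s. F (\<rho> + h) s - F \<rho> s)"
  have F_time: "continuous_on {0..} (\<lambda>\<sigma>. F \<sigma> s)" for s
    unfolding F_def by (rule orbit_cont_time)
  have G_shift: "G \<rho> s = integral {0..h} (\<lambda>\<sigma>. F (\<rho> + \<sigma>) s)" if "0 \<le> \<rho>" for \<rho> s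
  proof -
    have "continuous_on {0 + \<rho>..h + \<rho>} (\<lambda>\<sigma>. F \<sigma> s)"
      by (rule continuous_on_subset[OF F_time]) (use that in auto)
    from integral_shift[OF this] show ?thesis by (simp add: G_def comp_def add.commute)
  qed
  have G0: "G \<rho> 0 = integral {\<rho>..\<rho> + h} (\<lambda>\<sigma>. \<phi> (T \<sigma> u0))" if "0 \<le> \<rho>" for \<rho>
    using orbit_average_telegraph[OF that _ order_refl, of h] h by (simp add: G_def F_def)
  \<comment> \<open>The average satisfies the bound \<open>h * C\<close> and the difference \<open>2 * C\<close>; the sum serves for both.\<close>
  interpret telegraph_family a t "(h + 2) * C" w G H
  proof
    show "continuous_on ({0..t} \<times> {0..}) (\<lambda>(\<rho>, s). G \<rho> s)"
    proof -
      have "continuous_on (({0..t} \<times> {0..}) \<times> cbox 0 h) (\<lambda>(z, \<sigma>). F (fst z + \<sigma>) (snd z))"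
        unfolding case_prod_beta F_def by (intro orbit_cont_compose continuous_intros) auto
      from integral_continuous_on_param[OF this]
      have "continuous_on ({0..t} \<times> {0..}) (\<lambda>z. integral {0..h} (\<lambda>\<sigma>. F (fst z + \<sigma>) (snd z)))" by simp
      then show ?thesis by (rule continuous_on_eq) (auto simp: G_shift)
    qed
    show "continuous_on ({0..t} \<times> {0..}) (\<lambda>(\<rho>, s). H \<rho> s)"
    proof -
      have "continuous_on ({0..t} \<times> {0..}) (\<lambda>z. F (fst z + h) (snd z))"
        unfolding F_def by (intro orbit_cont_compose continuous_intros) (use h in auto)
      moreover have "continuous_on ({0..t} \<times> {0..}) (\<lambda>z. F (fst z) (snd z))"
        unfolding F_def by (intro orbit_cont_compose continuous_intros) auto
      ultimately show ?thesis unfolding H_def case_prod_beta by (intro continuous_on_diff)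
    qed
    fix \<rho> s :: real assume \<rho>: "\<rho> \<in> {0..t}" and s: "0 \<le> s"
    show "((\<lambda>\<rho>. G \<rho> s) has_real_derivative H \<rho> s) (at \<rho> within {0..t})"
    proof -
      let ?I = "\<lambda>x. integral {0..x} (\<lambda>\<sigma>. F \<sigma> s)"
      have F0: "continuous_on {0..x} (\<lambda>\<sigma>. F \<sigma> s)" for x
        by (rule continuous_on_subset[OF F_time]) auto
      have I: "(?I has_real_derivative F x s) (at x within {0..t + h})" if "x \<in> {0..t + h}" for x
        using F0 that by (rule integral_has_real_derivative)
      have I\<rho>: "(?I has_real_derivative F \<rho> s) (at \<rho> within {0..t})"
        by (rule has_field_derivative_subset[OF I]) (use \<rho> h in auto)
      have "(?I has_real_derivative F (\<rho> + h) s) (at (\<rho> + h) within (\<lambda>\<rho>. \<rho> + h) ` {0..t})"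
        by (rule has_field_derivative_subset[OF I]) (use \<rho> h in auto)
      moreover have "((\<lambda>\<rho>. \<rho> + h) has_real_derivative 1) (at \<rho> within {0..t})"
        by (auto intro!: derivative_eq_intros)
      ultimately have "((\<lambda>\<rho>. ?I (\<rho> + h)) has_real_derivative F (\<rho> + h) s) (at \<rho> within {0..t})"
        using DERIV_image_chain[of ?I "F (\<rho> + h) s" "\<lambda>\<rho>. \<rho> + h" \<rho> "{0..t}" 1]
        by (simp only: comp_def mult_1_right)
      from DERIV_diff[OF this I\<rho>]
      have "((\<lambda>\<rho>. ?I (\<rho> + h) - ?I \<rho>) has_real_derivative H \<rho> s) (at \<rho> within {0..t})"
        unfolding H_def .
      moreover have "?I (x + h) - ?I x = G x s" if "x \<in> {0..t}" for x
      proof -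
        have "?I x + integral {x..x + h} (\<lambda>\<sigma>. F \<sigma> s) = ?I (x + h)"
          using that h by (intro Henstock_Kurzweil_Integration.integral_combine integrable_continuous_real F0) auto
        then show ?thesis by (simp add: G_def)
      qed
      ultimately show ?thesis
        using has_field_derivative_transform_within[OF _ zero_less_one \<rho>, of "\<lambda>\<rho>. ?I (\<rho> + h) - ?I \<rho>" "H \<rho> s" "\<lambda>\<rho>. G \<rho> s"]
        by blast
    qed
    show "G \<rho> s = G \<rho> 0 + integral {0..s} (\<lambda>r. telegraph_kernel a (s - r) * H \<rho> r)"
      using orbit_average_telegraph[of \<rho> h s] \<rho> h s G0[of \<rho>] by (simp add: G_def F_def H_def)
    have D: "0 \<le> C * exp (w * s)" using C0 by simp
    have "norm (integral {\<rho>..\<rho> + h} (\<lambda>\<sigma>. F \<sigma> s)) \<le> C * exp (w * s) * (\<rho> + h - \<rho>)"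
    proof (rule integral_bound)
      show "continuous_on {\<rho>..\<rho> + h} (\<lambda>\<sigma>. F \<sigma> s)"
        by (rule continuous_on_subset[OF F_time]) (use \<rho> in auto)
    qed (use C \<rho> h s in auto)
    also have "\<dots> \<le> (h + 2) * C * exp (w * s)" using D h by (simp add: algebra_simps)
    finally show "\<bar>G \<rho> s\<bar> \<le> (h + 2) * C * exp (w * s)" by (simp add: G_def)
    have "\<bar>H \<rho> s\<bar> \<le> C * exp (w * s) + C * exp (w * s)"
      unfolding H_def by (rule order_trans[OF abs_triangle_ineq4 add_mono]) (use C \<rho> h s in auto)
    also have "\<dots> \<le> (h + 2) * C * exp (w * s)"
      using mult_nonneg_nonneg[OF less_imp_le[OF h] D] by (simp add: algebra_simps)
    finally show "\<bar>H \<rho> s\<bar> \<le> (h + 2) * C * exp (w * s)" .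
  qed (use a t w in auto)
  from duality show ?thesis using G0[of t] t by (simp add: G_def F_def)
qed

text \<open>
  The averages over an interval of length \<open>1 / Suc n\<close>, divided by this length, converge to the
  orbits themselves, and the exponential bound on the orbits dominates the integrands.
\<close>

lemma functional_duality:
  assumes t: "0 < t"
  shows "(\<integral>s. indicator {0..} s * (inverse_ig_density a s t * \<phi> (u s)) \<partial>lborel) = \<phi> (T t u0)"
proof -
  let ?J = "\<lambda>h s. integral {0..h} (\<lambda>\<sigma>. \<phi> (T \<sigma> (u s)))"
  let ?h = "\<lambda>n. 1 / real (Suc n)"
  obtain C w where w: "0 \<le> w"
    and C: "\<And>\<sigma> s. 0 \<le> \<sigma> \<Longrightarrow> \<sigma> \<le> 1 \<Longrightarrow> 0 \<le> s \<Longrightarrow> \<bar>\<phi> (T \<sigma> (u s))\<bar> \<le> C * exp (w * s)"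
    using orbit_bound[of 1] by metis
  have J_cont: "continuous_on {0..} (\<lambda>s. ?J h s)" if "0 \<le> h" for h
  proof -
    have "continuous_on ({0..} \<times> cbox 0 h) (\<lambda>(s, \<sigma>). \<phi> (T \<sigma> (u s)))"
      unfolding case_prod_beta by (intro orbit_cont_compose continuous_intros) auto
    from integral_continuous_on_param[OF this] show ?thesis by simp
  qed
  have J_bound: "\<bar>?J (?h n) s * real (Suc n)\<bar> \<le> C * exp (w * s)" if "0 \<le> s" for n s
  proof -
    have h1: "?h n \<le> 1" by simp
    have "norm (?J (?h n) s) \<le> C * exp (w * s) * (?h n - 0)"
    proof (rule integral_bound)
      show "continuous_on {0..?h n} (\<lambda>\<sigma>. \<phi> (T \<sigma> (u s)))"
        by (rule continuous_on_subset[OF orbit_cont_time]) auto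
      fix \<sigma> assume "\<sigma> \<in> {0..?h n}"
      then have "0 \<le> \<sigma>" "\<sigma> \<le> ?h n" by auto
      then have "0 \<le> \<sigma>" "\<sigma> \<le> 1" using order_trans[OF _ h1] by blast+
      then show "norm (\<phi> (T \<sigma> (u s))) \<le> C * exp (w * s)" using C that by simp
    qed simp
    then show ?thesis by (simp add: abs_mult field_simps del: of_nat_Suc)
  qed
  have "(\<lambda>n. \<integral>s. indicator {0..} s * (inverse_ig_density a s t * (?J (?h n) s * real (Suc n))) \<partial>lborel)
      \<longlonglongrightarrow> (\<integral>s. indicator {0..} s * (inverse_ig_density a s t * \<phi> (u s)) \<partial>lborel)"
  proof (rule integral_dominated_convergence[where w = "\<lambda>s. indicator {0..} s * (inverse_ig_density a s t * (C * exp (w * s)))"])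
    have p_cont: "continuous_on {0..} (\<lambda>s. inverse_ig_density a s t)" using t by (intro continuous_intros) auto
    have meas: "(\<lambda>s. indicator {0..} s * (inverse_ig_density a s t * f s)) \<in> borel_measurable lborel"
      if "continuous_on {0..} f" for f
      using borel_measurable_continuous_on_indicator[OF _ continuous_on_mult[OF p_cont that]] by simp
    show "(\<lambda>s. indicator {0..} s * (inverse_ig_density a s t * \<phi> (u s))) \<in> borel_measurable lborel"
      by (intro meas \<phi>.continuous_on u_cont)
    show "(\<lambda>s. indicator {0..} s * (inverse_ig_density a s t * (?J (?h n) s * real (Suc n)))) \<in> borel_measurable lborel" for n
      by (intro meas continuous_intros J_cont) simp
    have "0 \<le> C * exp (w * 0)" using order_trans[OF abs_ge_zero C[of 0 0]] by simp
    then have "0 \<le> C" by simp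
    then show "integrable lborel (\<lambda>s. indicator {0..} s * (inverse_ig_density a s t * (C * exp (w * s))))"
      by (intro integrable_inverse_ig_density_times[OF a t, where C = C and w = w] continuous_intros) auto
    show "AE s in lborel. norm (indicator {0..} s * (inverse_ig_density a s t * (?J (?h n) s * real (Suc n))))
        \<le> indicator {0..} s * (inverse_ig_density a s t * (C * exp (w * s)))" for n
    proof (rule AE_I2)
      fix s :: real
      show "norm (indicator {0..} s * (inverse_ig_density a s t * (?J (?h n) s * real (Suc n))))
        \<le> indicator {0..} s * (inverse_ig_density a s t * (C * exp (w * s)))"
      proof (cases "0 \<le> s")
        case True
        have p: "0 \<le> inverse_ig_density a s t" by (rule inverse_ig_density_nonneg[OF a True t])
        show ?thesis
          using mult_left_mono[OF J_bound[OF True, of n] p] True p by (simp add: abs_mult)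
      qed simp
    qed
    show "AE s in lborel. (\<lambda>n. indicator {0..} s * (inverse_ig_density a s t * (?J (?h n) s * real (Suc n))))
        \<longlonglongrightarrow> indicator {0..} s * (inverse_ig_density a s t * \<phi> (u s))"
    proof (rule AE_I2)
      fix s :: real
      have "(\<lambda>n. ?J (?h n) s * real (Suc n)) \<longlonglongrightarrow> \<phi> (T 0 (u s))"
        using average_tendsto[OF orbit_cont_time[of "u s"] order_refl] by simp
      then show "(\<lambda>n. indicator {0..} s * (inverse_ig_density a s t * (?J (?h n) s * real (Suc n))))
        \<longlonglongrightarrow> indicator {0..} s * (inverse_ig_density a s t * \<phi> (u s))"
        by (intro tendsto_intros) (simp add: C0_semigroup_zero[OF T])
    qed
  qed
  moreover have "(\<integral>s. indicator {0..} s * (inverse_ig_density a s t * (?J (?h n) s * real (Suc n))) \<partial>lborel)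
      = integral {t..t + ?h n} (\<lambda>\<sigma>. \<phi> (T \<sigma> u0)) * real (Suc n)" for n
  proof -
    have "(\<integral>s. indicator {0..} s * (inverse_ig_density a s t * (?J (?h n) s * real (Suc n))) \<partial>lborel)
        = (\<integral>s. indicator {0..} s * (inverse_ig_density a s t * ?J (?h n) s) \<partial>lborel) * real (Suc n)"
      unfolding mult.assoc[symmetric] by (rule integral_mult_left_zero)
    then show ?thesis using orbit_average_duality[OF t, of "?h n"] by simp
  qed
  moreover have "(\<lambda>n. integral {t..t + ?h n} (\<lambda>\<sigma>. \<phi> (T \<sigma> u0)) * real (Suc n)) \<longlonglongrightarrow> \<phi> (T t u0)"
    by (rule average_tendsto[OF orbit_cont_time]) (use t in simp)
  ultimately show ?thesis using LIMSEQ_unique by simp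
qed

end

text \<open>
  The kernel decays like a Gaussian and \<open>u\<close> grows at most exponentially, so the integral exists; its
  value is determined by bounded linear functionals.
\<close>

lemma telegraph_subordination:
  fixes T :: "real \<Rightarrow> 'a::banach \<Rightarrow>\<^sub>L 'a"
  assumes a: "0 < a" and T: "C0_semigroup T" and A: "is_generator T DA A"
    and u: "telegraph_solution a DA A u0 u" and t: "0 < t"
  shows "has_Bochner_integral_on (\<lambda>s. inverse_ig_density a s t *\<^sub>R u s) {0<..} (T t u0)"
proof -
  let ?f = "\<lambda>s. inverse_ig_density a s t *\<^sub>R u s"
  note u_cont = telegraph_solution_continuous[OF u]
  obtain C w where C: "\<And>s. 0 \<le> s \<Longrightarrow> norm (u s) \<le> C * exp (w * s)"
    using telegraph_solution_bound[OF u] by blast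
  have f_cont: "continuous_on {0..} ?f"
    using t by (intro continuous_intros u_cont) auto
  have "integrable lborel (\<lambda>s. indicator {0..} s * (inverse_ig_density a s t * norm (u s)))"
    by (rule integrable_inverse_ig_density_times[OF a t, where C = C and w = w])
       (use C in \<open>auto intro!: continuous_intros u_cont\<close>)
  then have "(\<integral>\<^sup>+ s. ennreal (norm (indicator {0..} s * (inverse_ig_density a s t * norm (u s)))) \<partial>lborel) < \<infinity>"
    by (simp only: integrable_iff_bounded)
  moreover have "(\<integral>\<^sup>+ s. ennreal (indicator {0<..} s * norm (?f s)) \<partial>lborel)
      \<le> (\<integral>\<^sup>+ s. ennreal (norm (indicator {0..} s * (inverse_ig_density a s t * norm (u s)))) \<partial>lborel)"
    by (intro nn_integral_mono ennreal_leI) (auto simp: indicator_def abs_mult)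
  ultimately have "(\<integral>\<^sup>+ s. ennreal (indicator {0<..} s * norm (?f s)) \<partial>lborel) < \<infinity>"
    by (rule le_less_trans[rotated])
  from has_Bochner_integral_continuous[OF f_cont this]
  obtain W where W: "has_Bochner_integral_on ?f {0<..} W" by blast
  have "W = T t u0"
  proof (rule functionals_separate)
    fix \<phi> :: "'a \<Rightarrow> real" assume \<phi>: "bounded_linear \<phi>"
    interpret \<phi>: bounded_linear \<phi> by fact
    have "\<phi> W = (\<integral>s. \<phi> (indicat_real {0<..} s *\<^sub>R ?f s) \<partial>lborel)"
      using has_Bochner_integral_bounded_linear[OF \<phi> W] by (simp add: has_bochner_integral_iff)
    also have "\<dots> = (\<integral>s. indicator {0..} s * (inverse_ig_density a s t * \<phi> (u s)) \<partial>lborel)"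
    proof (rule integral_cong_AE)
      have greaterThan_subset_atLeast: "{0<..} \<subseteq> {0::real..}" by auto
      have m: "(\<lambda>s. indicator S s * (inverse_ig_density a s t * \<phi> (u s))) \<in> borel_measurable lborel"
        if "S \<subseteq> {0..}" "S \<in> sets borel" for S
      proof -
        have "continuous_on S (\<lambda>s. inverse_ig_density a s t * \<phi> (u s))"
          using t continuous_on_subset[OF u_cont that(1)]
          by (intro continuous_intros \<phi>.continuous_on) auto
        from borel_measurable_continuous_on_indicator[OF that(2) this] show ?thesis by simp
      qed
      show "(\<lambda>s. \<phi> (indicat_real {0<..} s *\<^sub>R ?f s)) \<in> borel_measurable lborel"
        using m[of "{0<..}"] by (simp add: \<phi>.scaleR mult.assoc greaterThan_subset_atLeast)
      show "(\<lambda>s. indicator {0..} s * (inverse_ig_density a s t * \<phi> (u s))) \<in> borel_measurable lborel"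
        by (rule m) auto
      have "AE s in lborel. s \<noteq> (0::real)" by (rule AE_lborel_singleton)
      then show "AE s in lborel. \<phi> (indicat_real {0<..} s *\<^sub>R ?f s) = indicator {0..} s * (inverse_ig_density a s t * \<phi> (u s))"
        by eventually_elim (auto simp: indicator_def \<phi>.scaleR \<phi>.zero)
    qed
    also have "\<dots> = \<phi> (T t u0)" by (rule functional_duality[OF a T A u \<phi> t])
    finally show "\<phi> W = \<phi> (T t u0)" .
  qed
  with W show ?thesis by simp
qed

theorem theorem3p1:
  fixes a :: real
    and T :: "real \<Rightarrow> 'a::banach \<Rightarrow>\<^sub>L 'a"
    and DA :: "'a set" and A :: "'a \<Rightarrow> 'a"
    and u0 :: 'a and u v :: "real \<Rightarrow> 'a"
    and M :: "'w measure" and D :: "real \<Rightarrow> 'w \<Rightarrow> real"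
  assumes "0 < a"
    and "C0_semigroup T"
    and "is_generator T DA A"
    and "telegraph_solution a DA A u0 u"
    and "\<And>t. 0 \<le> t \<Longrightarrow> v t = T t u0"
    and "subordinator M D"
    and "has_laplace_exponent M D (\<lambda>l. - a + sqrt (l + a\<^sup>2))"
  shows "\<forall>t>0. is_inverse_density M D t (\<lambda>s. inverse_density M D s t) \<and>
           has_Bochner_integral_on (\<lambda>s. inverse_density M D s t *\<^sub>R u s) {0<..} (v t)"
proof (intro allI impI conjI)
  fix t :: real assume t: "0 < t"
  show "is_inverse_density M D t (\<lambda>s. inverse_density M D s t)"
    by (rule is_inverse_density_subordinator[OF assms(1,6,7) t])
  have "indicat_real {0<..} s *\<^sub>R inverse_density M D s t *\<^sub>R u s
      = indicat_real {0<..} s *\<^sub>R inverse_ig_density a s t *\<^sub>R u s" for s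
    using inverse_density_eq[OF assms(1,6,7) _ t, of s] by (simp add: indicator_def)
  moreover have "has_Bochner_integral_on (\<lambda>s. inverse_ig_density a s t *\<^sub>R u s) {0<..} (v t)"
    using telegraph_subordination[OF assms(1-4) t] assms(5)[of t] t by simp
  ultimately show "has_Bochner_integral_on (\<lambda>s. inverse_density M D s t *\<^sub>R u s) {0<..} (v t)"
    by (simp only:)
qed

end
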